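(* Let $a$ be an integer. The progression $\{11184810h+a : h=0,1,2,\dots\}$ is a longest quasi-non-representable infinite arithmetic progression if and only if $a\in\{509203, 762701, 992077, 1247173, 1254341, 1330207, 1330319, 1730653, 1730681, 1976473, 2313487, 2344211, 2554843, 3177553, 3292241, 3419789, 3423373, 3661529, 3661543, 3784439, 4384979, 4442323, 4506097, 4507889, 4626967, 5049251, 5050147, 6610811, 7117807, 7576559, 7629217, 8086751, 8101087, 8252819, 8253043, 8643209, 9053711, 9053767, 9545351, 9560713, 9666029, 10219379, 10280827, 10581097, 10609769, 10702091, 10913233, 10913681\}$.
   Context: $\mathcal{U}$ denotes the set of positive odd integers $n$ that cannot be written as $n=p+2^k$ with $p$ a prime and $k$ a positive integer. An infinite arithmetic progression $\{mh+a : h=0,1,2,\dots\}$ with $m$ a positive integer is called quasi-non-representable if $a>0$ and $\{mh+a : h=0,1,\dots\}\setminus\mathcal{U}$ has asymptotic density zero. A quasi-non-representable progression $\{mh+a : h\ge0\}$ is called longest if there is no quasi-non-representable progression $\{m'h+a' : h\ge 0\}$ of which $\{mh+a : h\ge 0\}$ is a proper subset. Asymptotic density of a set $A$ of positive integers is $\lim |A\cap[1,x]|/x$. *)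

theory Defs
  imports Complex_Main "HOL-Computational_Algebra.Primes"
begin

definition has_asymptotic_density :: "int set \<Rightarrow> real \<Rightarrow> bool" where
  "has_asymptotic_density A d \<longleftrightarrow>
     ((\<lambda>x::real. real (card {n \<in> A. 1 \<le> n \<and> real_of_int n \<le> x}) / x) \<longlongrightarrow> d) at_top"

definition nonrepresentable :: "int set" where
  "nonrepresentable = {n. 0 < n \<and> odd n \<and>
     \<not> (\<exists>(p::nat) (k::nat). prime p \<and> 0 < k \<and> n = int p + 2 ^ k)}"

definition progression :: "int \<Rightarrow> int \<Rightarrow> int set" where
  "progression m a = {m * int h + a | h. True}"

(* A progression determines its modulus and first term (gap and minimum), so stating
   the following properties in terms of the pair (m, a) is unambiguous. *)

definition quasi_nonrepresentable :: "int \<Rightarrow> int \<Rightarrow> bool" where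
  "quasi_nonrepresentable m a \<longleftrightarrow> 0 < m \<and> 0 < a \<and>
     has_asymptotic_density (progression m a - nonrepresentable) 0"

definition longest_quasi_nonrepresentable :: "int \<Rightarrow> int \<Rightarrow> bool" where
  "longest_quasi_nonrepresentable m a \<longleftrightarrow> quasi_nonrepresentable m a \<and>
     \<not> (\<exists>m' a'. quasi_nonrepresentable m' a' \<and> progression m a \<subset> progression m' a')"

end

theory Submission
  imports Defs "HOL-Number_Theory.Number_Theory" "HOL-Computational_Algebra.Squarefree"
    "HOL-Library.FuncSet" "HOL-Real_Asymp.Real_Asymp"
begin

text \<open>If \<open>a - 2 ^ k\<close> shares a prime factor with the modulus \<open>m\<close> for every \<open>k\<close>, then a representation
  \<open>p + 2 ^ k\<close> in the class of \<open>a\<close> forces \<open>p\<close> to divide \<open>m\<close>, so the representable members have density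
  zero. Conversely, if some \<open>a - 2 ^ k\<close> is coprime to \<open>m\<close>, the primes congruent to \<open>a - 2 ^ k\<close> modulo
  \<open>m\<close> have at least their expected order (Dirichlet's theorem in Mertens form, by Shapiro's method),
  and Romanov's second-moment argument shows that the sums \<open>p + 2 ^ k\<close> fill a positive proportion
  of the class: coincidences are bounded by a Selberg sieve for prime pairs, averaged by means of the
  convergence of the sum of \<open>1 / (d ord(d))\<close> over odd \<open>d\<close>, where \<open>ord(d)\<close> is the order of 2 modulo
  \<open>d\<close>. So a progression of even squarefree modulus and odd first term is quasi-non-representable
  exactly when the classes of exponents \<open>k\<close> cut out by the prime factors of \<open>m\<close> cover all integers.
  For \<open>11184810 = 2 \<cdot> 3 \<cdot> 5 \<cdot> 7 \<cdot> 13 \<cdot> 17 \<cdot> 241\<close> the relevant orders are 2, 4, 3, 12, 8, 24; the coverings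
  are found by a finite search, and each of the 48 uses all six odd primes, whence maximality.\<close>


section \<open>Chebyshev and Mertens estimates, Moebius sums\<close>

text \<open>The modulus is twice the radical of
  \<open>2 ^ 24 - 1 = 3^2 * 5 * 7 * 13 * 17 * 241\<close>, so the covering condition depends on the
  exponent modulo 24 only. The factor 2 takes care of parity: a quasi-non-representable progression
  contains no infinite progression of even numbers, so its modulus is even and its first term odd. A
  progression containing the given one has a modulus dividing 11184810, hence squarefree; for such
  moduli a single prime factor separates Dirichlet characters, and the powers of 2 are periodic from
  exponent 1 on. The obstacle in the converse half is that prime pairs with difference
  \<open>h\<close> are bounded only up to the factor \<open>prime_ratio h\<close>, which is
  unbounded. The differences that occur are \<open>2 ^ k * (2 ^ j - 1)\<close>, with factor
  \<open>2 * prime_ratio (2 ^ j - 1)\<close>, and a linear bound for the sum of these over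
  \<open>j\<close> is enough. For primes in a residue class the order of magnitude
  \<open>N / ln N\<close> suffices; it comes from comparing the Mertens sums up to \<open>N\<close>
  and up to \<open>N / D\<close> for one large constant \<open>D\<close>.\<close>

lemma sum_divisors_swap:
  fixes f :: "nat \<Rightarrow> nat \<Rightarrow> 'a :: comm_monoid_add"
  shows "(\<Sum>n=1..N. \<Sum>d | d dvd n. f d (n div d)) = (\<Sum>d=1..N. \<Sum>e=1..N div d. f d e)"
proof -
  have fin: "finite {d. d dvd n}" if "n \<in> {1..N}" for n
    using that by (intro finite_divisors_nat) auto
  have "(\<Sum>n=1..N. \<Sum>d | d dvd n. f d (n div d)) = (\<Sum>(n,d)\<in>(SIGMA n:{1..N}. {d. d dvd n}). f d (n div d))"
    using fin by (intro sum.Sigma) auto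
  also have "\<dots> = (\<Sum>(d,e)\<in>(SIGMA d:{1..N}. {1..N div d}). f d e)"
  proof (rule sum.reindex_bij_witness[of _ "\<lambda>(d,e). (d * e, d)" "\<lambda>(n,d). (d, n div d)"], goal_cases)
    case (2 z)
    then obtain n d where z: "z = (n, d)" "1 \<le> n" "n \<le> N" "d dvd n" by auto
    then have "d \<le> n" "d > 0" by (auto simp: dvd_imp_le intro!: Nat.gr0I)
    then show ?case using z by (auto simp: div_le_mono dvd_div_ge_1)
  next
    case (4 z)
    then obtain d e where z: "z = (d, e)" "1 \<le> d" "1 \<le> e" "e \<le> N div d" by auto
    then have "d * e \<le> d * (N div d)" by simp
    also have "\<dots> \<le> N" by simp
    finally show ?case using z by (simp add: Suc_le_eq)
  qed auto
  also have "\<dots> = (\<Sum>d=1..N. \<Sum>e=1..N div d. f d e)"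
    by (intro sum.Sigma[symmetric]) auto
  finally show ?thesis .
qed

lemma ln_fact_eq_sum: "ln (fact n) = (\<Sum>k=1..n. ln (real k))"
proof (induction n)
  case (Suc n)
  have "ln (fact (Suc n) :: real) = ln (real (Suc n) * fact n)" by simp
  also have "\<dots> = ln (real (Suc n)) + ln (fact n)" by (intro ln_mult_pos) auto
  finally show ?case using Suc by simp
qed simp

lemma ln_fact_eq_mangoldt: "ln (fact N) = (\<Sum>d=1..N. mangoldt d * real (N div d))"
proof -
  have "ln (fact N :: real) = (\<Sum>n=1..N. \<Sum>d | d dvd n. mangoldt d)"
    unfolding ln_fact_eq_sum by (intro sum.cong refl) (subst mangoldt_sum, auto)
  also have "\<dots> = (\<Sum>d=1..N. mangoldt d * real (N div d))"
    by (subst sum_divisors_swap) (simp add: mult.commute)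
  finally show ?thesis .
qed

text \<open>Chebyshev's argument: \<open>ln (2 * n choose n)\<close> expands into the
  \<open>mangoldt d\<close> with weights \<open>2 * n div d - 2 * (n div d)\<close>, which are
  non-negative and at least 1 for \<open>n < d \<le> 2 * n\<close>, while the binomial coefficient
  is at most \<open>2 ^ (2 * n)\<close>.\<close>

lemma mangoldt_sum_doubling: "(\<Sum>d=1..2*n. mangoldt d) \<le> (\<Sum>d=1..n. mangoldt d) + 2 * real n"
proof -
  have "(\<Sum>d\<in>{n<..2*n}. mangoldt d) \<le> (\<Sum>d=1..2*n. mangoldt d * (real (2 * n div d) - 2 * real (n div d)))"
  proof -
    have ge: "real (2 * n div d) - 2 * real (n div d) \<ge> 0" for d
    proof -
      have "2 * (n div d) \<le> 2 * n div d" by (metis div_mult1_eq le_add1)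
      then have "real (2 * (n div d)) \<le> real (2 * n div d)" by (rule of_nat_mono)
      then show ?thesis by simp
    qed
    have "(\<Sum>d\<in>{n<..2*n}. mangoldt d) \<le> (\<Sum>d\<in>{n<..2*n}. mangoldt d * (real (2 * n div d) - 2 * real (n div d)))"
    proof (rule sum_mono)
      fix d assume "d \<in> {n<..2*n}"
      then have "n div d = 0" "2 * n div d \<ge> 1" by (auto simp: Suc_le_eq div_greater_zero_iff)
      then show "mangoldt d \<le> mangoldt d * (real (2 * n div d) - 2 * real (n div d))"
        using mangoldt_nonneg[of d] by (simp add: mult_le_cancel_left1)
    qed
    also have "\<dots> \<le> (\<Sum>d=1..2*n. mangoldt d * (real (2 * n div d) - 2 * real (n div d)))"
      using ge by (intro sum_mono2) (auto simp: mangoldt_nonneg)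
    finally show ?thesis .
  qed
  also have "\<dots> = ln (fact (2 * n)) - 2 * (\<Sum>d=1..2*n. mangoldt d * real (n div d))"
    unfolding ln_fact_eq_mangoldt by (simp add: algebra_simps sum_subtractf sum_distrib_left)
  also have "(\<Sum>d=1..2*n. mangoldt d * real (n div d)) = ln (fact n)"
    unfolding ln_fact_eq_mangoldt by (intro sum.mono_neutral_right) auto
  also have "ln (fact (2 * n)) - 2 * ln (fact n) = ln (real (2 * n choose n))"
    using binomial_fact[of n "2 * n", where 'a = real]
    by (simp add: ln_div ln_mult)
  also have "\<dots> \<le> ln (2 ^ (2 * n))"
  proof -
    have "real (2 * n choose n) \<le> real (2 ^ (2 * n))" using binomial_le_pow2 by (rule of_nat_mono)
    then show ?thesis by simp
  qed
  also have "\<dots> \<le> 2 * real n"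
    using ln_2_less_1 by (simp add: ln_realpow mult_left_le)
  finally have "(\<Sum>d\<in>{n<..2*n}. mangoldt d) \<le> 2 * real n" .
  moreover have "{1..2*n} = {1..n} \<union> {n<..2*n}" by auto
  then have "(\<Sum>d=1..2*n. mangoldt d :: real) = (\<Sum>d=1..n. mangoldt d) + (\<Sum>d\<in>{n<..2*n}. mangoldt d)"
    by (simp add: sum.union_disjoint ivl_disj_int)
  ultimately show ?thesis by simp
qed

text \<open>Doubling alone gives the constant 2. The surplus pays for odd
  \<open>n = 2 * k + 1\<close>, which is rounded up to \<open>2 * (k + 1)\<close>: the resulting
  \<open>6 * (k + 1)\<close> is at most \<open>4 * (2 * k + 1)\<close> once
  \<open>k \<ge> 1\<close>.\<close>

lemma chebyshev_upper_bound: "(\<Sum>d=1..n. mangoldt d) \<le> 4 * real n"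
proof (induction n rule: less_induct)
  case (less n)
  consider "n = 0" | "n = 1" | k where "n = 2 * k" "k \<ge> 1" | k where "n = 2 * k + 1" "k \<ge> 1"
  proof -
    have "n = 2 * (n div 2) \<or> n = 2 * (n div 2) + 1" by presburger
    then show ?thesis using that by (cases "n div 2 \<ge> 1") auto
  qed
  then show ?case
  proof cases
    case (3 k)
    then show ?thesis using mangoldt_sum_doubling[of k] less.IH[of k] by simp
  next
    case (4 k)
    have "(\<Sum>d=1..n. mangoldt d :: real) \<le> (\<Sum>d=1..2*(k+1). mangoldt d)"
      using 4 by (intro sum_mono2) (auto simp: mangoldt_nonneg)
    also have "\<dots> \<le> (\<Sum>d=1..k+1. mangoldt d) + 2 * real (k + 1)" by (rule mangoldt_sum_doubling)
    also have "(\<Sum>d=1..k+1. mangoldt d) \<le> 4 * real (k + 1)" using 4 by (intro less.IH) auto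
    finally show ?thesis using 4 by simp
  qed auto
qed

lemma ln_fact_le: "ln (fact n) \<le> real n * ln (real n)"
proof -
  have "(\<Sum>k=1..n. ln (real k)) \<le> (\<Sum>k=1..n. ln (real n))" by (intro sum_mono) auto
  then show ?thesis by (simp add: ln_fact_eq_sum)
qed

lemma real_mult_ln_Suc_diff_le:
  assumes "n \<ge> 1"
  shows "real n * (ln (real (Suc n)) - ln (real n)) \<le> 1"
proof -
  have "ln (real (Suc n)) - ln (real n) = ln (1 + 1 / real n)"
  proof -
    have "1 + 1 / real n = real (Suc n) / real n" using assms by (simp add: field_simps)
    then show ?thesis using assms by (simp add: ln_div del: of_nat_Suc)
  qed
  also have "\<dots> \<le> 1 / real n" by (rule ln_add_one_self_le_self) simp
  finally show ?thesis using assms by (simp add: field_simps)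
qed

lemma ln_fact_ge: "real n * ln (real n) - real n \<le> ln (fact n)"
proof (induction n)
  case (Suc n)
  show ?case
  proof (cases "n = 0")
    case False
    have "ln (fact (Suc n) :: real) = ln (fact n) + ln (real (Suc n))"
      by (simp add: ln_fact_eq_sum del: fact_Suc)
    then show ?thesis using Suc real_mult_ln_Suc_diff_le[of n] False by (simp add: algebra_simps del: fact_Suc)
  qed simp
qed simp

text \<open>\<open>ln (fact N)\<close> is estimated twice: it lies between
  \<open>N * ln N - N\<close> and \<open>N * ln N\<close>, and it is \<open>N\<close> times the sum
  in question up to the rounding in \<open>N div d\<close>, which costs at most the Chebyshev bound
  \<open>4 * N\<close>.\<close>

lemma mertens_mangoldt:
  assumes "N \<ge> 1"
  shows "\<bar>(\<Sum>d=1..N. mangoldt d / real d) - ln (real N)\<bar> \<le> 4"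
proof -
  define S where "S = (\<Sum>d=1..N. mangoldt d / real d)"
  have div: "real N / real d - 1 \<le> real (N div d)" "real (N div d) \<le> real N / real d" if "d \<ge> 1" for d
  proof -
    have "real N = real d * real (N div d) + real (N mod d)"
      by (simp only: of_nat_mult[symmetric] of_nat_add[symmetric]) simp
    moreover have "real (N mod d) \<le> real d" using that by (simp add: less_imp_le)
    ultimately show "real N / real d - 1 \<le> real (N div d)" "real (N div d) \<le> real N / real d"
      using that by (simp_all add: field_simps)
  qed
  have "ln (fact N) \<le> (\<Sum>d=1..N. mangoldt d * (real N / real d))"
    unfolding ln_fact_eq_mangoldt using div by (intro sum_mono mult_left_mono) (auto simp: mangoldt_nonneg)
  also have "\<dots> = real N * S" by (simp add: S_def sum_distrib_left mult_ac)
  finally have "real N * ln (real N) - real N \<le> real N * S" using ln_fact_ge[of N] by linarith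
  then have "real N * (ln (real N) - 1) \<le> real N * S" by (simp add: algebra_simps)
  then have lo: "ln (real N) - 1 \<le> S" by (rule mult_left_le_imp_le) (use assms in simp)
  have "(\<Sum>d=1..N. mangoldt d * (real N / real d - 1)) \<le> ln (fact N)"
    unfolding ln_fact_eq_mangoldt using div by (intro sum_mono mult_left_mono) (auto simp: mangoldt_nonneg)
  moreover have "(\<Sum>d=1..N. mangoldt d * (real N / real d - 1)) = real N * S - (\<Sum>d=1..N. mangoldt d)"
    by (simp add: S_def sum_distrib_left sum_subtractf algebra_simps)
  ultimately have "real N * S \<le> real N * (ln (real N) + 4)"
    using ln_fact_le[of N] chebyshev_upper_bound[of N] by (simp add: algebra_simps)
  then have "S \<le> ln (real N) + 4" by (rule mult_left_le_imp_le) (use assms in simp)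
  with lo show ?thesis by (simp add: S_def)
qed

section \<open>Moebius sums as alternating sums over sets of primes\<close>

lemma squarefree_eq_prod_prime_factors:
  fixes m :: nat
  assumes "squarefree m" "m > 0"
  shows "\<Prod>(prime_factors m) = m"
proof -
  have "\<Prod>(prime_factors m) = (\<Prod>p\<in>prime_factors m. p ^ multiplicity p m)"
  proof (rule prod.cong)
    fix p assume "p \<in> prime_factors m"
    then have "multiplicity p m = 1"
      using assms squarefree_factorial_semiring''[of m] by (auto simp: prime_factors_multiplicity le_Suc_eq)
    then show "p = p ^ multiplicity p m" by simp
  qed simp
  also have "\<dots> = m" using assms(2) by (subst prod_prime_factors) auto
  finally show ?thesis .
qed

definition moebius :: "nat \<Rightarrow> real" where
  "moebius n = (if squarefree n then (-1) ^ card (prime_factors n) else 0)"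

lemma abs_moebius_le_1: "\<bar>moebius n\<bar> \<le> 1"
  by (simp add: moebius_def power_abs)

lemma prime_dvd_prod_primes_iff:
  fixes p :: nat
  assumes "finite E" "\<And>p. p \<in> E \<Longrightarrow> prime p" "prime p"
  shows "p dvd \<Prod>E \<longleftrightarrow> p \<in> E"
proof
  assume "p dvd \<Prod>E"
  then obtain q where "q \<in> E" "p dvd q"
    using assms(1,3) prime_dvd_prod_iff[of E p "\<lambda>x. x"] by blast
  then show "p \<in> E" using assms(2,3) primes_dvd_imp_eq[of p q] by simp
next
  assume "p \<in> E"
  then show "p dvd \<Prod>E" using dvd_prodI[of E p "\<lambda>x. x"] assms(1) by simp
qed

lemma prime_factors_prod_primes:
  fixes P :: "nat set"
  assumes "finite P" "\<And>p. p \<in> P \<Longrightarrow> prime p"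
  shows "prime_factors (\<Prod>P) = P"
proof -
  have "\<Prod>P > 0" using assms prime_gt_0_nat by (auto intro!: prod_pos)
  then have "prime_factors (\<Prod>P) = {p. prime p \<and> p dvd \<Prod>P}"
    by (intro prime_factors_dvd) simp
  moreover have "prime p \<and> p dvd \<Prod>P \<longleftrightarrow> p \<in> P" for p
    using assms prime_dvd_prod_primes_iff[of P p] by blast
  ultimately show ?thesis by blast
qed

text \<open>The divisors with non-zero Moebius value are exactly the products of sets of prime
  factors of \<open>n\<close>, with the parity of the set as sign. In this form the sum is open to
  induction on the set of primes.\<close>

lemma sum_moebius:
  fixes g :: "nat \<Rightarrow> real"
  assumes "n > 0"
  shows "(\<Sum>d | d dvd n. moebius d * g d) = (\<Sum>S\<in>Pow (prime_factors n). (-1) ^ card S * g (\<Prod>S))"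
proof -
  have S: "finite S" "\<And>p. p \<in> S \<Longrightarrow> prime p" if "S \<in> Pow (prime_factors n)" for S
    using that by (auto intro: finite_subset[of S "prime_factors n"])
  have pf: "prime_factors (\<Prod>S) = S" if "S \<in> Pow (prime_factors n)" for S
    using S[OF that] by (rule prime_factors_prod_primes)
  have inj: "inj_on (\<lambda>S. \<Prod>S) (Pow (prime_factors n))"
    using pf by (intro inj_on_inverseI[of _ prime_factors]) simp
  have sqf: "squarefree (\<Prod>S)" if "S \<in> Pow (prime_factors n)" for S
    using S[OF that] by (intro squarefree_prod_coprime) (auto intro: primes_coprime squarefree_prime)
  have img: "(\<lambda>S. \<Prod>S) ` Pow (prime_factors n) = {d. d dvd n \<and> squarefree d}"
  proof (intro equalityI subsetI)
    fix d assume "d \<in> (\<lambda>S. \<Prod>S) ` Pow (prime_factors n)"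
    then obtain S where S': "S \<in> Pow (prime_factors n)" "d = \<Prod>S" by auto
    have "\<Prod>S dvd \<Prod>(prime_factors n)" using S' by (intro prod_dvd_prod_subset) auto
    also have "\<dots> dvd (\<Prod>p\<in>prime_factors n. p ^ multiplicity p n)"
      by (intro prod_dvd_prod) (auto simp: prime_factors_multiplicity)
    also have "\<dots> = n" using assms by (subst prod_prime_factors) auto
    finally show "d \<in> {d. d dvd n \<and> squarefree d}" using S' sqf by auto
  next
    fix d assume d: "d \<in> {d. d dvd n \<and> squarefree d}"
    then have "d > 0" using assms by (auto intro!: Nat.gr0I)
    moreover have "prime_factors d \<subseteq> prime_factors n" using d assms by (intro dvd_prime_factors) auto
    ultimately show "d \<in> (\<lambda>S. \<Prod>S) ` Pow (prime_factors n)"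
      using d squarefree_eq_prod_prime_factors[of d] by (intro image_eqI[of _ _ "prime_factors d"]) auto
  qed
  have "(\<Sum>d | d dvd n. moebius d * g d) = (\<Sum>d | d dvd n \<and> squarefree d. moebius d * g d)"
    using assms by (intro sum.mono_neutral_right) (auto simp: moebius_def)
  also have "\<dots> = (\<Sum>S\<in>Pow (prime_factors n). moebius (\<Prod>S) * g (\<Prod>S))"
    unfolding img[symmetric] by (simp add: sum.reindex[OF inj])
  also have "\<dots> = (\<Sum>S\<in>Pow (prime_factors n). (-1) ^ card S * g (\<Prod>S))"
    using pf sqf by (intro sum.cong) (auto simp: moebius_def)
  finally show ?thesis .
qed

lemma sum_Pow_insert:
  assumes "finite P" "x \<notin> P"
  shows "(\<Sum>S\<in>Pow (insert x P). h S) = (\<Sum>S\<in>Pow P. h S) + (\<Sum>S\<in>Pow P. h (insert x S))"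
proof -
  have "inj_on (insert x) (Pow P)" using assms(2) by (auto simp: inj_on_def)
  moreover have "Pow P \<inter> insert x ` Pow P = {}" using assms(2) by auto
  ultimately show ?thesis
    using assms by (simp add: Pow_insert sum.union_disjoint sum.reindex)
qed

text \<open>As a function of \<open>S\<close>, \<open>c - sum w S\<close> is affine, and the
  alternating sum over \<open>Pow P\<close> takes one difference for each element of
  \<open>P\<close>, so it vanishes from two elements on. The constant must be arbitrary in the
  induction, because splitting off \<open>x\<close> replaces \<open>c\<close> by
  \<open>c - w x\<close>.\<close>

lemma alternating_Pow_sum:
  fixes w :: "'a \<Rightarrow> real"
  assumes "finite P"
  shows "(\<Sum>S\<in>Pow P. (-1) ^ card S * (c - sum w S)) =
           (if P = {} then c else if card P = 1 then sum w P else 0)"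
  using assms
proof (induction P arbitrary: c rule: finite_induct)
  case (insert x P)
  have step: "(\<Sum>S\<in>Pow P. (-1) ^ card (insert x S) * (c - sum w (insert x S)))
      = - (\<Sum>S\<in>Pow P. (-1) ^ card S * ((c - w x) - sum w S))"
  proof -
    have "(-1) ^ card (insert x S) * (c - sum w (insert x S)) = - ((-1) ^ card S * ((c - w x) - sum w S))"
      if "S \<in> Pow P" for S
    proof -
      have "finite S" "x \<notin> S" using that insert.hyps finite_subset by auto
      then show ?thesis by (simp add: algebra_simps)
    qed
    then show ?thesis by (simp add: sum_negf[symmetric])
  qed
  have "(\<Sum>S\<in>Pow (insert x P). (-1) ^ card S * (c - sum w S))
      = (\<Sum>S\<in>Pow P. (-1) ^ card S * (c - sum w S)) - (\<Sum>S\<in>Pow P. (-1) ^ card S * ((c - w x) - sum w S))"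
    by (subst sum_Pow_insert[OF insert.hyps]) (simp only: step)
  also have "\<dots> = (if P = {} then w x else 0)"
    unfolding insert.IH[of c] insert.IH[of "c - w x"] by simp
  finally show ?case using insert.hyps by (auto simp: card_insert_if)
qed simp

text \<open>The logarithm is additive over the primes of a squarefree divisor, so the alternating
  sum survives only for \<open>n = 1\<close> and for prime powers. The free \<open>x\<close> later
  becomes the summation bound \<open>N\<close> and supplies the term \<open>ln N\<close> at
  \<open>n = 1\<close>.\<close>

lemma mangoldt_eq_moebius_sum:
  assumes "n > 0" "x > 0"
  shows "(\<Sum>d | d dvd n. moebius d * ln (x / real d)) = mangoldt n + (if n = 1 then ln x else 0)"
proof -
  have "(\<Sum>d | d dvd n. moebius d * ln (x / real d))
      = (\<Sum>S\<in>Pow (prime_factors n). (-1) ^ card S * ln (x / real (\<Prod>S)))"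
    by (rule sum_moebius[OF assms(1)])
  also have "\<dots> = (\<Sum>S\<in>Pow (prime_factors n). (-1) ^ card S * (ln x - sum (\<lambda>p. ln (real p)) S))"
  proof (intro sum.cong refl)
    fix S assume "S \<in> Pow (prime_factors n)"
    then have S: "finite S" "\<And>p. p \<in> S \<Longrightarrow> p > 0"
      using finite_subset[of S "prime_factors n"] prime_gt_0_nat by auto
    then have "ln (real (\<Prod>S)) = sum (\<lambda>p. ln (real p)) S" by (simp add: ln_prod)
    moreover have "real (\<Prod>S) > 0" using S by (simp only: of_nat_0_less_iff) (auto intro!: prod_pos)
    ultimately show "(-1) ^ card S * ln (x / real (\<Prod>S)) = (-1) ^ card S * (ln x - sum (\<lambda>p. ln (real p)) S)"
      using assms(2) by (simp add: ln_div del: of_nat_prod)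
  qed
  also have "\<dots> = (if prime_factors n = {} then ln x else if card (prime_factors n) = 1
      then sum (\<lambda>p. ln (real p)) (prime_factors n) else 0)"
    by (rule alternating_Pow_sum) simp
  also have "\<dots> = mangoldt n + (if n = 1 then ln x else 0)"
  proof (cases "prime_factors n = {}")
    case True
    then have "n = 1" using assms(1) by (simp add: prime_factorization_empty_iff)
    then show ?thesis by simp
  next
    case False
    then have "n \<noteq> 1" by auto
    show ?thesis
    proof (cases "card (prime_factors n) = 1")
      case True
      then obtain p where p: "prime_factors n = {p}" by (auto simp: card_1_singleton_iff)
      then have "prime p" "p dvd n" by (auto simp: in_prime_factors_iff set_eq_iff)
      have "n = (\<Prod>p\<in>prime_factors n. p ^ multiplicity p n)"
        using assms(1) by (subst prod_prime_factors) auto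
      then have n: "n = p ^ multiplicity p n" by (simp add: p)
      have "multiplicity p n > 0" using p \<open>n > 0\<close> \<open>prime p\<close> \<open>p dvd n\<close>
        by (simp add: prime_multiplicity_gt_zero_iff)
      then have "mangoldt (p ^ multiplicity p n) = ln (real p)" using \<open>prime p\<close> by simp
      then have "mangoldt n = ln (real p)" using n by metis
      then show ?thesis using p \<open>n \<noteq> 1\<close> by simp
    next
      case c: False
      have "\<not> primepow n"
      proof
        assume "primepow n"
        then obtain p k where "prime p" "k > 0" "n = p ^ k" by (auto simp: primepow_def)
        then have "prime_factors n = {p}" by (simp add: prime_factors_power prime_prime_factors)
        with c show False by simp
      qed
      then show ?thesis using c False \<open>n \<noteq> 1\<close> by (simp add: mangoldt_def)
    qed
  qed
  finally show ?thesis .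
qed


section \<open>An upper-bound sieve for pairs of primes\<close>

lemma bij_betw_mod_pair:
  fixes a b :: nat
  assumes "coprime a b" "a > 0" "b > 0"
  shows "bij_betw (\<lambda>n. (n mod a, n mod b)) {..<a * b} ({..<a} \<times> {..<b})"
proof -
  have inj: "inj_on (\<lambda>n. (n mod a, n mod b)) {..<a * b}"
  proof (rule inj_onI)
    fix x y assume xy: "x \<in> {..<a * b}" "y \<in> {..<a * b}" "(x mod a, x mod b) = (y mod a, y mod b)"
    then have "[x = y] (mod a)" "[x = y] (mod b)" by (auto simp: Cong.cong_def)
    then have "[x = y] (mod a * b)" using assms by (simp add: coprime_cong_mult_nat)
    with xy show "x = y" by (simp add: cong_less_modulus_unique_nat)
  qed
  have "(\<lambda>n. (n mod a, n mod b)) ` {..<a * b} = {..<a} \<times> {..<b}"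
    using assms by (intro card_subset_eq) (auto simp: card_image[OF inj] card_cartesian_product)
  with inj show ?thesis by (simp add: bij_betw_def)
qed

lemma periodic_mod:
  fixes F :: "nat \<Rightarrow> 'a"
  assumes "\<And>n. F (n + q) = F n"
  shows "F (n mod q) = F n"
proof -
  have "F (k + q * t) = F k" for k t
  proof (induction t)
    case (Suc t)
    have "F (k + q * Suc t) = F ((k + q * t) + q)" by (simp add: algebra_simps)
    with Suc assms show ?case by simp
  qed simp
  from this[of "n mod q" "n div q"] show ?thesis by simp
qed

lemma sum_periodic_coprime_mult:
  fixes F H :: "nat \<Rightarrow> real"
  assumes "coprime a b" "a > 0" "b > 0"
    and F: "\<And>n. F (n + a) = F n" and H: "\<And>n. H (n + b) = H n"
  shows "(\<Sum>n<a*b. F n * H n) = (\<Sum>n<a. F n) * (\<Sum>n<b. H n)"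
proof -
  have "(\<Sum>n<a*b. F n * H n) = (\<Sum>n<a*b. F (n mod a) * H (n mod b))"
    by (simp add: periodic_mod[of F, OF F] periodic_mod[of H, OF H])
  also have "\<dots> = (\<Sum>(i,j)\<in>{..<a}\<times>{..<b}. F i * H j)"
    using sum.reindex_bij_betw[OF bij_betw_mod_pair[OF assms(1-3)], of "\<lambda>(i,j). F i * H j"] by simp
  also have "\<dots> = (\<Sum>n<a. F n) * (\<Sum>n<b. H n)"
    by (simp add: sum_product sum.cartesian_product)
  finally show ?thesis .
qed

lemma prod_primes_periodic:
  fixes f :: "nat \<Rightarrow> nat \<Rightarrow> 'a :: comm_monoid_mult"
  assumes "finite P" "\<And>p n. p \<in> P \<Longrightarrow> f p (n + p) = f p n"
  shows "(\<Prod>p\<in>P. f p (n + \<Prod>P)) = (\<Prod>p\<in>P. f p n)"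
proof (rule prod.cong)
  fix p assume "p \<in> P"
  then have "p dvd \<Prod>P" using dvd_prodI[of P p "\<lambda>x. x"] assms by simp
  then have "(n + \<Prod>P) mod p = n mod p" by (metis dvd_def mod_mult_self2)
  then show "f p (n + \<Prod>P) = f p n"
    using periodic_mod[of "f p" p] assms \<open>p \<in> P\<close> by metis
qed simp

text \<open>By Chinese remaindering the residues modulo distinct primes are independent, so the sum
  over a full period factors into local sums.\<close>

lemma sum_prod_primes_periodic:
  fixes f :: "nat \<Rightarrow> nat \<Rightarrow> real"
  assumes "finite P" "\<And>p. p \<in> P \<Longrightarrow> prime p" "\<And>p n. p \<in> P \<Longrightarrow> f p (n + p) = f p n"
  shows "(\<Sum>n<\<Prod>P. \<Prod>p\<in>P. f p n) = (\<Prod>p\<in>P. \<Sum>n<p. f p n)"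
  using assms
proof (induction P rule: finite_induct)
  case (insert q P)
  have "coprime q (\<Prod>P)"
    using insert by (intro prod_coprime_right) (metis insertCI primes_coprime)
  moreover have "q > 0" "\<Prod>P > 0"
    using insert prime_gt_0_nat by (auto intro!: prod_pos)
  ultimately have "(\<Sum>n<q * \<Prod>P. f q n * (\<Prod>p\<in>P. f p n)) = (\<Sum>n<q. f q n) * (\<Sum>n<\<Prod>P. \<Prod>p\<in>P. f p n)"
    using insert prod_primes_periodic[of P f]
    by (intro sum_periodic_coprime_mult) auto
  with insert show ?case by simp
qed simp

lemma sum_periodic_div_mod:
  fixes F :: "nat \<Rightarrow> 'a :: comm_ring_1"
  assumes "q > 0" "\<And>n. F (n + q) = F n"
  shows "(\<Sum>n<N. F n) = of_nat (N div q) * (\<Sum>n<q. F n) + (\<Sum>n<N mod q. F n)"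
proof -
  have shift: "(\<Sum>n\<in>{q*t..<q*t+r}. F n) = (\<Sum>n<r. F n)" for t r
  proof -
    have "(\<Sum>n\<in>{q*t..<q*t+r}. F n) = (\<Sum>n<r. F (n + q * t))"
      by (rule sum.reindex_bij_witness[of _ "\<lambda>n. n + q*t" "\<lambda>n. n - q*t"]) auto
    also have "\<dots> = (\<Sum>n<r. F n)"
      using periodic_mod[of F q, OF assms(2)] by (metis (no_types, lifting) mod_mult_self2)
    finally show ?thesis .
  qed
  have split: "(\<Sum>n<k + l. F n) = (\<Sum>n<k. F n) + (\<Sum>n\<in>{k..<k+l}. F n)" for k l
    by (subst sum.union_disjoint[symmetric]) (auto intro!: sum.cong)
  have full: "(\<Sum>n<q * t. F n) = of_nat t * (\<Sum>n<q. F n)" for t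
  proof (induction t)
    case (Suc t)
    have "(\<Sum>n<q * t + q. F n) = of_nat (Suc t) * (\<Sum>n<q. F n)"
      unfolding split shift Suc.IH by (simp add: algebra_simps)
    then show ?case by (simp add: add.commute)
  qed simp
  have "(\<Sum>n<q * (N div q) + N mod q. F n) = of_nat (N div q) * (\<Sum>n<q. F n) + (\<Sum>n<N mod q. F n)"
    unfolding split shift full ..
  then show ?thesis by simp
qed

text \<open>One \<open>q * B\<close> pays for the incomplete last period, the other for replacing
  \<open>N div q\<close> by \<open>N / q\<close>.\<close>

lemma sum_periodic_bound:
  fixes F :: "nat \<Rightarrow> real"
  assumes "q > 0" and per: "\<And>n. F (n + q) = F n" and bd: "\<And>n. \<bar>F n\<bar> \<le> B"
  shows "\<bar>(\<Sum>n<N. F n) - real N / real q * (\<Sum>n<q. F n)\<bar> \<le> 2 * real q * B"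
proof -
  define S where "S = (\<Sum>n<q. F n)"
  define t where "t = N div q"
  define r where "r = N mod q"
  have N: "N = q * t + r" "r < q" using assms by (auto simp: t_def r_def)
  have split: "(\<Sum>n<N. F n) = real t * S + (\<Sum>n<r. F n)"
    unfolding t_def S_def r_def by (rule sum_periodic_div_mod) (fact assms(1), rule per)
  have B: "0 \<le> B" using bd[of 0] by linarith
  have "\<bar>\<Sum>n<r. F n\<bar> \<le> (\<Sum>n<r. B)"
    by (intro order.trans[OF sum_abs] sum_mono bd)
  also have "\<dots> \<le> real q * B" using N B by (simp add: mult_right_mono)
  finally have 1: "\<bar>\<Sum>n<r. F n\<bar> \<le> real q * B" .
  have "\<bar>S\<bar> \<le> (\<Sum>n<q. B)"
    unfolding S_def by (intro order.trans[OF sum_abs] sum_mono bd)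
  then have S: "\<bar>S\<bar> \<le> real q * B" by simp
  define u where "u = real r / real q * S"
  have "real N / real q * S = real t * S + u"
    using assms by (simp add: N(1) u_def field_simps)
  moreover have "\<bar>u\<bar> \<le> 1 * (real q * B)"
    unfolding abs_mult u_def using N S B by (intro mult_mono) auto
  ultimately have "\<bar>(\<Sum>n<N. F n) - real N / real q * S\<bar> \<le> real q * B + real q * B"
    unfolding split S_def[symmetric] using 1 by linarith
  then show ?thesis by (simp add: S_def mult_ac)
qed

text \<open>Modulo \<open>p\<close>, \<open>sieve_local h p\<close> is a mean-zero function that is constant off the residues with
  \<open>p dvd n * (n + h)\<close>, normalised so that its mean square equals that constant. Products over
  distinct primes are orthogonal, so the Selberg weight is their plain sum and no Moebius inversion
  is needed.\<close>

definition sieve_density :: "nat \<Rightarrow> nat \<Rightarrow> real" where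
  "sieve_density h p = (if p dvd h then 1 / (real p - 1) else 2 / (real p - 2))"

definition sieve_local :: "nat \<Rightarrow> nat \<Rightarrow> nat \<Rightarrow> real" where
  "sieve_local h p n = (if p dvd n * (n + h) then -1 else sieve_density h p)"

lemma sieve_local_periodic: "sieve_local h p (n + p) = sieve_local h p n"
proof -
  have "p dvd (n + p) * (n + p + h) \<longleftrightarrow> p dvd n * (n + h)"
  proof -
    have "(n + p) * (n + p + h) = n * (n + h) + p * (n + n + p + h)" by (simp add: algebra_simps)
    then show ?thesis by (metis dvd_add_left_iff dvd_triv_left)
  qed
  then show ?thesis by (simp add: sieve_local_def)
qed

text \<open>The roots of \<open>n * (n + h)\<close> modulo the prime \<open>p\<close> are
  \<open>0\<close> and \<open>-h\<close>, which coincide exactly when \<open>p\<close> divides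
  \<open>h\<close>.\<close>

lemma card_sieved_residues:
  fixes p h :: nat
  assumes "prime p"
  shows "card {n \<in> {..<p}. p dvd n * (n + h)} = (if p dvd h then 1 else 2)"
proof -
  have p: "p > 0" using assms prime_gt_0_nat by blast
  have iff: "p dvd n + h \<longleftrightarrow> n = (p - h mod p) mod p" if "n < p" for n
  proof -
    have hp: "h mod p < p" using p by simp
    have "p dvd n + h \<longleftrightarrow> p dvd n + h mod p"
      by (simp add: dvd_eq_mod_eq_0 mod_add_right_eq)
    also have "\<dots> \<longleftrightarrow> n + h mod p = 0 \<or> n + h mod p = p"
    proof
      assume "p dvd n + h mod p"
      then obtain c where c: "n + h mod p = p * c" by blast
      then have "p * c < p * 2" using that hp by linarith
      then have "c = 0 \<or> c = 1" by auto
      with c show "n + h mod p = 0 \<or> n + h mod p = p" by auto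
    qed auto
    also have "\<dots> \<longleftrightarrow> n = (p - h mod p) mod p"
    proof (cases "h mod p = 0")
      case True
      with that show ?thesis by simp
    next
      case False
      then have "(p - h mod p) mod p = p - h mod p" using hp by simp
      with False hp show ?thesis by linarith
    qed
    finally show ?thesis .
  qed
  define c where "c = (p - h mod p) mod p"
  have "{n \<in> {..<p}. p dvd n * (n + h)} = {0, c}"
  proof (intro equalityI subsetI)
    fix n assume "n \<in> {n \<in> {..<p}. p dvd n * (n + h)}"
    then have "n < p" "p dvd n \<or> p dvd n + h"
      using assms by (simp_all add: prime_dvd_mult_iff)
    then show "n \<in> {0, c}" using iff[of n] nat_dvd_not_less[of n p] by (auto simp: c_def)
  next
    fix n assume "n \<in> {0, c}"
    moreover have "c < p" using p by (simp add: c_def)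
    ultimately show "n \<in> {n \<in> {..<p}. p dvd n * (n + h)}"
      using p iff[of c] by (auto simp: c_def)
  qed
  moreover have "c = 0 \<longleftrightarrow> p dvd h"
  proof -
    have "p dvd 0 + h \<longleftrightarrow> 0 = c" unfolding c_def by (rule iff[OF p])
    then show ?thesis by auto
  qed
  ultimately show ?thesis by (cases "c = 0") simp_all
qed

text \<open>With \<open>k\<close> sieved residues the value elsewhere is
  \<open>g = k / (p - k)\<close>. From \<open>g * (p - k) = k\<close> follow the mean zero and the
  square sum \<open>k + (p - k) * g^2 = g * (p - k) + g * k = p * g\<close>. Evenness of
  \<open>h\<close> excludes the degenerate case \<open>p = k = 2\<close>.\<close>

lemma
  assumes "prime p" "even h"
  shows sum_sieve_local: "(\<Sum>n<p. sieve_local h p n) = 0"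
    and sum_sieve_local_square:
      "(\<Sum>n<p. sieve_local h p n * sieve_local h p n) = real p * sieve_density h p"
    and sieve_density_pos: "sieve_density h p > 0"
    and abs_sieve_local_le: "\<bar>sieve_local h p n\<bar> \<le> real p"
proof -
  define A where "A = {n \<in> {..<p}. p dvd n * (n + h)}"
  define k where "k = (if p dvd h then 1 else 2 :: real)"
  define g where "g = sieve_density h p"
  have p2: "p \<ge> 2" using assms prime_ge_2_nat by blast
  have p3: "p > 2" if "\<not> p dvd h" using that p2 assms by (cases "p = 2") auto
  have kp: "k < p" using p2 p3 by (auto simp: k_def)
  have g: "g = k / (real p - k)" by (auto simp: g_def sieve_density_def k_def)
  have g': "g * (real p - k) = k" using kp by (simp add: g)
  show gpos: "sieve_density h p > 0"
    unfolding g_def[symmetric] g using kp by (auto simp: k_def)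
  have cA: "real (card A) = k"
    using card_sieved_residues[OF assms(1), of h] by (auto simp: A_def k_def)
  have cB: "real (card ({..<p} - A)) = real p - k"
  proof -
    have "A \<subseteq> {..<p}" by (auto simp: A_def)
    then have "card ({..<p} - A) = p - card A" "card A \<le> p"
      using card_mono[of "{..<p}" A] by (simp_all add: card_Diff_subset finite_subset)
    with cA show ?thesis by (simp add: of_nat_diff)
  qed
  have split: "(\<Sum>n<p. F (sieve_local h p n)) = k * F (-1) + (real p - k) * F g" for F :: "real \<Rightarrow> real"
  proof -
    have "(\<Sum>n<p. F (sieve_local h p n)) = (\<Sum>n\<in>A. F (sieve_local h p n)) + (\<Sum>n\<in>{..<p}-A. F (sieve_local h p n))"
      by (subst sum.union_disjoint[symmetric]) (auto simp: A_def intro!: sum.cong)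
    also have "(\<Sum>n\<in>A. F (sieve_local h p n)) = (\<Sum>n\<in>A. F (-1))"
      by (rule sum.cong) (auto simp: A_def sieve_local_def)
    also have "(\<Sum>n\<in>{..<p}-A. F (sieve_local h p n)) = (\<Sum>n\<in>{..<p}-A. F g)"
      by (rule sum.cong) (auto simp: A_def sieve_local_def g_def)
    finally show ?thesis using cA cB by simp
  qed
  show "(\<Sum>n<p. sieve_local h p n) = 0"
    using split[of "\<lambda>x. x"] g' by (simp add: algebra_simps)
  show "(\<Sum>n<p. sieve_local h p n * sieve_local h p n) = real p * sieve_density h p"
  proof -
    have "k + (real p - k) * (g * g) = g * (real p - k) + g * (g * (real p - k))"
      by (subst (1) g'[symmetric]) (simp add: algebra_simps)
    also have "\<dots> = real p * g" using g' by (simp add: algebra_simps)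
    finally show ?thesis using split[of "\<lambda>x. x * x"] unfolding g_def[symmetric] by simp
  qed
  have "g \<le> p"
  proof (cases "p dvd h")
    case True
    then have "g = 1 / (real p - 1)" by (simp add: g k_def)
    also have "\<dots> \<le> 1" using p2 by simp
    finally show ?thesis using p2 by linarith
  next
    case False
    then have "g = 2 / (real p - 2)" by (simp add: g k_def)
    also have "\<dots> \<le> 2" using p3[OF False] by (simp add: field_simps)
    finally show ?thesis using p2 by linarith
  qed
  then show "\<bar>sieve_local h p n\<bar> \<le> real p"
    using gpos p2 by (auto simp: sieve_local_def g_def)
qed

text \<open>A squarefree number up to \<open>R\<close> is represented by its set of prime factors.
  With this encoding \<open>sieve_total\<close> is the denominator of Selberg's sieve: the sum over
  squarefree \<open>d \<le> R\<close> of the multiplicative function with value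
  \<open>sieve_density h p\<close> at each prime \<open>p\<close> dividing \<open>d\<close>.\<close>

definition sieve_sets :: "nat \<Rightarrow> nat set set" where
  "sieve_sets R = {E. E \<subseteq> {p. prime p \<and> p \<le> R} \<and> \<Prod>E \<le> R}"

definition sieve_total :: "nat \<Rightarrow> nat \<Rightarrow> real" where
  "sieve_total h R = (\<Sum>E\<in>sieve_sets R. \<Prod>p\<in>E. sieve_density h p)"

lemma sieve_setsD:
  assumes "E \<in> sieve_sets R"
  shows "finite E" "\<And>p. p \<in> E \<Longrightarrow> prime p" "\<And>p. p \<in> E \<Longrightarrow> p \<le> R" "\<Prod>E \<le> R" "\<Prod>E > 0"
proof -
  have fin: "finite {p::nat. prime p \<and> p \<le> R}" by (rule finite_subset[of _ "{..R}"]) auto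
  show "finite E" using assms finite_subset[OF _ fin] by (auto simp: sieve_sets_def)
  show prm: "\<And>p. p \<in> E \<Longrightarrow> prime p" using assms by (auto simp: sieve_sets_def)
  show "\<And>p. p \<in> E \<Longrightarrow> p \<le> R" "\<Prod>E \<le> R" using assms by (auto simp: sieve_sets_def)
  show "\<Prod>E > 0" using prm prime_gt_0_nat by (auto intro!: prod_pos)
qed

lemma finite_sieve_sets: "finite (sieve_sets R)"
  by (rule finite_subset[of _ "Pow {..R}"]) (auto simp: sieve_sets_def)

lemma prod_primes_dvd:
  fixes n :: nat
  assumes "finite E" "\<And>p. p \<in> E \<Longrightarrow> prime p" "\<And>p. p \<in> E \<Longrightarrow> p dvd n"
  shows "\<Prod>E dvd n"
  using assms
proof (induction E rule: finite_induct)
  case (insert q E)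
  have "coprime q (\<Prod>E)"
    using insert by (intro prod_coprime_right) (metis insertCI primes_coprime)
  with insert show ?case by (simp add: divides_mult)
qed simp

lemma card_sieve_sets_le: "card (sieve_sets R) \<le> R"
proof -
  have "inj_on (\<lambda>E. \<Prod>E) (sieve_sets R)"
  proof (rule inj_onI)
    fix E F assume EF: "E \<in> sieve_sets R" "F \<in> sieve_sets R" "\<Prod>E = \<Prod>F"
    have "p \<in> E \<longleftrightarrow> p \<in> F" for p
      using sieve_setsD[OF EF(1)] sieve_setsD[OF EF(2)] prime_dvd_prod_primes_iff[of E p]
        prime_dvd_prod_primes_iff[of F p] EF(3) by metis
    then show "E = F" by blast
  qed
  moreover have "(\<lambda>E. \<Prod>E) ` sieve_sets R \<subseteq> {1..R}"
    using sieve_setsD by (force simp: Suc_le_eq)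
  ultimately have "card (sieve_sets R) \<le> card {1..R}"
    by (intro card_inj_on_le) auto
  then show ?thesis by simp
qed

lemma
  assumes "even h" "E \<in> sieve_sets R"
  shows abs_prod_sieve_local_le: "\<bar>\<Prod>p\<in>E. sieve_local h p n\<bar> \<le> real R"
    and prod_sieve_density_pos: "(\<Prod>p\<in>E. sieve_density h p) > 0"
proof -
  have "\<bar>\<Prod>p\<in>E. sieve_local h p n\<bar> = (\<Prod>p\<in>E. \<bar>sieve_local h p n\<bar>)"
    by (simp add: abs_prod)
  also have "\<dots> \<le> (\<Prod>p\<in>E. real p)"
    using assms sieve_setsD(2)[OF assms(2)] by (intro prod_mono) (auto intro: abs_sieve_local_le)
  also have "\<dots> = real (\<Prod>E)" by simp
  also have "\<dots> \<le> real R" using sieve_setsD(4)[OF assms(2)] by (simp only: of_nat_le_iff)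
  finally show "\<bar>\<Prod>p\<in>E. sieve_local h p n\<bar> \<le> real R" .
  show "(\<Prod>p\<in>E. sieve_density h p) > 0"
    using assms sieve_setsD(2)[OF assms(2)] by (intro prod_pos) (auto intro: sieve_density_pos)
qed

text \<open>Over the period \<open>\<Prod>(E \<union> F)\<close> the sum factors into local sums: a
  prime in only one of the two sets contributes mean 0, a common prime its mean square. The period
  and the values are both at most \<open>R^2\<close>, whence the error
  \<open>2 * R^4\<close>.\<close>

lemma sieve_correlation:
  assumes "even h" and E: "E \<in> sieve_sets R" and F: "F \<in> sieve_sets R"
  shows "\<bar>(\<Sum>n<N. (\<Prod>p\<in>E. sieve_local h p n) * (\<Prod>p\<in>F. sieve_local h p n))
           - (if E = F then real N * (\<Prod>p\<in>E. sieve_density h p) else 0)\<bar> \<le> 2 * real R ^ 4"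
proof -
  define U where "U = E \<union> F"
  define f where "f = (\<lambda>p n. (if p \<in> E then sieve_local h p n else 1) * (if p \<in> F then sieve_local h p n else 1))"
  note E' = sieve_setsD[OF E] and F' = sieve_setsD[OF F]
  have U: "finite U" "\<And>p. p \<in> U \<Longrightarrow> prime p" using E' F' by (auto simp: U_def)
  have prodU: "(\<Prod>p\<in>E. sieve_local h p n) * (\<Prod>p\<in>F. sieve_local h p n) = (\<Prod>p\<in>U. f p n)" for n
  proof -
    have "(\<Prod>p\<in>E. sieve_local h p n) = (\<Prod>p\<in>U. if p \<in> E then sieve_local h p n else 1)"
      using U by (intro prod.mono_neutral_cong_left) (auto simp: U_def)
    moreover have "(\<Prod>p\<in>F. sieve_local h p n) = (\<Prod>p\<in>U. if p \<in> F then sieve_local h p n else 1)"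
      using U by (intro prod.mono_neutral_cong_left) (auto simp: U_def)
    ultimately show ?thesis by (simp add: f_def prod.distrib)
  qed
  have per: "f p (n + p) = f p n" for p n by (simp add: f_def sieve_local_periodic)
  have Upos: "\<Prod>U > 0" using U prime_gt_0_nat by (auto intro!: prod_pos)
  have "\<Prod>U * \<Prod>(E \<inter> F) = \<Prod>E * \<Prod>F"
    unfolding U_def using E' F' by (intro prod.union_inter)
  moreover have "\<Prod>(E \<inter> F) \<ge> 1" using E' prime_gt_0_nat by (auto intro!: prod_pos simp: Suc_le_eq)
  ultimately have "\<Prod>U \<le> \<Prod>E * \<Prod>F"
    by (metis mult_le_mono2 nat_mult_1_right)
  also have "\<dots> \<le> R * R" using E'(4) F'(4) by (intro mult_le_mono)
  finally have UR: "real (\<Prod>U) \<le> real R * real R" by (simp only: of_nat_mult[symmetric] of_nat_le_iff)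
  have bd: "\<bar>\<Prod>p\<in>U. f p n\<bar> \<le> real R * real R" for n
    unfolding prodU[symmetric] abs_mult
    using abs_prod_sieve_local_le[OF assms(1) E] abs_prod_sieve_local_le[OF assms(1) F]
    by (intro mult_mono) auto
  have full: "(\<Sum>n<\<Prod>U. \<Prod>p\<in>U. f p n) = (if E = F then real (\<Prod>U) * (\<Prod>p\<in>E. sieve_density h p) else 0)"
  proof -
    have "(\<Sum>n<\<Prod>U. \<Prod>p\<in>U. f p n) = (\<Prod>p\<in>U. \<Sum>n<p. f p n)"
      using U per by (intro sum_prod_primes_periodic) auto
    also have "\<dots> = (if E = F then real (\<Prod>U) * (\<Prod>p\<in>E. sieve_density h p) else 0)"
    proof (cases "E = F")
      case True
      have "(\<Prod>p\<in>U. \<Sum>n<p. f p n) = (\<Prod>p\<in>U. real p * sieve_density h p)"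
      proof (rule prod.cong)
        fix p assume "p \<in> U"
        then show "(\<Sum>n<p. f p n) = real p * sieve_density h p"
          using True sum_sieve_local_square[of p h] U assms by (simp add: f_def U_def)
      qed simp
      with True show ?thesis by (simp add: prod.distrib U_def)
    next
      case False
      then obtain q where q: "q \<in> U" "\<not> (q \<in> E \<and> q \<in> F)" by (auto simp: U_def)
      then have "(\<Sum>n<q. f q n) = 0"
        using sum_sieve_local[of q h] U assms by (auto simp: f_def U_def)
      with q False U show ?thesis by (auto intro!: prod_zero)
    qed
    finally show ?thesis .
  qed
  have "\<bar>(\<Sum>n<N. \<Prod>p\<in>U. f p n) - real N / real (\<Prod>U) * (\<Sum>n<\<Prod>U. \<Prod>p\<in>U. f p n)\<bar>
      \<le> 2 * real (\<Prod>U) * (real R * real R)"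
    using Upos bd prod_primes_periodic[of U f] U per by (intro sum_periodic_bound) auto
  also have "\<dots> \<le> 2 * (real R * real R) * (real R * real R)"
    using UR by (intro mult_right_mono mult_left_mono) auto
  also have "\<dots> = 2 * real R ^ 4" by (simp add: power4_eq_xxxx)
  finally have le: "\<bar>(\<Sum>n<N. \<Prod>p\<in>U. f p n) - real N / real (\<Prod>U) * (\<Sum>n<\<Prod>U. \<Prod>p\<in>U. f p n)\<bar>
      \<le> 2 * real R ^ 4" .
  have "real (\<Prod>U) \<noteq> 0" using Upos by (simp only: of_nat_eq_0_iff)
  then have "real N / real (\<Prod>U) * (\<Sum>n<\<Prod>U. \<Prod>p\<in>U. f p n)
      = (if E = F then real N * (\<Prod>p\<in>E. sieve_density h p) else 0)"
    unfolding full by (simp del: of_nat_prod)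
  with le show ?thesis by (simp only: prodU)
qed

lemma sieve_total_ge_1:
  assumes "even h" "R \<ge> 1"
  shows "sieve_total h R \<ge> 1"
proof -
  have "{} \<in> sieve_sets R" using assms by (simp add: sieve_sets_def)
  then have "(\<Sum>E\<in>{{}}. \<Prod>p\<in>E. sieve_density h p) \<le> sieve_total h R"
    unfolding sieve_total_def using prod_sieve_density_pos[OF assms(1)] finite_sieve_sets
    by (intro sum_mono2) (auto intro: less_imp_le)
  then show ?thesis by simp
qed

text \<open>For a surviving \<open>n > R\<close> no prime up to \<open>R\<close> divides
  \<open>n\<close> or \<open>n + h\<close>, so the weight \<open>\<Lambda> n\<close> takes the value
  \<open>G\<close>. By orthogonality the second moment of \<open>\<Lambda>\<close> is
  \<open>N * G\<close> up to at most \<open>R^2\<close> errors of size \<open>2 * R^4\<close>;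
  comparing it with \<open>G^2\<close> times the number of survivors and cancelling one
  \<open>G\<close> gives the bound.\<close>

lemma selberg_sieve_prime_pairs:
  assumes "even h" "R \<ge> 1"
  shows "real (card {n. n < N \<and> R < n \<and> prime n \<and> prime (n + h)}) * sieve_total h R
           \<le> real N + 2 * real R ^ 6"
proof -
  define G where "G = sieve_total h R"
  define \<Lambda> where "\<Lambda> = (\<lambda>n. \<Sum>E\<in>sieve_sets R. \<Prod>p\<in>E. sieve_local h p n)"
  define S where "S = {n. n < N \<and> R < n \<and> prime n \<and> prime (n + h)}"
  have finS: "finite S" by (simp add: S_def)
  have \<Lambda>S: "\<Lambda> n = G" if "n \<in> S" for n
  proof -
    have "sieve_local h p n = sieve_density h p" if "prime p" "p \<le> R" for p
    proof -
      have "\<not> p dvd n" "\<not> p dvd n + h"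
        using that \<open>n \<in> S\<close> by (auto simp: S_def dest: primes_dvd_imp_eq)
      then show ?thesis using that by (simp add: sieve_local_def prime_dvd_mult_iff)
    qed
    then show ?thesis
      unfolding \<Lambda>_def G_def sieve_total_def using sieve_setsD by (intro sum.cong prod.cong) auto
  qed
  have "real (card S) * G\<^sup>2 = (\<Sum>n\<in>S. (\<Lambda> n)\<^sup>2)" using \<Lambda>S by simp
  also have "\<dots> \<le> (\<Sum>n<N. (\<Lambda> n)\<^sup>2)" by (intro sum_mono2) (auto simp: S_def)
  also have "\<dots> = (\<Sum>n<N. \<Sum>E\<in>sieve_sets R. \<Sum>F\<in>sieve_sets R.
      (\<Prod>p\<in>E. sieve_local h p n) * (\<Prod>p\<in>F. sieve_local h p n))"
    by (simp add: \<Lambda>_def power2_eq_square sum_product)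
  also have "\<dots> = (\<Sum>E\<in>sieve_sets R. \<Sum>n<N. \<Sum>F\<in>sieve_sets R.
      (\<Prod>p\<in>E. sieve_local h p n) * (\<Prod>p\<in>F. sieve_local h p n))"
    by (rule sum.swap)
  also have "\<dots> = (\<Sum>E\<in>sieve_sets R. \<Sum>F\<in>sieve_sets R. \<Sum>n<N.
      (\<Prod>p\<in>E. sieve_local h p n) * (\<Prod>p\<in>F. sieve_local h p n))"
    by (intro sum.cong refl sum.swap)
  also have "\<dots> \<le> (\<Sum>E\<in>sieve_sets R. \<Sum>F\<in>sieve_sets R.
      (if E = F then real N * (\<Prod>p\<in>E. sieve_density h p) else 0) + 2 * real R ^ 4)"
  proof (intro sum_mono)
    fix E F assume "E \<in> sieve_sets R" "F \<in> sieve_sets R"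
    from sieve_correlation[OF assms(1) this, of N]
    show "(\<Sum>n<N. (\<Prod>p\<in>E. sieve_local h p n) * (\<Prod>p\<in>F. sieve_local h p n))
      \<le> (if E = F then real N * (\<Prod>p\<in>E. sieve_density h p) else 0) + 2 * real R ^ 4"
      by linarith
  qed
  also have "\<dots> = real N * G + 2 * real R ^ 4 * (real (card (sieve_sets R)) * real (card (sieve_sets R)))"
    by (simp add: sum.distrib finite_sieve_sets G_def sieve_total_def sum_distrib_left)
  also have "\<dots> \<le> real N * G + 2 * real R ^ 4 * (real R * real R)"
    using card_sieve_sets_le by (intro add_left_mono mult_left_mono mult_mono) auto
  also have "\<dots> = real N * G + 2 * real R ^ 6 * 1"
    by (simp add: power_numeral_reduce)
  also have "\<dots> \<le> real N * G + 2 * real R ^ 6 * G"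
    using sieve_total_ge_1[OF assms] by (intro add_left_mono mult_left_mono) (auto simp: G_def)
  finally have "(real (card S) * G) * G \<le> (real N + 2 * real R ^ 6) * G"
    by (simp add: algebra_simps power2_eq_square)
  then show ?thesis
    using sieve_total_ge_1[OF assms] unfolding S_def[symmetric] G_def[symmetric]
    by (meson less_le_trans mult_right_le_imp_le zero_less_one)
qed

text \<open>For positive \<open>n\<close> this is \<open>n / totient n\<close>.\<close>

definition prime_ratio :: "nat \<Rightarrow> real" where
  "prime_ratio n = (\<Prod>p\<in>prime_factors n. real p / (real p - 1))"

lemma sum_power_le_geometric:
  fixes x :: real
  assumes "0 \<le> x" "x < 1"
  shows "(\<Sum>i=0..J. x ^ i) \<le> 1 / (1 - x)"
proof -
  have "(\<Sum>i=0..J. x ^ i) = (1 - x ^ Suc J) / (1 - x)"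
    using assms by (simp add: atLeast0AtMost sum_gp0)
  also have "\<dots> \<le> 1 / (1 - x)" using assms by (intro divide_right_mono) auto
  finally show ?thesis .
qed

lemma nat_eq_prod_prime_powers:
  fixes n :: nat
  assumes "finite P" "\<And>p. p \<in> P \<Longrightarrow> prime p" "prime_factors n \<subseteq> P" "n > 0"
  shows "n = (\<Prod>p\<in>P. p ^ multiplicity p n)"
proof -
  have "n = (\<Prod>p\<in>prime_factors n. p ^ multiplicity p n)"
    using assms by (simp add: prod_prime_factors)
  also have "\<dots> = (\<Prod>p\<in>P. p ^ multiplicity p n)"
    using assms by (intro prod.mono_neutral_left) (auto simp: prime_factors_multiplicity)
  finally show ?thesis .
qed

lemma multiplicity_le_self:
  fixes n p :: nat
  assumes "n > 0" "prime p"
  shows "multiplicity p n \<le> n"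
proof -
  have "p ^ multiplicity p n \<le> n" using assms by (intro dvd_imp_le multiplicity_dvd) auto
  moreover have "multiplicity p n < p ^ multiplicity p n"
    using assms prime_gt_1_nat by (intro power_gt_expt) auto
  ultimately show ?thesis by simp
qed

text \<open>Pairs \<open>(a, b)\<close> are sorted according to the set \<open>E\<close> of primes that divide \<open>b\<close>, or divide \<open>a\<close>
  without dividing \<open>h\<close>; the local Euler factor of each class is then at most the weight of \<open>E\<close>,
  up to the factor \<open>prime_ratio h\<close> produced by the free part of \<open>a\<close> at primes dividing \<open>h\<close>.\<close>

lemma sieve_total_lower_bound:
  assumes h: "even h" "h > 0"
  shows "(\<Sum>a=1..Q. 1 / real a)\<^sup>2 \<le> sieve_total h (Q\<^sup>2) * prime_ratio h"
proof -
  define P where "P = {p::nat. prime p \<and> p \<le> Q}"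
  define cls where "cls = (\<lambda>(a,b). {p\<in>P. p dvd b \<or> (\<not> p dvd h \<and> p dvd a)})"
  define I where "I = {1..Q} \<times> {1..Q}"
  define V where "V = (\<lambda>(a,b). 1 / (real a * real b))"
  \<comment> \<open>\<open>B E p\<close> contains the possible pairs of exponents of
    \<open>p\<close> in \<open>a\<close> and \<open>b\<close> for a pair of class \<open>E\<close>;
    no exponent exceeds \<open>Q\<close>.\<close>
  define B where "B = (\<lambda>E p. if p dvd h then {0..Q} \<times> (if p \<in> E then {1..Q} else {0})
                             else (if p \<in> E then {0..Q} \<times> {0..Q} - {(0,0)} else {(0,0)}))"
  define w where "w = (\<lambda>(p::nat) (i,j). (1 / real p) ^ i * (1 / real p) ^ j)"
  have finP: "finite P" unfolding P_def by (rule finite_subset[of _ "{..Q}"]) auto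
  have prP: "\<And>p. p \<in> P \<Longrightarrow> prime p" by (auto simp: P_def)
  have wnonneg: "w p z \<ge> 0" for p z by (auto simp: w_def split: prod.splits)
  have cls_sieve: "cls z \<in> sieve_sets (Q\<^sup>2)" if "z \<in> I" for z
  proof -
    obtain a b where z: "z = (a, b)" by force
    have "\<Prod>(cls z) dvd a * b"
      using finP prP by (intro prod_primes_dvd) (auto simp: cls_def z)
    then have "\<Prod>(cls z) \<le> a * b" using that by (auto intro!: dvd_imp_le simp: z I_def)
    also have "\<dots> \<le> Q * Q" using that by (intro mult_le_mono) (auto simp: z I_def)
    finally have "\<Prod>(cls z) \<le> Q\<^sup>2" by (simp add: power2_eq_square)
    moreover have "p \<le> Q\<^sup>2" if "p \<in> P" for p
      using that by (auto simp: P_def power2_eq_square intro: order.trans[OF _ le_square])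
    ultimately show ?thesis using prP by (auto simp: sieve_sets_def cls_def z)
  qed
  have fiber: "(\<Sum>z | z \<in> I \<and> cls z = E. V z) \<le> (\<Prod>p\<in>E. sieve_density h p) * prime_ratio h"
    if E: "E \<subseteq> P" for E
  proof -
    \<comment> \<open>Passing to exponent vectors embeds a class into a product of finite sets, on
      which the sum of \<open>V\<close> becomes a product of local sums.\<close>
    define e where "e = (\<lambda>(a,b). \<lambda>p\<in>P. (multiplicity p a, multiplicity p b) :: nat \<times> nat)"
    have pf: "prime_factors a \<subseteq> P" if "a \<in> {1..Q}" for a
    proof
      fix p assume "p \<in> prime_factors a"
      then have "prime p" "p dvd a" by auto
      moreover have "p \<le> a" using \<open>p dvd a\<close> that by (intro dvd_imp_le) auto
      ultimately show "p \<in> P" using that by (simp add: P_def)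
    qed
    have recover: "a = (\<Prod>p\<in>P. p ^ multiplicity p a)" if "a \<in> {1..Q}" for a
      using finP prP pf[OF that] that by (intro nat_eq_prod_prime_powers) auto
    have inj: "inj_on e {z. z \<in> I \<and> cls z = E}"
    proof (rule inj_onI, clarify)
      fix a b c d assume *: "(a,b) \<in> I" "(c,d) \<in> I" "e (a,b) = e (c,d)"
      have "multiplicity p a = multiplicity p c \<and> multiplicity p b = multiplicity p d" if "p \<in> P" for p
        using fun_cong[OF *(3), of p] that by (simp add: e_def)
      then have "(\<Prod>p\<in>P. p ^ multiplicity p a) = (\<Prod>p\<in>P. p ^ multiplicity p c)"
        "(\<Prod>p\<in>P. p ^ multiplicity p b) = (\<Prod>p\<in>P. p ^ multiplicity p d)"
        by (auto intro!: prod.cong)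
      with recover[of a] recover[of b] recover[of c] recover[of d] * show "a = c \<and> b = d"
        by (auto simp: I_def)
    qed
    have img: "e ` {z. z \<in> I \<and> cls z = E} \<subseteq> PiE P (B E)"
    proof clarify
      fix a b assume ab: "(a,b) \<in> I" "E = cls (a,b)"
      show "e (a,b) \<in> PiE P (B (cls (a,b)))"
      proof (rule PiE_I)
        fix p assume p: "p \<in> P"
        have "multiplicity p a \<le> Q" "multiplicity p b \<le> Q"
          using ab prP[OF p] multiplicity_le_self[of a p] multiplicity_le_self[of b p]
          by (auto simp: I_def)
        moreover have "multiplicity p a > 0 \<longleftrightarrow> p dvd a" "multiplicity p b > 0 \<longleftrightarrow> p dvd b"
          using ab prP[OF p] prime_multiplicity_gt_zero_iff[of p a]
            prime_multiplicity_gt_zero_iff[of p b] by (simp_all add: I_def)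
        moreover have "e (a,b) p = (multiplicity p a, multiplicity p b)"
          using p by (simp add: e_def)
        moreover have "p \<in> cls (a,b) \<longleftrightarrow> p dvd b \<or> (\<not> p dvd h \<and> p dvd a)"
          using p by (simp add: cls_def)
        ultimately show "e (a,b) p \<in> B (cls (a,b)) p"
          by (cases "p dvd h"; cases "p dvd a"; cases "p dvd b") (simp_all add: B_def)
      qed (simp add: e_def)
    qed
    have V: "V z = (\<Prod>p\<in>P. w p (e z p))" if "z \<in> I" for z
    proof -
      obtain a b where z: "z = (a, b)" by force
      have "real a = (\<Prod>p\<in>P. real p ^ multiplicity p a)" "real b = (\<Prod>p\<in>P. real p ^ multiplicity p b)"
        using recover[of a] recover[of b] that unfolding z I_def
        by (metis (no_types, lifting) mem_Sigma_iff of_nat_power of_nat_prod prod.cong)+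
      then have "V z = 1 / ((\<Prod>p\<in>P. real p ^ multiplicity p a) * (\<Prod>p\<in>P. real p ^ multiplicity p b))"
        by (simp add: V_def z)
      also have "\<dots> = (\<Prod>p\<in>P. w p (e z p))"
        by (simp add: w_def e_def z prod.distrib power_divide prod_dividef)
      finally show ?thesis .
    qed
    have "(\<Sum>z | z \<in> I \<and> cls z = E. V z) = (\<Sum>z | z \<in> I \<and> cls z = E. \<Prod>p\<in>P. w p (e z p))"
      by (intro sum.cong) (auto simp: V)
    also have "\<dots> = (\<Sum>y\<in>e ` {z. z \<in> I \<and> cls z = E}. \<Prod>p\<in>P. w p (y p))"
      by (simp add: sum.reindex[OF inj])
    also have "\<dots> \<le> (\<Sum>y\<in>PiE P (B E). \<Prod>p\<in>P. w p (y p))"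
      using img finP by (intro sum_mono2) (auto intro!: finite_PiE prod_nonneg wnonneg simp: B_def)
    also have "\<dots> = (\<Prod>p\<in>P. \<Sum>y\<in>B E p. w p y)"
      using finP by (intro prod_sum_PiE[symmetric]) (auto simp: B_def)
    also have "\<dots> \<le> (\<Prod>p\<in>P. (if p \<in> E then sieve_density h p else 1) *
        (if p dvd h then real p / (real p - 1) else 1))"
    proof (intro prod_mono conjI)
      fix p assume p: "p \<in> P"
      then have p2: "p \<ge> 2" using prP prime_ge_2_nat by blast
      define x where "x = 1 / real p"
      have x: "0 \<le> x" "x < 1" using p2 by (auto simp: x_def)
      define s where "s = (\<Sum>i=0..Q. x ^ i)"
      have s1: "s = 1 + (\<Sum>i=1..Q. x ^ i)"
        by (simp add: s_def sum.atLeast_Suc_atMost)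
      have s: "0 \<le> s" "s \<le> real p / (real p - 1)"
      proof -
        have "1 / (1 - x) = real p / (real p - 1)" using p2 by (simp add: x_def field_simps)
        then show "s \<le> real p / (real p - 1)" using sum_power_le_geometric[OF x] by (simp add: s_def)
        show "0 \<le> s" using x by (auto simp: s_def intro: sum_nonneg)
      qed
      have s': "s - 1 \<le> 1 / (real p - 1)"
        using s(2) p2 by (simp add: field_simps)
      have rect: "(\<Sum>y\<in>{0..Q} \<times> J. w p y) = s * (\<Sum>j\<in>J. x ^ j)" for J
        by (simp add: w_def s_def x_def sum_product sum.cartesian_product)
      show "(\<Sum>y\<in>B E p. w p y) \<le> (if p \<in> E then sieve_density h p else 1) *
        (if p dvd h then real p / (real p - 1) else 1)"
      proof (cases "p dvd h")
        case True
        show ?thesis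
        proof (cases "p \<in> E")
          case E: True
          have "(\<Sum>y\<in>B E p. w p y) = s * (s - 1)" using True E rect s1 by (simp add: B_def)
          also have "\<dots> \<le> real p / (real p - 1) * (1 / (real p - 1))"
            using s s' p2 s1 x by (intro mult_mono) (auto intro: sum_nonneg)
          finally show ?thesis using True E by (simp add: sieve_density_def)
        next
          case False
          then show ?thesis using True rect[of "{0}"] s by (simp add: B_def)
        qed
      next
        case False
        show ?thesis
        proof (cases "p \<in> E")
          case E: True
          have p3: "p \<ge> 3" using False h p2 by (cases "p = 2") auto
          have "(\<Sum>y\<in>B E p. w p y) = s * s - 1"
            using False E rect[of "{0..Q}"] by (simp add: B_def sum_diff1 s_def w_def)
          also have "\<dots> \<le> real p / (real p - 1) * (real p / (real p - 1)) - 1"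
            using s p2 by (intro diff_right_mono mult_mono) auto
          \<comment> \<open>The left side is \<open>(2 * p - 1) / (p - 1)^2\<close>, and
            \<open>(2 * p - 1) * (p - 2) \<le> 2 * (p - 1)^2\<close>.\<close>
          also have "\<dots> \<le> 2 / (real p - 2)"
          proof -
            define u where "u = real p - 2"
            have u: "u \<ge> 1" "real p = u + 2" using p3 by (auto simp: u_def)
            show ?thesis unfolding u(2) using u(1) by (simp add: divide_simps) (simp add: algebra_simps)
          qed
          finally show ?thesis using False E by (simp add: sieve_density_def)
        next
          case E: False
          then show ?thesis using False by (simp add: B_def w_def)
        qed
      qed
      show "0 \<le> (\<Sum>y\<in>B E p. w p y)" by (intro sum_nonneg wnonneg)
    qed
    also have "\<dots> = (\<Prod>p\<in>E. sieve_density h p) * (\<Prod>p\<in>P \<inter> {p. p dvd h}. real p / (real p - 1))"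
    proof -
      have "P \<inter> {p. p \<in> E} = E" using E by auto
      then show ?thesis
        using finP by (simp add: prod.distrib prod.If_cases)
    qed
    also have "\<dots> \<le> (\<Prod>p\<in>E. sieve_density h p) * prime_ratio h"
    proof -
      have "(\<Prod>p\<in>P \<inter> {p. p dvd h}. real p / (real p - 1)) \<le> prime_ratio h"
        unfolding prime_ratio_def
      proof (rule prod_mono2)
        show "P \<inter> {p. p dvd h} \<subseteq> prime_factors h" using h prP by (auto simp: prime_factors_dvd)
        fix p assume "p \<in> prime_factors h - P \<inter> {p. p dvd h}"
        then have "p \<ge> 2" using prime_ge_2_nat by auto
        then show "1 \<le> real p / (real p - 1)" by (simp add: field_simps)
      next
        fix p assume "p \<in> P \<inter> {p. p dvd h}"
        then have "p \<ge> 2" using prP prime_ge_2_nat by auto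
        then show "0 \<le> real p / (real p - 1)" by simp
      qed simp
      moreover have "(\<Prod>p\<in>E. sieve_density h p) \<ge> 0"
        using E prP sieve_density_pos[OF _ h(1)] by (intro prod_nonneg) (auto intro: less_imp_le)
      ultimately show ?thesis by (rule mult_left_mono)
    qed
    finally show ?thesis .
  qed
  have "(\<Sum>a=1..Q. 1 / real a)\<^sup>2 = (\<Sum>z\<in>I. V z)"
    by (simp add: I_def V_def power2_eq_square sum_product sum.cartesian_product)
  also have "\<dots> = (\<Sum>E\<in>cls ` I. \<Sum>z | z \<in> I \<and> cls z = E. V z)"
    by (rule sum.image_gen) (simp add: I_def)
  also have "\<dots> \<le> (\<Sum>E\<in>cls ` I. (\<Prod>p\<in>E. sieve_density h p) * prime_ratio h)"
    by (intro sum_mono fiber) (auto simp: cls_def)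
  also have "\<dots> \<le> (\<Sum>E\<in>sieve_sets (Q\<^sup>2). (\<Prod>p\<in>E. sieve_density h p) * prime_ratio h)"
  proof (intro sum_mono2 finite_sieve_sets)
    show "cls ` I \<subseteq> sieve_sets (Q\<^sup>2)" using cls_sieve by auto
    fix E assume "E \<in> sieve_sets (Q\<^sup>2) - cls ` I"
    moreover have "prime_ratio h \<ge> 0"
      unfolding prime_ratio_def
    proof (rule prod_nonneg)
      fix p assume "p \<in> prime_factors h"
      then have "p \<ge> 2" using prime_ge_2_nat by auto
      then show "0 \<le> real p / (real p - 1)" by simp
    qed
    ultimately show "0 \<le> (\<Prod>p\<in>E. sieve_density h p) * prime_ratio h"
      using prod_sieve_density_pos[OF h(1)] by (intro mult_nonneg_nonneg) (auto intro: less_imp_le)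
  qed
  also have "\<dots> = sieve_total h (Q\<^sup>2) * prime_ratio h"
    by (simp add: sieve_total_def sum_distrib_right)
  finally show ?thesis .
qed


lemma prime_ratio_ge_1: "prime_ratio n \<ge> 1"
  unfolding prime_ratio_def
proof (rule prod_ge_1)
  fix p assume "p \<in> prime_factors n"
  then have "p \<ge> 2" using prime_ge_2_nat by auto
  then show "1 \<le> real p / (real p - 1)" by simp
qed

lemma ln_le_harmonic_sum: "ln (real (Suc n)) \<le> (\<Sum>a=1..n. 1 / real a)"
proof (induction n)
  case (Suc n)
  have "ln (real (Suc (Suc n))) - ln (real (Suc n)) = ln (1 + 1 / real (Suc n))"
  proof -
    have "1 + 1 / real (Suc n) = real (Suc (Suc n)) / real (Suc n)" by (simp add: field_simps)
    then show ?thesis by (simp add: ln_div del: of_nat_Suc)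
  qed
  also have "\<dots> \<le> 1 / real (Suc n)" by (rule ln_add_one_self_le_self) simp
  finally show ?case using Suc by simp
qed simp

text \<open>The sieve is used with \<open>R = Q^2\<close> and \<open>Q\<close> about
  \<open>N powr (1/24)\<close>, so that \<open>R^6 = Q^12 \<le> sqrt N\<close> is negligible, while
  the harmonic sum up to \<open>Q\<close> is still at least \<open>ln N / 24\<close>. This gives
  \<open>1728 = 3 * 24^2\<close>; the remaining 16 pays for the \<open>n\<close> up to
  \<open>Q^2\<close>, which the sieve does not count.\<close>

lemma prime_pairs_upper_bound:
  assumes N: "N \<ge> 2" and h: "even h" "h > 0"
  shows "real (card {n. n < N \<and> prime n \<and> prime (n + h)})
           \<le> 1744 * real N / (ln (real N))\<^sup>2 * prime_ratio h"
proof -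
  define y where "y = real N powr (1/24)"
  define Q where "Q = nat \<lfloor>y\<rfloor>"
  define G where "G = sieve_total h (Q\<^sup>2)"
  define l where "l = ln (real N)"
  have l: "l > 0" using N by (simp add: l_def)
  have y1: "y \<ge> 1" using N by (simp add: y_def ge_one_powr_ge_zero)
  then have Q1: "Q \<ge> 1" by (simp add: Q_def le_nat_floor)
  have Qy: "real Q \<le> y" using y1 by (simp add: Q_def)
  have yQ: "y \<le> real (Suc Q)" using y1 unfolding Q_def by linarith
  have y12: "y ^ 12 = sqrt (real N)"
    using N by (simp add: y_def powr_realpow[symmetric] powr_powr powr_half_sqrt)
  have "(real Q ^ 2) ^ 6 \<le> y ^ 12" using Qy by (simp add: power_mult[symmetric] power_mono)
  then have R6: "real (Q\<^sup>2) ^ 6 \<le> sqrt (real N)" using y12 by simp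
  have sqN: "sqrt (real N) \<le> real N" using N by (intro real_le_lsqrt) (auto simp: power2_eq_square)
  have "l / 24 = ln y" using N by (simp add: l_def y_def ln_powr)
  also have "\<dots> \<le> ln (real (Suc Q))" using y1 yQ by simp
  also have "\<dots> \<le> (\<Sum>a=1..Q. 1 / real a)" by (rule ln_le_harmonic_sum)
  finally have "(l / 24)\<^sup>2 \<le> (\<Sum>a=1..Q. 1 / real a)\<^sup>2" using l by (intro power_mono) auto
  also have "\<dots> \<le> G * prime_ratio h" unfolding G_def by (rule sieve_total_lower_bound[OF h])
  finally have GH: "l\<^sup>2 / 576 \<le> G * prime_ratio h" by (simp add: power_divide)
  have G1: "G \<ge> 1" unfolding G_def using Q1 h by (intro sieve_total_ge_1) auto
  define S where "S = {n. n < N \<and> Q\<^sup>2 < n \<and> prime n \<and> prime (n + h)}"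
  have "real (card S) * G \<le> real N + 2 * real (Q\<^sup>2) ^ 6"
    unfolding S_def G_def using h Q1 by (intro selberg_sieve_prime_pairs) auto
  also have "\<dots> \<le> 3 * real N" using R6 sqN by linarith
  finally have SG: "real (card S) * G \<le> 3 * real N" .
  have "real (card S) * l\<^sup>2 \<le> real (card S) * (576 * (G * prime_ratio h))"
    using GH by (intro mult_left_mono) auto
  also have "\<dots> = (real (card S) * G) * (576 * prime_ratio h)" by simp
  also have "\<dots> \<le> (3 * real N) * (576 * prime_ratio h)"
    using SG prime_ratio_ge_1[of h] by (intro mult_right_mono) auto
  finally have cS: "real (card S) \<le> 1728 * real N / l\<^sup>2 * prime_ratio h"
    using l by (simp add: field_simps)
  have "real (Q\<^sup>2) \<le> real (Q\<^sup>2) ^ 6"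
    using Q1 by (intro self_le_power) (auto simp: Suc_le_eq)
  also have "\<dots> \<le> sqrt (real N)" by (rule R6)
  also have "\<dots> \<le> 16 * real N / l\<^sup>2"
  proof -
    have "l = 4 * ln (real N powr (1/4))" using N by (simp add: l_def ln_powr)
    also have "\<dots> \<le> 4 * real N powr (1/4)" using N by (intro mult_left_mono ln_bound) auto
    finally have "l\<^sup>2 \<le> (4 * real N powr (1/4))\<^sup>2" using l by (intro power_mono) auto
    also have "\<dots> = 16 * sqrt (real N)"
      using N by (simp add: power_mult_distrib powr_realpow[symmetric] powr_powr powr_half_sqrt)
    finally have "sqrt (real N) * l\<^sup>2 \<le> sqrt (real N) * (16 * sqrt (real N))"
      by (intro mult_left_mono) auto
    also have "\<dots> = 16 * real N" by simp
    finally show ?thesis using l by (simp add: field_simps)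
  qed
  also have "\<dots> \<le> 16 * real N / l\<^sup>2 * prime_ratio h"
    using mult_left_mono[OF prime_ratio_ge_1[of h], of "16 * real N / l\<^sup>2"] by simp
  finally have cQ: "real (Q\<^sup>2) \<le> 16 * real N / l\<^sup>2 * prime_ratio h" .
  have "{n. n < N \<and> prime n \<and> prime (n + h)} \<subseteq> S \<union> {1..Q\<^sup>2}"
    using prime_ge_1_nat by (auto simp: S_def)
  then have "card {n. n < N \<and> prime n \<and> prime (n + h)} \<le> card (S \<union> {1..Q\<^sup>2})"
    by (intro card_mono) (auto simp: S_def)
  also have "\<dots> \<le> card S + Q\<^sup>2" using card_Un_le[of S "{1..Q\<^sup>2}"] by simp
  finally have "real (card {n. n < N \<and> prime n \<and> prime (n + h)}) \<le> real (card S) + real (Q\<^sup>2)"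
    by (simp only: of_nat_add[symmetric] of_nat_le_iff)
  also have "\<dots> \<le> 1728 * real N / l\<^sup>2 * prime_ratio h + 16 * real N / l\<^sup>2 * prime_ratio h"
    using cS cQ by (rule add_mono)
  also have "\<dots> = 1744 * real N / l\<^sup>2 * prime_ratio h"
    by (simp add: field_simps)
  finally show ?thesis by (simp add: l_def)
qed


section \<open>Dirichlet characters\<close>

text \<open>Abel summation. The induction on \<open>b\<close> concerns the sum minus its boundary
  term \<open>T b * f b\<close>: each step then adds only
  \<open>T (Suc k) * (f k - f (Suc k))\<close>, and these bounds telescope.\<close>

lemma norm_sum_mult_decreasing_le:
  fixes c :: "nat \<Rightarrow> complex" and f :: "nat \<Rightarrow> real"
  assumes B: "\<And>k. norm (\<Sum>n\<in>{a..<k}. c n) \<le> B"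
    and mono: "\<And>n. a \<le> n \<Longrightarrow> f (Suc n) \<le> f n" and nonneg: "\<And>n. a \<le> n \<Longrightarrow> 0 \<le> f n"
  shows "norm (\<Sum>n\<in>{a..<b}. c n * of_real (f n)) \<le> B * f a"
proof (cases "a \<le> b")
  case True
  define T where "T = (\<lambda>k. \<Sum>n\<in>{a..<k}. c n)"
  have "norm ((\<Sum>n\<in>{a..<b}. c n * of_real (f n)) - T b * of_real (f b)) \<le> B * (f a - f b)"
    using True
  proof (induction b rule: dec_induct)
    case (step k)
    have "T (Suc k) = T k + c k" using step by (simp add: T_def)
    then have "(\<Sum>n\<in>{a..<Suc k}. c n * of_real (f n)) - T (Suc k) * of_real (f (Suc k))
        = ((\<Sum>n\<in>{a..<k}. c n * of_real (f n)) - T k * of_real (f k))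
          + T (Suc k) * of_real (f k - f (Suc k))"
      using step by (simp add: algebra_simps)
    also have "norm \<dots> \<le> B * (f a - f k) + B * (f k - f (Suc k))"
      using step B[of "Suc k"] mono[of k] unfolding T_def
      by (intro norm_triangle_mono step.IH[unfolded T_def]) (auto simp: norm_mult abs_of_nonneg simp del: of_real_diff intro!: mult_right_mono)
    finally show ?case by (simp add: algebra_simps)
  qed (simp add: T_def)
  moreover have "norm (T b * of_real (f b)) \<le> B * f b"
    using B[of b] nonneg[OF True] by (auto simp: T_def norm_mult intro!: mult_right_mono)
  ultimately have "norm (((\<Sum>n\<in>{a..<b}. c n * of_real (f n)) - T b * of_real (f b)) + T b * of_real (f b))
      \<le> B * (f a - f b) + B * f b"
    by (rule norm_triangle_mono)
  then show ?thesis by (simp add: algebra_simps)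
next
  case False
  have "0 \<le> B" using B[of 0] norm_ge_zero order.trans by blast
  with False nonneg[of a] show ?thesis by simp
qed

lemma coprime_add_modulus_iff: "coprime (x + m) m \<longleftrightarrow> coprime x m" for x m :: nat
  unfolding coprime_iff_gcd_eq_1 by (simp only: gcd_add1)

text \<open>Characters of the unit group modulo \<open>m\<close>, extended by 0 to all natural
  numbers. The value 1 at 1 follows, since \<open>\<chi> 1\<close> is idempotent and
  non-zero.\<close>

locale dcharacter =
  fixes m :: nat and \<chi> :: "nat \<Rightarrow> complex"
  assumes modulus_pos: "m > 0"
    and mult: "\<chi> (a * b) = \<chi> a * \<chi> b"
    and periodic: "\<chi> (a + m) = \<chi> a"
    and nonzero_iff: "\<chi> a \<noteq> 0 \<longleftrightarrow> coprime a m"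
begin

lemma one [simp]: "\<chi> (Suc 0) = 1"
proof -
  have "\<chi> (Suc 0) * \<chi> (Suc 0) = \<chi> (Suc 0)" using mult[of "Suc 0" "Suc 0", symmetric] by simp
  then show ?thesis using nonzero_iff[of "Suc 0"] by simp
qed

lemma cong: "[a = b] (mod m) \<Longrightarrow> \<chi> a = \<chi> b"
  using periodic_mod[of \<chi> m, OF periodic] by (metis Cong.cong_def)

lemma power: "\<chi> (a ^ k) = \<chi> a ^ k"
  by (induction k) (simp_all add: mult)

lemma power_totient: "coprime a m \<Longrightarrow> \<chi> a ^ totient m = 1"
  using euler_theorem[of a m] cong[of "a ^ totient m" 1] by (simp add: power)

lemma norm_eq_1: "coprime a m \<Longrightarrow> norm (\<chi> a) = 1"
  using power_totient[of a] power_eq_1_iff[of "\<chi> a" "totient m"] modulus_pos by auto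

lemma norm_le_1: "norm (\<chi> a) \<le> 1"
  using norm_eq_1[of a] nonzero_iff[of a] by (cases "coprime a m") auto

end

definition principal_dcharacter :: "nat \<Rightarrow> nat \<Rightarrow> complex" where
  "principal_dcharacter m a = (if coprime a m then 1 else 0)"

lemma dcharacter_principal: "m > 0 \<Longrightarrow> dcharacter m (principal_dcharacter m)"
  by unfold_locales (auto simp: principal_dcharacter_def coprime_add_modulus_iff)

lemma dcharacter_mult:
  assumes "dcharacter m \<chi>" "dcharacter m \<psi>"
  shows "dcharacter m (\<lambda>a. \<chi> a * \<psi> a)"
proof -
  interpret \<chi>: dcharacter m \<chi> by fact
  interpret \<psi>: dcharacter m \<psi> by fact
  show ?thesis
    using \<chi>.modulus_pos \<chi>.nonzero_iff \<psi>.nonzero_iff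
    by unfold_locales (auto simp: \<chi>.mult \<psi>.mult \<chi>.periodic \<psi>.periodic)
qed

lemma dcharacter_cnj:
  assumes "dcharacter m \<chi>"
  shows "dcharacter m (\<lambda>a. cnj (\<chi> a))"
proof -
  interpret \<chi>: dcharacter m \<chi> by fact
  show ?thesis
    using \<chi>.modulus_pos \<chi>.nonzero_iff by unfold_locales (auto simp: \<chi>.mult \<chi>.periodic)
qed

text \<open>A character is determined by its values below \<open>m\<close>, each of which is 0 or a
  root of \<open>z ^ totient m = 1\<close>.\<close>

lemma finite_dcharacters: "finite {\<chi>. dcharacter m \<chi>}"
proof (cases "m > 0")
  case True
  define Z where "Z = insert 0 {z::complex. z ^ totient m = 1}"
  have Z: "finite Z" using True by (simp add: Z_def finite_roots_unity Suc_le_eq)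
  have "inj_on (\<lambda>\<chi>. restrict \<chi> {..<m}) {\<chi>. dcharacter m \<chi>}"
  proof (rule inj_onI, clarify)
    fix \<chi> \<psi> :: "nat \<Rightarrow> complex"
    assume *: "dcharacter m \<chi>" "dcharacter m \<psi>" "restrict \<chi> {..<m} = restrict \<psi> {..<m}"
    show "\<chi> = \<psi>"
    proof
      fix a
      have "a mod m < m" using True by simp
      then have "\<chi> (a mod m) = \<psi> (a mod m)" using fun_cong[OF *(3), of "a mod m"] by simp
      then show "\<chi> a = \<psi> a"
        using dcharacter.cong[OF *(1), of "a mod m" a] dcharacter.cong[OF *(2), of "a mod m" a] by simp
    qed
  qed
  moreover have "(\<lambda>\<chi>. restrict \<chi> {..<m}) ` {\<chi>. dcharacter m \<chi>} \<subseteq> PiE {..<m} (\<lambda>_. Z)"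
  proof clarify
    fix \<chi> assume "dcharacter m \<chi>"
    then interpret dcharacter m \<chi> .
    have "\<chi> a \<in> Z" for a
      using power_totient[of a] nonzero_iff[of a] by (cases "coprime a m") (auto simp: Z_def)
    then show "restrict \<chi> {..<m} \<in> PiE {..<m} (\<lambda>_. Z)" by auto
  qed
  then have "finite ((\<lambda>\<chi>. restrict \<chi> {..<m}) ` {\<chi>. dcharacter m \<chi>})"
    by (rule finite_subset) (intro finite_PiE Z finite_lessThan)
  ultimately show ?thesis by (rule finite_imageD[rotated])
next
  case False
  then have "{\<chi>. dcharacter m \<chi>} = {}" by (auto dest: dcharacter.modulus_pos)
  then show ?thesis by simp
qed

context dcharacter
begin

lemma sum_period_eq_0:
  assumes "\<chi> \<noteq> principal_dcharacter m"
  shows "(\<Sum>a<m. \<chi> a) = 0"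
proof -
  obtain c where c: "coprime c m" "\<chi> c \<noteq> 1"
  proof -
    from assms obtain c where "\<chi> c \<noteq> principal_dcharacter m c" by blast
    then show ?thesis using that nonzero_iff[of c] by (auto simp: principal_dcharacter_def split: if_splits)
  qed
  have inj: "inj_on (\<lambda>a. c * a mod m) {..<m}"
  proof (rule inj_onI)
    fix a b assume "a \<in> {..<m}" "b \<in> {..<m}" "c * a mod m = c * b mod m"
    moreover from this have "[c * a = c * b] (mod m)" by (simp add: Cong.cong_def)
    then have "[a = b] (mod m)" using c by (simp add: cong_mult_lcancel_nat)
    ultimately show "a = b" by (simp add: cong_less_modulus_unique_nat)
  qed
  have "(\<lambda>a. c * a mod m) ` {..<m} = {..<m}"
    using inj modulus_pos by (intro endo_inj_surj) auto
  then have "(\<Sum>a<m. \<chi> a) = (\<Sum>a<m. \<chi> (c * a mod m))"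
    by (metis (no_types, lifting) inj o_apply sum.cong sum.reindex)
  also have "\<dots> = (\<Sum>a<m. \<chi> c * \<chi> a)"
  proof (rule sum.cong)
    fix a
    have "\<chi> (c * a mod m) = \<chi> (c * a)" by (rule cong) simp
    then show "\<chi> (c * a mod m) = \<chi> c * \<chi> a" by (simp add: mult)
  qed simp
  also have "\<dots> = \<chi> c * (\<Sum>a<m. \<chi> a)" by (simp add: sum_distrib_left)
  finally show ?thesis using c by (simp add: algebra_simps)
qed

lemma norm_partial_sum_le:
  assumes "\<chi> \<noteq> principal_dcharacter m"
  shows "norm (\<Sum>n\<in>{a..<b}. \<chi> n) \<le> 2 * real m"
proof (cases "a \<le> b")
  case True
  have le: "norm (\<Sum>n<N. \<chi> n) \<le> real m" for N
  proof -
    have "(\<Sum>n<N. \<chi> n) = (\<Sum>n<N mod m. \<chi> n)"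
      using sum_periodic_div_mod[of m \<chi> N] modulus_pos periodic sum_period_eq_0[OF assms] by simp
    also have "norm \<dots> \<le> (\<Sum>n<N mod m. 1)"
      by (intro order.trans[OF norm_sum] sum_mono norm_le_1)
    also have "\<dots> \<le> real m" using modulus_pos by (simp add: less_imp_le)
    finally show ?thesis .
  qed
  have "{..<b} = {..<a} \<union> {a..<b}" using True by auto
  then have "(\<Sum>n<b. \<chi> n) = (\<Sum>n<a. \<chi> n) + (\<Sum>n\<in>{a..<b}. \<chi> n)"
    by (simp add: sum.union_disjoint ivl_disj_int)
  then have "norm (\<Sum>n\<in>{a..<b}. \<chi> n) = norm ((\<Sum>n<b. \<chi> n) - (\<Sum>n<a. \<chi> n))" by simp
  also have "\<dots> \<le> real m + real m" by (rule norm_triangle_le_diff) (intro add_mono le)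
  finally show ?thesis by simp
qed simp

end

text \<open>For a squarefree modulus it suffices to lift a character that is injective on the powers of a
  primitive root modulo a single prime factor.\<close>

lemma dcharacter_separates:
  assumes "squarefree m" "m > 0" "coprime a m" "\<not> [a = 1] (mod m)"
  shows "\<exists>\<chi>. dcharacter m \<chi> \<and> \<chi> a \<noteq> 1"
proof -
  have m: "m = (\<Prod>p\<in>prime_factors m. p)"
    using squarefree_eq_prod_prime_factors[OF assms(1,2)] by simp
  obtain p where p: "p \<in> prime_factors m" "\<not> [a = 1] (mod p)"
  proof (rule ccontr)
    assume "\<not> thesis"
    then have "\<forall>p\<in>prime_factors m. [a = 1] (mod p)" using that by blast
    then have "[a = 1] (mod (\<Prod>p\<in>prime_factors m. p))"
      by (intro coprime_cong_prod_nat) (auto intro: primes_coprime)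
    with m assms(4) show False by simp
  qed
  then have pp: "prime p" "p dvd m" by auto
  then have p1: "p > 1" using prime_gt_1_nat by blast
  obtain g where g: "residue_primroot p g"
    using prime_primitive_root_exists[of p] pp p1 by auto
  define N where "N = totient p"
  define \<zeta> where "\<zeta> = cis (2 * pi / real N)"
  have Npos: "N > 0" using p1 by (simp add: N_def)
  have ordg: "ord p g = N" "coprime p g" using g by (auto simp: residue_primroot_def N_def)
  have bij: "bij_betw (\<lambda>i. g ^ i mod p) {..<N} (totatives p)"
    unfolding N_def by (rule residue_primroot_is_generator[OF p1 g])
  \<comment> \<open>The discrete logarithm modulo \<open>p\<close> to base \<open>g\<close>. It is
    additive only modulo \<open>N\<close>, which is enough because
    \<open>\<zeta> ^ N = 1\<close>.\<close>
  define ix where "ix = (\<lambda>x. inv_into {..<N} (\<lambda>i. g ^ i mod p) (x mod p))"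
  have ix: "ix x < N \<and> g ^ ix x mod p = x mod p" if "coprime x m" for x
  proof -
    have "coprime x p" using that pp by (metis coprime_divisors dvd_refl)
    then have "x mod p \<in> totatives p" using p1
      by (auto simp: totatives_def coprime_commute intro!: Nat.gr0I)
    then have "x mod p \<in> (\<lambda>i. g ^ i mod p) ` {..<N}" using bij by (simp add: bij_betw_def)
    from inv_into_into[OF this] f_inv_into_f[OF this] show ?thesis by (auto simp: ix_def)
  qed
  have \<zeta>pow: "\<zeta> ^ k = \<zeta> ^ l" if "[k = l] (mod N)" for k l
  proof -
    have "\<zeta> ^ N = 1" using Npos by (simp add: \<zeta>_def DeMoivre)
    then have "\<zeta> ^ k = \<zeta> ^ (k mod N)" for k
      by (metis mult_div_mod_eq mult.right_neutral mult_1 power_add power_mult power_one)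
    then show ?thesis using that by (metis Cong.cong_def)
  qed
  define \<chi> where "\<chi> = (\<lambda>x. if coprime x m then \<zeta> ^ ix x else 0)"
  have "dcharacter m \<chi>"
  proof
    fix x y
    show "\<chi> (x * y) = \<chi> x * \<chi> y"
    proof (cases "coprime x m \<and> coprime y m")
      case True
      then have "g ^ (ix x + ix y) mod p = g ^ ix (x * y) mod p"
        using ix[of x] ix[of y] ix[of "x * y"] by (metis coprime_mult_left_iff mod_mult_eq power_add)
      then have "[ix x + ix y = ix (x * y)] (mod N)"
        using order_divides_expdiff[of p g] ordg by (simp add: Cong.cong_def)
      from \<zeta>pow[OF this] True show ?thesis by (simp add: \<chi>_def power_add)
    qed (auto simp: \<chi>_def)
    have "(x + m) mod p = x mod p" using pp by (metis dvd_def mod_mult_self2)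
    then have "ix (x + m) = ix x" unfolding ix_def by (rule arg_cong)
    moreover have "coprime (x + m) m \<longleftrightarrow> coprime x m" by (rule coprime_add_modulus_iff)
    ultimately show "\<chi> (x + m) = \<chi> x" by (simp only: \<chi>_def)
  qed (use assms in \<open>auto simp: \<chi>_def \<zeta>_def\<close>)
  moreover have "\<chi> a \<noteq> 1"
  proof
    assume "\<chi> a = 1"
    then have "\<zeta> ^ ix a = 1" using assms(3) by (simp add: \<chi>_def)
    then have "cis (2 * pi * real (ix a) / real N) = cis (2 * pi * real 0 / real N)"
      by (simp add: \<zeta>_def DeMoivre mult_ac)
    then have "ix a = 0"
      using bij_betw_roots_unity[OF Npos] ix[OF assms(3)] Npos unfolding bij_betw_def inj_on_def by fastforce
    then have "[a = 1] (mod p)" using ix[OF assms(3)] by (simp add: Cong.cong_def)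
    with p show False by simp
  qed
  ultimately show ?thesis by blast
qed

text \<open>With \<open>c\<close> inverse to \<open>b\<close>,
  \<open>cnj (\<chi> b) = \<chi> c\<close>, so the sum runs over \<open>\<chi> (a * c)\<close>. When
  \<open>a * c\<close> is coprime but not congruent to 1, multiplication by a separating character
  permutes all characters and scales the sum by a value other than 1, so the sum vanishes.\<close>

lemma sum_dcharacters:
  assumes "squarefree m" "m > 0" "coprime b m"
  shows "(\<Sum>\<chi> | dcharacter m \<chi>. \<chi> a * cnj (\<chi> b))
           = (if [a = b] (mod m) then of_nat (card {\<chi>. dcharacter m \<chi>}) else 0)"
proof -
  define X where "X = {\<chi>. dcharacter m \<chi>}"
  obtain c where c: "[b * c = 1] (mod m)" using cong_solve_coprime_nat[OF assms(3)] by auto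
  have cm: "coprime c m"
    using cong_imp_coprime[OF cong_sym[OF c]] by simp
  have cnj: "cnj (\<chi> b) = \<chi> c" if "dcharacter m \<chi>" for \<chi>
  proof -
    interpret dcharacter m \<chi> by fact
    have 1: "\<chi> b * \<chi> c = 1" using cong[OF c] by (simp add: mult)
    have 2: "\<chi> b * cnj (\<chi> b) = 1"
      using norm_eq_1[OF assms(3)] by (simp add: complex_norm_square[symmetric])
    from 1 have "\<chi> b \<noteq> 0" by auto
    with 1 2 show ?thesis by (metis mult_left_cancel)
  qed
  have eq: "(\<Sum>\<chi> | dcharacter m \<chi>. \<chi> a * cnj (\<chi> b)) = (\<Sum>\<chi>\<in>X. \<chi> (a * c))"
    unfolding X_def by (intro sum.cong) (auto simp: cnj dcharacter.mult)
  have iff: "[a * c = 1] (mod m) \<longleftrightarrow> [a = b] (mod m)"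
  proof
    assume "[a * c = 1] (mod m)"
    with c have "[c * a = c * b] (mod m)" by (metis cong_sym cong_trans mult.commute)
    then show "[a = b] (mod m)" using cm by (simp add: cong_mult_lcancel_nat)
  next
    assume "[a = b] (mod m)"
    then have "[a * c = b * c] (mod m)" by (rule cong_scalar_right)
    with c show "[a * c = 1] (mod m)" by (metis cong_trans)
  qed
  show ?thesis
  proof (cases "[a = b] (mod m)")
    case True
    have "(\<Sum>\<chi>\<in>X. \<chi> (a * c)) = (\<Sum>\<chi>\<in>X. 1)"
    proof (rule sum.cong)
      fix \<chi> assume "\<chi> \<in> X"
      then interpret dcharacter m \<chi> by (simp add: X_def)
      show "\<chi> (a * c) = 1" using cong[of "a * c" 1] True iff one by simp
    qed simp
    with eq True show ?thesis by (simp add: X_def)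
  next
    case False
    show ?thesis
    proof (cases "coprime (a * c) m")
      case True
      obtain \<psi> where \<psi>: "dcharacter m \<psi>" "\<psi> (a * c) \<noteq> 1"
        using dcharacter_separates[OF assms(1,2) True] False iff by auto
      have inj: "inj_on (\<lambda>\<chi> a. \<psi> a * \<chi> a) X"
      proof (rule inj_onI, rule ext)
        fix \<chi> \<chi>' n assume "\<chi> \<in> X" "\<chi>' \<in> X" and eq: "(\<lambda>a. \<psi> a * \<chi> a) = (\<lambda>a. \<psi> a * \<chi>' a)"
        then have X: "dcharacter m \<chi>" "dcharacter m \<chi>'" by (simp_all add: X_def)
        show "\<chi> n = \<chi>' n"
          using fun_cong[OF eq, of n] dcharacter.nonzero_iff[OF \<psi>(1), of n]
            dcharacter.nonzero_iff[OF X(1), of n] dcharacter.nonzero_iff[OF X(2), of n] by auto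
      qed
      have img: "(\<lambda>\<chi> a. \<psi> a * \<chi> a) ` X = X"
        using inj finite_dcharacters dcharacter_mult[OF \<psi>(1)]
        by (intro endo_inj_surj) (auto simp: X_def)
      have "(\<Sum>\<chi>\<in>X. \<chi> (a * c)) = (\<Sum>\<chi>\<in>(\<lambda>\<chi> a. \<psi> a * \<chi> a) ` X. \<chi> (a * c))" by (simp only: img)
      also have "\<dots> = (\<Sum>\<chi>\<in>X. \<psi> (a * c) * \<chi> (a * c))" by (simp add: sum.reindex[OF inj])
      also have "\<dots> = \<psi> (a * c) * (\<Sum>\<chi>\<in>X. \<chi> (a * c))" by (simp add: sum_distrib_left)
      finally have "(\<Sum>\<chi>\<in>X. \<chi> (a * c)) = 0" using \<psi>(2) by (simp add: algebra_simps)
      with eq False show ?thesis by simp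
    next
      case nc: False
      have "(\<Sum>\<chi>\<in>X. \<chi> (a * c)) = 0"
      proof (intro sum.neutral ballI)
        fix \<chi> assume "\<chi> \<in> X"
        then show "\<chi> (a * c) = 0" using nc dcharacter.nonzero_iff[of m \<chi> "a * c"]
          unfolding X_def by blast
      qed
      with eq False show ?thesis by simp
    qed
  qed
qed


section \<open>Character sums over the von Mangoldt function\<close>

text \<open>\<open>ln x / x\<close> decreases from \<open>x = e\<close> on; hence the threshold 3,
  and the separate treatment of \<open>n < 3\<close> in the logarithmic character sum.\<close>

lemma ln_over_self_decreasing:
  assumes "n \<ge> 3"
  shows "ln (real (Suc n)) / real (Suc n) \<le> ln (real n) / real n"
proof -
  have "exp 1 \<le> real n" using exp_le assms by linarith
  then have "1 \<le> ln (real n)" using assms by (subst ln_ge_iff) auto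
  then have "real n * ln (real (Suc n)) \<le> real (Suc n) * ln (real n)"
    using real_mult_ln_Suc_diff_le[of n] assms by (simp add: algebra_simps)
  then show ?thesis using assms by (simp add: field_simps)
qed

context dcharacter
begin

text \<open>The value at 1 of the Dirichlet L-series of \<open>\<chi>\<close>. The index 0
  contributes 0 because division by 0 yields 0. For the principal character the series diverges, so
  statements about \<open>L1\<close> exclude it.\<close>

definition L1 :: complex where "L1 = (\<Sum>n. \<chi> n / of_nat n)"

lemma sum_divisors:
  "(\<Sum>n=1..N. \<chi> n * (\<Sum>d | d dvd n. f d (n div d)))
     = (\<Sum>d=1..N. \<Sum>e=1..N div d. \<chi> d * \<chi> e * f d e)"
proof -
  have "(\<Sum>n=1..N. \<chi> n * (\<Sum>d | d dvd n. f d (n div d)))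
      = (\<Sum>n=1..N. \<Sum>d | d dvd n. \<chi> d * \<chi> (n div d) * f d (n div d))"
  proof (intro sum.cong refl)
    fix n
    have "\<chi> n * f d (n div d) = \<chi> d * \<chi> (n div d) * f d (n div d)" if "d dvd n" for d
      using that by (simp add: mult[symmetric])
    then show "\<chi> n * (\<Sum>d | d dvd n. f d (n div d))
        = (\<Sum>d | d dvd n. \<chi> d * \<chi> (n div d) * f d (n div d))"
      unfolding sum_distrib_left by (intro sum.cong refl) (simp only: mem_Collect_eq)
  qed
  then show ?thesis by (simp only: sum_divisors_swap[of "\<lambda>d e. \<chi> d * \<chi> e * f d e"])
qed

lemma norm_sum_decreasing_le:
  assumes "\<chi> \<noteq> principal_dcharacter m"
    and "\<And>n. a \<le> n \<Longrightarrow> f (Suc n) \<le> f n" "\<And>n. a \<le> n \<Longrightarrow> 0 \<le> f n"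
  shows "norm (\<Sum>n\<in>{a..<b}. \<chi> n * of_real (f n)) \<le> 2 * real m * f a"
  using assms norm_partial_sum_le by (intro norm_sum_mult_decreasing_le) auto

lemma norm_sum_inverse_le:
  assumes "\<chi> \<noteq> principal_dcharacter m" "a \<ge> 1"
  shows "norm (\<Sum>n\<in>{a..<b}. \<chi> n / of_nat n) \<le> 2 * real m / real a"
  using norm_sum_decreasing_le[OF assms(1), of a "\<lambda>n. 1 / real n" b] assms(2)
  by (simp add: frac_le)

lemma norm_sum_minus_L1_le:
  assumes "\<chi> \<noteq> principal_dcharacter m"
  shows "norm ((\<Sum>n=1..N. \<chi> n / of_nat n) - L1) \<le> 2 * real m / real (Suc N)"
proof -
  have summable: "summable (\<lambda>n. \<chi> n / of_nat n)"
    unfolding summable_Cauchy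
  proof (intro allI impI)
    fix e :: real assume "e > 0"
    obtain M where M: "2 * real m / e < real M" using reals_Archimedean2 by blast
    have "norm (\<Sum>n\<in>{a..<b}. \<chi> n / of_nat n) < e" if "a \<ge> Suc M" for a b
    proof -
      have "norm (\<Sum>n\<in>{a..<b}. \<chi> n / of_nat n) \<le> 2 * real m / real a"
        using that by (intro norm_sum_inverse_le assms) auto
      also have "\<dots> < e" using M that \<open>e > 0\<close> by (simp add: field_simps) (smt (verit) mult_left_mono of_nat_Suc of_nat_mono)
      finally show ?thesis .
    qed
    then show "\<exists>N. \<forall>a\<ge>N. \<forall>b. norm (\<Sum>n\<in>{a..<b}. \<chi> n / of_nat n) < e" by blast
  qed
  define S where "S = (\<lambda>N. \<Sum>n<N. \<chi> n / of_nat n)"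
  have S: "S \<longlonglongrightarrow> L1" unfolding S_def L1_def using summable by (rule summable_LIMSEQ)
  have "(\<lambda>k. norm (S (Suc N) - S k)) \<longlonglongrightarrow> norm (S (Suc N) - L1)" by (intro tendsto_intros S)
  moreover have "norm (S (Suc N) - S k) \<le> 2 * real m / real (Suc N)" if "k \<ge> Suc N" for k
  proof -
    have "{..<k} = {..<Suc N} \<union> {Suc N..<k}" using that by auto
    then have "S k = S (Suc N) + (\<Sum>n\<in>{Suc N..<k}. \<chi> n / of_nat n)"
      unfolding S_def by (simp add: sum.union_disjoint ivl_disj_int del: lessThan_Suc sum.lessThan_Suc)
    then show ?thesis using norm_sum_inverse_le[OF assms, of "Suc N" k] by simp
  qed
  ultimately have "norm (S (Suc N) - L1) \<le> 2 * real m / real (Suc N)"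
    by (intro LIMSEQ_le_const2) blast+
  moreover have "S (Suc N) = (\<Sum>n=1..N. \<chi> n / of_nat n)"
    unfolding S_def by (intro sum.mono_neutral_cong_right) auto
  ultimately show ?thesis by simp
qed

text \<open>The tail bound at \<open>N div d\<close>, brought into a form whose factor
  \<open>d\<close> cancels the \<open>1 / d\<close> of the outer sum in the two estimates
  below.\<close>

lemma norm_sum_quotient_minus_L1_le:
  assumes "\<chi> \<noteq> principal_dcharacter m" "1 \<le> d" "d \<le> N"
  shows "norm ((\<Sum>n=1..N div d. \<chi> n / of_nat n) - L1) \<le> 2 * real m * real d / real N"
proof -
  have "real N \<le> real d * real (Suc (N div d))"
  proof -
    have "N \<le> d * Suc (N div d)"
      using assms(2) mod_less_divisor[of d N] by (metis add_le_mono1 div_mult_mod_eq less_imp_le less_le_trans mult.commute mult_Suc_right nat_add_left_cancel_le add.commute zero_less_one)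
    then show ?thesis by (simp only: of_nat_mult[symmetric] of_nat_le_iff)
  qed
  then have "2 * real m * real N \<le> 2 * real m * (real d * real (Suc (N div d)))"
    by (intro mult_left_mono) auto
  then have "2 * real m / real (Suc (N div d)) \<le> 2 * real m * real d / real N"
    using assms by (simp add: divide_simps mult_ac del: of_nat_Suc)
  with norm_sum_minus_L1_le[OF assms(1), of "N div d"] show ?thesis by linarith
qed

definition mangoldt_sum_char :: "nat \<Rightarrow> complex" where
  "mangoldt_sum_char N = (\<Sum>n=1..N. \<chi> n * of_real (mangoldt n / real n))"

text \<open>The sum of \<open>\<chi> n * ln n / n\<close> is evaluated twice. It is bounded by
  partial summation; and since \<open>ln n\<close> is the divisor sum of \<open>mangoldt\<close>, it
  equals \<open>L1\<close> times the sum in question up to an error that Chebyshev's bound controls.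
  Dividing by \<open>L1\<close> finishes.\<close>

lemma mangoldt_sum_char_bounded:
  assumes "\<chi> \<noteq> principal_dcharacter m" "L1 \<noteq> 0"
  shows "\<exists>C. \<forall>N\<ge>1. norm (mangoldt_sum_char N) \<le> C"
proof -
  define K where "K = 2 + 2 * real m * (ln 3 / 3)"
  have log_sum: "norm (\<Sum>n=1..N. \<chi> n * of_real (ln (real n) / real n)) \<le> K" for N
  proof -
    have eq: "(\<Sum>n=1..N. \<chi> n * of_real (ln (real n) / real n)) =
        (\<Sum>n\<in>{1..N} \<inter> {..<3}. \<chi> n * of_real (ln (real n) / real n))
        + (\<Sum>n\<in>{3..<Suc N}. \<chi> n * of_real (ln (real n) / real n))"
      by (subst sum.union_disjoint[symmetric]) (auto intro!: sum.cong)
    have le1: "norm (\<Sum>n\<in>{1..N} \<inter> {..<3}. \<chi> n * of_real (ln (real n) / real n)) \<le> 2"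
    proof -
      have "norm (\<Sum>n\<in>{1..N} \<inter> {..<3}. \<chi> n * of_real (ln (real n) / real n)) \<le> (\<Sum>n\<in>{1..N} \<inter> {..<3}. 1)"
      proof (intro order.trans[OF norm_sum] sum_mono)
        fix n assume n: "n \<in> {1..N} \<inter> {..<3}"
        have "\<bar>ln (real n) / real n\<bar> \<le> 1" using n ln_le_minus_one[of "real n"] by (simp add: field_simps)
        from mult_mono[OF norm_le_1[of n] this] show "norm (\<chi> n * of_real (ln (real n) / real n)) \<le> 1"
          by (simp add: norm_mult del: of_real_divide)
      qed
      also have "\<dots> = real (card ({1..N} \<inter> {..<3}))" by simp
      also have "\<dots> \<le> real (card {1..<3::nat})" by (intro of_nat_mono card_mono) auto
      finally show ?thesis by simp
    qed
    have le2: "norm (\<Sum>n\<in>{3..<Suc N}. \<chi> n * of_real (ln (real n) / real n)) \<le> 2 * real m * (ln 3 / 3)"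
      using norm_sum_decreasing_le[OF assms(1), of 3 "\<lambda>n. ln (real n) / real n" "Suc N"]
        ln_over_self_decreasing by simp
    show ?thesis unfolding eq K_def by (rule norm_triangle_mono[OF le1 le2])
  qed
  have "norm (mangoldt_sum_char N) \<le> (K + 8 * real m) / norm L1" if N: "N \<ge> 1" for N
  proof -
    define E where "E = (\<lambda>d. (\<Sum>n=1..N div d. \<chi> n / of_nat n) - L1)"
    have "(\<Sum>n=1..N. \<chi> n * of_real (ln (real n) / real n))
        = (\<Sum>n=1..N. \<chi> n * (\<Sum>d | d dvd n. of_real (mangoldt d / real d) / of_nat (n div d)))"
    proof (intro sum.cong refl)
      fix n assume n: "n \<in> {1..N}"
      have "of_real (ln (real n) / real n) = (\<Sum>d | d dvd n. of_real (mangoldt d) / of_nat n :: complex)"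
        using n by (simp add: mangoldt_sum sum_divide_distrib[symmetric])
      also have "\<dots> = (\<Sum>d | d dvd n. of_real (mangoldt d / real d) / of_nat (n div d))"
      proof (intro sum.cong refl)
        fix d assume "d \<in> {d. d dvd n}"
        then obtain e where "n = d * e" by auto
        then show "of_real (mangoldt d) / of_nat n = (of_real (mangoldt d / real d) / of_nat (n div d) :: complex)"
          using n by simp
      qed
      finally show "\<chi> n * of_real (ln (real n) / real n) = \<chi> n * (\<Sum>d | d dvd n. of_real (mangoldt d / real d) / of_nat (n div d))"
        by simp
    qed
    also have "\<dots> = (\<Sum>d=1..N. \<Sum>e=1..N div d. \<chi> d * \<chi> e * (of_real (mangoldt d / real d) / of_nat e))"
      by (rule sum_divisors)
    also have "\<dots> = (\<Sum>d=1..N. \<chi> d * of_real (mangoldt d / real d) * (L1 + E d))"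
      unfolding E_def by (simp add: sum_distrib_left mult_ac)
    also have "\<dots> = L1 * mangoldt_sum_char N + (\<Sum>d=1..N. \<chi> d * of_real (mangoldt d / real d) * E d)"
      unfolding mangoldt_sum_char_def sum_distrib_left sum.distrib[symmetric]
      by (intro sum.cong refl) (simp only: ring_distribs mult_ac)
    finally have eq: "L1 * mangoldt_sum_char N = (\<Sum>n=1..N. \<chi> n * of_real (ln (real n) / real n))
        - (\<Sum>d=1..N. \<chi> d * of_real (mangoldt d / real d) * E d)" by simp
    have "norm (\<Sum>d=1..N. \<chi> d * of_real (mangoldt d / real d) * E d) \<le> (\<Sum>d=1..N. 2 * real m / real N * mangoldt d)"
    proof (intro order.trans[OF norm_sum] sum_mono)
      fix d assume d: "d \<in> {1..N}"
      have "norm (\<chi> d * of_real (mangoldt d / real d) * E d)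
          \<le> (1 * (mangoldt d / real d)) * (2 * real m * real d / real N)"
        unfolding norm_mult E_def using d norm_le_1[of d] norm_sum_quotient_minus_L1_le[OF assms(1), of d N]
        by (intro mult_mono) (auto simp: mangoldt_nonneg simp del: of_real_divide)
      also have "\<dots> = 2 * real m / real N * mangoldt d" using d by simp
      finally show "norm (\<chi> d * of_real (mangoldt d / real d) * E d) \<le> 2 * real m / real N * mangoldt d" .
    qed
    also have "\<dots> = 2 * real m / real N * (\<Sum>d=1..N. mangoldt d)" by (simp add: sum_distrib_left)
    also have "\<dots> \<le> 2 * real m / real N * (4 * real N)"
      by (intro mult_left_mono chebyshev_upper_bound) auto
    also have "\<dots> = 8 * real m" using N by simp
    finally have "norm (L1 * mangoldt_sum_char N) \<le> K + 8 * real m"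
      unfolding eq using log_sum[of N] by (intro norm_triangle_le_diff) auto
    then show ?thesis using assms(2) by (simp add: norm_mult field_simps)
  qed
  then show ?thesis by blast
qed

text \<open>If \<open>L(1, \<chi>)\<close> vanishes, the sum picks up a full \<open>- ln N\<close>; the weight \<open>ln (N / d)\<close> in the
  Moebius sum adds exactly the missing term \<open>ln N\<close> at \<open>n = 1\<close>.\<close>

lemma mangoldt_sum_char_vanishing:
  assumes "\<chi> \<noteq> principal_dcharacter m" "L1 = 0" and N: "N \<ge> 1"
  shows "norm (mangoldt_sum_char N + of_real (ln (real N))) \<le> 2 * real m"
proof -
  have "mangoldt_sum_char N + of_real (ln (real N))
      = (\<Sum>n=1..N. \<chi> n * of_real ((mangoldt n + (if n = 1 then ln (real N) else 0)) / real n))"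
  proof -
    have "(\<Sum>n=1..N. \<chi> n * of_real ((if n = 1 then ln (real N) else 0) / real n))
        = (\<Sum>n\<in>{1}. \<chi> n * of_real ((if n = 1 then ln (real N) else 0) / real n))"
      using N by (intro sum.mono_neutral_right) auto
    then show ?thesis
      by (simp add: mangoldt_sum_char_def add_divide_distrib distrib_left sum.distrib)
  qed
  also have "\<dots> = (\<Sum>n=1..N. \<chi> n * (\<Sum>d | d dvd n. of_real (moebius d * ln (real N / real d) / real d) / of_nat (n div d)))"
  proof (intro sum.cong refl)
    fix n assume n: "n \<in> {1..N}"
    have "of_real ((mangoldt n + (if n = 1 then ln (real N) else 0)) / real n)
        = (\<Sum>d | d dvd n. of_real (moebius d * ln (real N / real d)) / of_nat n :: complex)"
      using n N mangoldt_eq_moebius_sum[of n "real N"]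
      by (simp add: sum_divide_distrib[symmetric] del: of_real_add of_real_mult flip: of_real_sum)
    also have "\<dots> = (\<Sum>d | d dvd n. of_real (moebius d * ln (real N / real d) / real d) / of_nat (n div d))"
    proof (intro sum.cong refl)
      fix d assume "d \<in> {d. d dvd n}"
      then obtain e where "n = d * e" by auto
      then show "of_real (moebius d * ln (real N / real d)) / of_nat n
          = (of_real (moebius d * ln (real N / real d) / real d) / of_nat (n div d) :: complex)"
        using n by simp
    qed
    finally show "\<chi> n * of_real ((mangoldt n + (if n = 1 then ln (real N) else 0)) / real n)
        = \<chi> n * (\<Sum>d | d dvd n. of_real (moebius d * ln (real N / real d) / real d) / of_nat (n div d))"
      by simp
  qed
  also have "\<dots> = (\<Sum>d=1..N. \<Sum>e=1..N div d. \<chi> d * \<chi> e * (of_real (moebius d * ln (real N / real d) / real d) / of_nat e))"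
    by (rule sum_divisors)
  also have "\<dots> = (\<Sum>d=1..N. \<chi> d * of_real (moebius d * ln (real N / real d) / real d) * (\<Sum>e=1..N div d. \<chi> e / of_nat e))"
    unfolding sum_distrib_left by (intro sum.cong refl) (simp add: mult_ac)
  also have "norm \<dots> \<le> (\<Sum>d=1..N. 2 * real m / real N * ln (real N / real d))"
  proof (intro order.trans[OF norm_sum] sum_mono)
    fix d assume d: "d \<in> {1..N}"
    then have ln0: "0 \<le> ln (real N / real d)" by simp
    have "\<bar>moebius d * ln (real N / real d) / real d\<bar> \<le> ln (real N / real d) / real d"
      using abs_moebius_le_1[of d] ln0 by (simp add: abs_mult divide_right_mono mult_left_le_one_le)
    then have "norm (\<chi> d * of_real (moebius d * ln (real N / real d) / real d) * (\<Sum>e=1..N div d. \<chi> e / of_nat e))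
        \<le> (1 * (ln (real N / real d) / real d)) * (2 * real m * real d / real N)"
      unfolding norm_mult using d norm_le_1[of d] norm_sum_quotient_minus_L1_le[OF assms(1), of d N] ln0 assms(2)
      by (intro mult_mono) (auto simp del: of_real_divide)
    also have "\<dots> = 2 * real m / real N * ln (real N / real d)" using d by simp
    finally show "norm (\<chi> d * of_real (moebius d * ln (real N / real d) / real d) * (\<Sum>e=1..N div d. \<chi> e / of_nat e))
        \<le> 2 * real m / real N * ln (real N / real d)" .
  qed
  also have "\<dots> = 2 * real m / real N * (real N * ln (real N) - ln (fact N))"
  proof -
    have "(\<Sum>d=1..N. ln (real N / real d)) = (\<Sum>d=1..N. ln (real N) - ln (real d))"
      using N by (intro sum.cong) (auto simp: ln_div)
    also have "\<dots> = real N * ln (real N) - ln (fact N)" by (simp add: sum_subtractf ln_fact_eq_sum)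
    finally show ?thesis by (simp only: sum_distrib_left[symmetric])
  qed
  also have "\<dots> \<le> 2 * real m / real N * real N"
    using ln_fact_ge[of N] by (intro mult_left_mono) auto
  also have "\<dots> = 2 * real m" using N by simp
  finally show ?thesis .
qed

end

text \<open>Only powers of primes \<open>p\<close> dividing \<open>m\<close> contribute, and for
  each \<open>p\<close> the terms \<open>ln p / p ^ k\<close> are dominated by
  \<open>ln p * (1/2) ^ k\<close>.\<close>

lemma sum_mangoldt_noncoprime_le:
  assumes "m > 0"
  shows "(\<Sum>n\<in>{n\<in>{1..N}. \<not> coprime n m}. mangoldt n / real n) \<le> (\<Sum>p\<in>prime_factors m. ln (real p))"
proof -
  define A where "A = {n\<in>{1..N}. \<not> coprime n m \<and> primepow n}"
  define B where "B = prime_factors m \<times> {1..N}"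
  have "(\<Sum>n\<in>{n\<in>{1..N}. \<not> coprime n m}. mangoldt n / real n :: real) = (\<Sum>n\<in>A. mangoldt n / real n)"
    by (intro sum.mono_neutral_right) (auto simp: A_def mangoldt_def)
  also have "\<dots> \<le> (\<Sum>n\<in>(\<lambda>(p,k). p ^ k) ` B. mangoldt n / real n)"
  proof (rule sum_mono2)
    show "A \<subseteq> (\<lambda>(p,k). p ^ k) ` B"
    proof
      fix n assume n: "n \<in> A"
      then obtain p k where pk: "prime p" "k > 0" "n = p ^ k" by (auto simp: A_def primepow_def)
      have "p dvd m"
      proof (rule ccontr)
        assume "\<not> p dvd m"
        then have "coprime n m" using pk by (simp add: prime_imp_coprime)
        with n show False by (simp add: A_def)
      qed
      moreover have "k < p ^ k" using pk prime_gt_1_nat by (intro power_gt_expt) auto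
      then have "k \<le> N" using n pk by (auto simp: A_def)
      ultimately have "(p, k) \<in> B" using pk assms by (auto simp: B_def prime_factors_dvd)
      with pk show "n \<in> (\<lambda>(p,k). p ^ k) ` B" by (intro image_eqI[of _ _ "(p,k)"]) auto
    qed
  qed (auto simp: B_def mangoldt_nonneg)
  also have "\<dots> \<le> (\<Sum>(p,k)\<in>B. mangoldt (p ^ k) / real (p ^ k))"
    using sum_image_le[of B "\<lambda>n. mangoldt n / real n" "\<lambda>(p,k). p ^ k"]
    by (simp add: B_def mangoldt_nonneg o_def case_prod_beta)
  also have "\<dots> = (\<Sum>p\<in>prime_factors m. \<Sum>k=1..N. mangoldt (p ^ k) / real (p ^ k))"
    unfolding B_def by (rule sum.cartesian_product[symmetric])
  also have "\<dots> \<le> (\<Sum>p\<in>prime_factors m. ln (real p))"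
  proof (rule sum_mono)
    fix p assume "p \<in> prime_factors m"
    then have p: "prime p" "p \<ge> 2" using prime_ge_2_nat by auto
    have "(\<Sum>k=1..N. mangoldt (p ^ k) / real (p ^ k)) \<le> (\<Sum>k=1..N. ln (real p) * (1/2) ^ k)"
    proof (rule sum_mono)
      fix k assume k: "k \<in> {1..N}"
      have "(2::real) ^ k \<le> real p ^ k" using p by (intro power_mono) auto
      then have "1 / real p ^ k \<le> (1/2) ^ k" using p by (simp add: power_divide frac_le)
      then have "ln (real p) * (1 / real p ^ k) \<le> ln (real p) * (1/2) ^ k"
        using p by (intro mult_left_mono) auto
      then show "mangoldt (p ^ k) / real (p ^ k) \<le> ln (real p) * (1/2) ^ k" using p k by simp
    qed
    also have "\<dots> = ln (real p) * (\<Sum>k=1..N. (1/2) ^ k)" by (simp add: sum_distrib_left)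
    also have "(\<Sum>k=1..N. (1/2::real) ^ k) = 1 - (1/2) ^ N"
      by (induction N) (simp_all add: field_simps)
    also have "ln (real p) * (1 - (1/2) ^ N) \<le> ln (real p) * 1" using p by (intro mult_left_mono) auto
    finally show "(\<Sum>k=1..N. mangoldt (p ^ k) / real (p ^ k)) \<le> ln (real p)" by simp
  qed
  finally show ?thesis .
qed

lemma mangoldt_sum_principal:
  assumes "m > 0"
  shows "\<exists>C. \<forall>N\<ge>1. norm (dcharacter.mangoldt_sum_char (principal_dcharacter m) N - of_real (ln (real N))) \<le> C"
proof -
  interpret dcharacter m "principal_dcharacter m" by (rule dcharacter_principal[OF assms])
  define K where "K = (\<Sum>p\<in>prime_factors m. ln (real p))"
  have "norm (mangoldt_sum_char N - of_real (ln (real N))) \<le> 4 + K" if "N \<ge> 1" for N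
  proof -
    define S where "S = (\<Sum>n\<in>{n\<in>{1..N}. coprime n m}. mangoldt n / real n)"
    define T where "T = (\<Sum>n\<in>{n\<in>{1..N}. \<not> coprime n m}. mangoldt n / real n)"
    have "mangoldt_sum_char N = of_real S"
      unfolding mangoldt_sum_char_def S_def of_real_sum
      by (intro sum.mono_neutral_cong_right) (auto simp: principal_dcharacter_def)
    then have eq: "norm (mangoldt_sum_char N - of_real (ln (real N))) = \<bar>S - ln (real N)\<bar>"
      by (simp only: of_real_diff[symmetric] norm_of_real)
    have "(\<Sum>n=1..N. mangoldt n / real n) = S + T"
      unfolding S_def T_def by (subst sum.union_disjoint[symmetric]) (auto intro!: sum.cong)
    moreover have "0 \<le> T" unfolding T_def by (intro sum_nonneg) (auto simp: mangoldt_nonneg)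
    moreover have "T \<le> K" unfolding T_def K_def by (rule sum_mangoldt_noncoprime_le[OF assms])
    ultimately show ?thesis unfolding eq using mertens_mangoldt[OF that] by linarith
  qed
  then show ?thesis by blast
qed


section \<open>Non-vanishing for real characters\<close>

lemma sum_divisors_coprime_mult:
  fixes f :: "nat \<Rightarrow> 'a :: comm_monoid_add"
  assumes "coprime a b" "a > 0" "b > 0"
  shows "(\<Sum>d | d dvd a * b. f d) = (\<Sum>x | x dvd a. \<Sum>y | y dvd b. f (x * y))"
proof -
  have "(\<Sum>x | x dvd a. \<Sum>y | y dvd b. f (x * y)) = (\<Sum>(x,y)\<in>{x. x dvd a} \<times> {y. y dvd b}. f (x * y))"
    by (rule sum.cartesian_product)
  also have "\<dots> = (\<Sum>d | d dvd a * b. f d)"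
  proof (rule sum.reindex_bij_witness[of _ "\<lambda>d. (gcd d a, gcd d b)" "\<lambda>(x,y). x * y"], goal_cases)
    case (1 z)
    then obtain x y where z: "z = (x, y)" "x dvd a" "y dvd b" by auto
    have "coprime x b" using assms(1) z(2) by (metis coprime_divisors dvd_refl)
    have "coprime y a" using assms(1) z(3) by (metis coprime_divisors dvd_refl coprime_commute)
    have "gcd (x * y) a = gcd x a" using \<open>coprime y a\<close>
      by (simp add: gcd_mult_right_right_cancel gcd.commute coprime_commute)
    moreover have "gcd (x * y) b = gcd y b" using \<open>coprime x b\<close>
      by (simp add: gcd_mult_right_left_cancel gcd.commute coprime_commute)
    ultimately show ?case using z by (simp add: gcd_nat.absorb1)
  next
    case (3 d)
    then have "d dvd a * b" by simp
    then obtain x y where xy: "d = x * y" "x dvd a" "y dvd b" by (rule division_decomp[THEN exE]) blast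
    have "gcd d a * gcd d b = d"
    proof (rule dvd_antisym)
      have "coprime (gcd d a) (gcd d b)" using assms(1) by (rule coprime_divisors[rotated 2]) auto
      then show "gcd d a * gcd d b dvd d" by (intro divides_mult) auto
      show "d dvd gcd d a * gcd d b" using xy by (subst xy(1)) (intro mult_dvd_mono, auto)
    qed
    then show ?case by simp
  qed (auto intro: mult_dvd_mono)
  finally show ?thesis ..
qed

text \<open>Splits off the full power of one prime, leaving a smaller coprime cofactor: the
  induction step for multiplicative functions.\<close>

lemma obtain_prime_power:
  assumes "n > (1::nat)"
  obtains p k n' where "prime p" "n = p ^ k * n'" "\<not> p dvd n'" "n' > 0" "n' < n"
proof -
  obtain p where p: "prime p" "p dvd n" using assms prime_factor_nat[of n] by auto
  obtain n' where n': "n = p ^ multiplicity p n * n'" "\<not> p dvd n'"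
    using multiplicity_decompose'[of n p] assms p by (metis not_prime_unit not_one_less_zero)
  have "n' > 0" using n' assms by (auto intro!: Nat.gr0I)
  moreover have "n' < n"
  proof -
    have "n' \<noteq> n" using n' p by auto
    moreover have "n' dvd n" by (subst n'(1)) simp
    ultimately show ?thesis using assms dvd_imp_le[of n' n] by linarith
  qed
  ultimately show ?thesis using that p n' by blast
qed

context
  fixes r :: "nat \<Rightarrow> real"
  assumes r_mult: "\<And>a b. r (a * b) = r a * r b" and r_one: "r (Suc 0) = 1"
    and r_range: "\<And>a. r a \<in> {-1, 0, 1}"
begin

lemma r_power: "r (p ^ k) = r p ^ k"
  by (induction k) (simp_all add: r_mult r_one)

lemma divisor_sum_prime_power:
  assumes "prime p"
  shows "(\<Sum>d | d dvd p ^ k. r d) = (\<Sum>i\<le>k. r p ^ i)"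
proof -
  have "{d. d dvd p ^ k} = (\<lambda>i. p ^ i) ` {..k}"
    using assms by (auto simp: divides_primepow_nat le_imp_power_dvd)
  moreover have "inj_on (\<lambda>i. p ^ i) {..k}"
    using assms prime_gt_1_nat by (auto simp: inj_on_def)
  ultimately show ?thesis by (simp add: sum.reindex r_power)
qed

text \<open>The divisor sum is a geometric sum with ratio 0, 1 or -1, so it is 1,
  \<open>k + 1\<close> or the indicator of even \<open>k\<close>.\<close>

lemma divisor_sum_prime_power_nonneg:
  assumes "prime p"
  shows "(\<Sum>d | d dvd p ^ k. r d) \<ge> 0" and "even k \<Longrightarrow> (\<Sum>d | d dvd p ^ k. r d) \<ge> 1"
proof -
  have "(\<Sum>i\<le>k. r p ^ i) \<ge> (if even k then 1 else 0)"
  proof -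
    consider "r p = 0" | "r p = 1" | "r p = -1" using r_range[of p] by auto
    then show ?thesis
    proof cases
      case 1
      have "(\<Sum>i\<le>k. r p ^ i) = 1" unfolding 1 by (induction k) auto
      then show ?thesis by simp
    next
      case 3
      have "(\<Sum>i\<le>k. (-1::real) ^ i) = (if even k then 1 else 0)" by (induction k) auto
      then show ?thesis by (simp add: 3)
    qed auto
  qed
  then show "(\<Sum>d | d dvd p ^ k. r d) \<ge> 0" and "even k \<Longrightarrow> (\<Sum>d | d dvd p ^ k. r d) \<ge> 1"
    using divisor_sum_prime_power[OF assms] by (simp_all split: if_splits)
qed

lemma divisor_sum_split:
  assumes "prime p" "\<not> p dvd n" "n > 0"
  shows "(\<Sum>d | d dvd p ^ k * n. r d) = (\<Sum>d | d dvd p ^ k. r d) * (\<Sum>d | d dvd n. r d)"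
proof -
  have "coprime (p ^ k) n" using assms by (simp add: prime_imp_coprime)
  moreover have "p ^ k > 0" using assms prime_gt_0_nat by simp
  ultimately show ?thesis
    using assms(3) by (simp add: sum_divisors_coprime_mult r_mult sum_product)
qed

lemma divisor_sum_nonneg:
  assumes "n > 0"
  shows "(\<Sum>d | d dvd n. r d) \<ge> 0"
  using assms
proof (induction n rule: less_induct)
  case (less n)
  show ?case
  proof (cases "n = 1")
    case False
    then have "n > 1" using less by simp
    then obtain p k n' where n: "prime p" "n = p ^ k * n'" "\<not> p dvd n'" "n' > 0" "n' < n"
      by (rule obtain_prime_power)
    show ?thesis
      using divisor_sum_split[OF n(1,3,4), of k] divisor_sum_prime_power_nonneg(1)[OF n(1), of k]
        less.IH[OF n(5,4)] n(2) by simp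
  qed (simp add: r_one)
qed

lemma divisor_sum_square_ge_1:
  assumes "n > 0"
  shows "(\<Sum>d | d dvd n\<^sup>2. r d) \<ge> 1"
  using assms
proof (induction n rule: less_induct)
  case (less n)
  show ?case
  proof (cases "n = 1")
    case False
    then have "n > 1" using less by simp
    then obtain p k n' where n: "prime p" "n = p ^ k * n'" "\<not> p dvd n'" "n' > 0" "n' < n"
      by (rule obtain_prime_power)
    have n2: "n\<^sup>2 = p ^ (2 * k) * n'\<^sup>2" by (simp add: n(2) power_mult_distrib power_mult[symmetric] mult.commute)
    have "\<not> p dvd n'\<^sup>2" "n'\<^sup>2 > 0" using n by (auto dest: prime_dvd_power)
    from divisor_sum_split[OF n(1) this, of "2 * k"]
    have "(\<Sum>d | d dvd n\<^sup>2. r d) = (\<Sum>d | d dvd p ^ (2 * k). r d) * (\<Sum>d | d dvd n'\<^sup>2. r d)"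
      by (simp add: n2)
    moreover have "1 * 1 \<le> (\<Sum>d | d dvd p ^ (2 * k). r d) * (\<Sum>d | d dvd n'\<^sup>2. r d)"
      using divisor_sum_prime_power_nonneg(2)[OF n(1), of "2 * k"] less.IH[OF n(5,4)]
      by (intro mult_mono) auto
    ultimately show ?thesis by simp
  qed (simp add: r_one)
qed

end

text \<open>The partial sums of \<open>1 / sqrt n\<close> deviate from \<open>2 sqrt N\<close> by a constant up to
  \<open>O(1 / sqrt N)\<close>; the constant is the infimum of a decreasing sequence.\<close>

lemma sum_inverse_sqrt_asymp:
  obtains c where "\<And>N. N \<ge> 1 \<Longrightarrow> \<bar>(\<Sum>n=1..N. 1 / sqrt (real n)) - 2 * sqrt (real N) - c\<bar> \<le> 1 / sqrt (real N)"
proof -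
  define u where "u = (\<lambda>N. (\<Sum>n=1..N. 1 / sqrt (real n)) - 2 * sqrt (real N))"
  \<comment> \<open>\<open>u\<close> decreases and \<open>v\<close> increases, so every value of
    \<open>v\<close> lies below every value of \<open>u\<close>; the infimum \<open>c\<close> of
    \<open>u\<close> is thus enclosed by \<open>v N\<close> and \<open>u N\<close>, which differ by
    \<open>1 / sqrt N\<close>.\<close>
  define v where "v = (\<lambda>N. u N - 1 / sqrt (real N))"
  have ustep: "u (Suc N) \<le> u N" and vstep: "v N \<le> v (Suc N)" if "N \<ge> 1" for N
  proof -
    define s where "s = sqrt (real N)"
    define t where "t = sqrt (real (Suc N))"
    have st: "0 < s" "s \<le> t" "t\<^sup>2 = s\<^sup>2 + 1" using that by (auto simp: s_def t_def)
    have "(t - s) * (t + s) = 1" using st(3) by (simp add: algebra_simps power2_eq_square)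
    then have ts: "t - s = 1 / (t + s)" using st by (simp add: field_simps)
    have us: "u (Suc N) - u N = 1 / t - 2 / (t + s)"
    proof -
      have "u (Suc N) - u N = 1 / t - 2 * (t - s)"
        by (simp add: u_def s_def t_def algebra_simps)
      then show ?thesis by (simp add: ts)
    qed
    have "1 / t \<le> 2 / (t + s)" using st by (simp add: field_simps)
    with us show "u (Suc N) \<le> u N" by simp
    have "2 / (t + s) \<le> 1 / s" using st by (simp add: field_simps)
    moreover have "v (Suc N) - v N = u (Suc N) - u N - 1 / t + 1 / s" by (simp add: v_def s_def t_def)
    ultimately show "v N \<le> v (Suc N)" using us by linarith
  qed
  have umono: "u b \<le> u a" if "a \<le> b" "1 \<le> a" for a b
    using that
  proof (induction b rule: dec_induct)
    case (step n)
    then show ?case using ustep[of n] by simp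
  qed simp
  have vmono: "v a \<le> v b" if "a \<le> b" "1 \<le> a" for a b
    using that
  proof (induction b rule: dec_induct)
    case (step n)
    then show ?case using vstep[of n] by simp
  qed simp
  have vu: "v a \<le> u b" if "1 \<le> a" "1 \<le> b" for a b
  proof -
    have "v a \<le> v (max a b)" using that by (intro vmono) auto
    also have "\<dots> \<le> u (max a b)" by (simp add: v_def)
    also have "\<dots> \<le> u b" using that by (intro umono) auto
    finally show ?thesis .
  qed
  define c where "c = (INF N\<in>{1..}. u N)"
  have bdd: "bdd_below (u ` {1..})" using vu[of 1] by (intro bdd_belowI2[of _ "v 1"]) auto
  have "\<bar>u N - c\<bar> \<le> 1 / sqrt (real N)" if "N \<ge> 1" for N
  proof -
    have "c \<le> u N" unfolding c_def using that by (intro cINF_lower bdd) auto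
    moreover have "v N \<le> c" unfolding c_def using that vu by (intro cINF_greatest) auto
    ultimately show ?thesis by (simp add: v_def)
  qed
  then show ?thesis using that[of c] by (simp add: u_def)
qed

lemma sum_inverse_sqrt_le: "(\<Sum>n=1..N. 1 / sqrt (real n)) \<le> 2 * sqrt (real N)"
proof (induction N)
  case (Suc N)
  define s where "s = sqrt (real N)"
  define t where "t = sqrt (real (Suc N))"
  have st: "0 \<le> s" "s \<le> t" "0 < t" "t\<^sup>2 = s\<^sup>2 + 1" by (auto simp: s_def t_def)
  have "(t - s) * (t + s) = 1" using st(4) by (simp add: algebra_simps power2_eq_square)
  then have "t - s = 1 / (t + s)" using st by (simp add: field_simps)
  moreover have "1 / (2 * t) \<le> 1 / (t + s)" using st by (intro divide_left_mono) auto
  ultimately have "1 / t \<le> 2 * (t - s)" using st by simp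
  then show ?case using Suc by (simp add: s_def t_def)
qed simp

context dcharacter
begin

lemma norm_sum_inverse_sqrt_le:
  assumes "\<chi> \<noteq> principal_dcharacter m" "a \<ge> 1"
  shows "norm (\<Sum>n\<in>{a..<b}. \<chi> n * of_real (1 / sqrt (real n))) \<le> 2 * real m / sqrt (real a)"
  using norm_sum_decreasing_le[OF assms(1), of a "\<lambda>n. 1 / sqrt (real n)" b] assms(2)
  by (simp add: frac_le)

text \<open>Dirichlet's hyperbola method at \<open>N = K\<^sup>2\<close>: the divisor sums of a real character are
  non-negative and at least 1 at squares, which is incompatible with \<open>L(1, \<chi>) = 0\<close>.\<close>

lemma L1_nonzero_real:
  assumes np: "\<chi> \<noteq> principal_dcharacter m" and real: "\<And>n. cnj (\<chi> n) = \<chi> n"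
  shows "L1 \<noteq> 0"
proof
  assume L0: "L1 = 0"
  define r where "r = (\<lambda>n. Re (\<chi> n))"
  have \<chi>r: "\<chi> n = of_real (r n)" for n
    using real[of n] by (simp add: r_def complex_eq_iff)
  have r_mult: "r (a * b) = r a * r b" for a b
    using mult[of a b] unfolding \<chi>r by (simp only: of_real_mult[symmetric] of_real_eq_iff)
  have r_one: "r (Suc 0) = 1" by (simp add: r_def)
  have abs_r: "\<bar>r n\<bar> \<le> 1" for n using norm_le_1[of n] unfolding \<chi>r by simp
  have r_range: "r n \<in> {-1, 0, 1}" for n
    using nonzero_iff[of n] norm_eq_1[of n] unfolding \<chi>r by (cases "coprime n m") auto
  note dsn = divisor_sum_nonneg[of r, OF r_mult r_one r_range]
  note dss = divisor_sum_square_ge_1[of r, OF r_mult r_one r_range]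
  define F where "F = (\<lambda>n. \<Sum>d | d dvd n. r d)"
  obtain c where c: "\<And>N. N \<ge> 1 \<Longrightarrow> \<bar>(\<Sum>n=1..N. 1 / sqrt (real n)) - 2 * sqrt (real N) - c\<bar> \<le> 1 / sqrt (real N)"
    using sum_inverse_sqrt_asymp by blast
  have sqrt_sum: "\<bar>\<Sum>n\<in>{a..<b}. r n * (1 / sqrt (real n))\<bar> \<le> 2 * real m / sqrt (real a)" if "a \<ge> 1" for a b
  proof -
    have "(\<Sum>n\<in>{a..<b}. \<chi> n * of_real (1 / sqrt (real n))) = of_real (\<Sum>n\<in>{a..<b}. r n * (1 / sqrt (real n)))"
      by (simp add: \<chi>r)
    with norm_sum_inverse_sqrt_le[OF np that, of b] show ?thesis by (simp only: norm_of_real)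
  qed
  \<comment> \<open>This is where the assumption \<open>L1 = 0\<close> enters: the partial sums
    themselves, not only their distance from the limit, are of size \<open>1 / K\<close>.\<close>
  have inv_sum: "\<bar>\<Sum>n=1..K. r n / real n\<bar> \<le> 2 * real m / real K" if "K \<ge> 1" for K
  proof -
    have "(\<Sum>n=1..K. \<chi> n / of_nat n) = of_real (\<Sum>n=1..K. r n / real n)" by (simp add: \<chi>r)
    then have "\<bar>\<Sum>n=1..K. r n / real n\<bar> \<le> 2 * real m / real (Suc K)"
      using norm_sum_minus_L1_le[OF np, of K] L0 by (simp only: norm_of_real diff_zero)
    also have "\<dots> \<le> 2 * real m / real K" using that by (intro divide_left_mono) auto
    finally show ?thesis .
  qed
  define C where "C = 4 * real m + \<bar>c\<bar> * (2 * real m) + 6 + 4 * real m"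
  have upper: "(\<Sum>n=1..K\<^sup>2. F n / sqrt (real n)) \<le> C" if K: "K \<ge> 1" for K
  proof -
    define g where "g = (\<lambda>d. \<Sum>e=1..K\<^sup>2 div d. 1 / sqrt (real e))"
    have "(\<Sum>n=1..K\<^sup>2. F n / sqrt (real n))
        = (\<Sum>n=1..K\<^sup>2. \<Sum>d | d dvd n. r d * (1 / sqrt (real d)) * (1 / sqrt (real (n div d))))"
    proof (intro sum.cong refl)
      fix n assume "n \<in> {1..K\<^sup>2}"
      show "F n / sqrt (real n) = (\<Sum>d | d dvd n. r d * (1 / sqrt (real d)) * (1 / sqrt (real (n div d))))"
        unfolding F_def sum_divide_distrib
      proof (intro sum.cong refl)
        fix d assume "d \<in> {d. d dvd n}"
        then obtain e where "n = d * e" by auto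
        moreover from this \<open>n \<in> {1..K\<^sup>2}\<close> have "d > 0" by (auto intro!: Nat.gr0I)
        ultimately show "r d / sqrt (real n) = r d * (1 / sqrt (real d)) * (1 / sqrt (real (n div d)))"
          by (simp add: real_sqrt_mult)
      qed
    qed
    also have "\<dots> = (\<Sum>d=1..K\<^sup>2. \<Sum>e=1..K\<^sup>2 div d. r d * (1 / sqrt (real d)) * (1 / sqrt (real e)))"
      by (rule sum_divisors_swap)
    also have "\<dots> = (\<Sum>d=1..K\<^sup>2. r d * (1 / sqrt (real d)) * g d)"
      by (simp add: g_def sum_distrib_left)
    also have "\<dots> = (\<Sum>d=1..K. r d * (1 / sqrt (real d)) * g d) + (\<Sum>d\<in>{K<..K\<^sup>2}. r d * (1 / sqrt (real d)) * g d)"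
    proof -
      have "{1..K\<^sup>2} = {1..K} \<union> {K<..K\<^sup>2}" using K by (auto simp: power2_eq_square intro: order.trans[OF _ le_square])
      then show ?thesis by (simp add: sum.union_disjoint ivl_disj_int)
    qed
    finally have split: "(\<Sum>n=1..K\<^sup>2. F n / sqrt (real n)) = \<dots>" .
    \<comment> \<open>For small \<open>d\<close> the inner sum is
      \<open>g d = 2 * K / sqrt d + c + E d\<close>. The main term would be of order
      \<open>K\<close>, but it carries the sum of \<open>r d / d\<close>, which is of size
      \<open>1 / K\<close>; the errors \<open>E d\<close> contribute at most \<open>6 / K\<close>
      for each \<open>d\<close>.\<close>
    have P1: "(\<Sum>d=1..K. r d * (1 / sqrt (real d)) * g d) \<le> 4 * real m + \<bar>c\<bar> * (2 * real m) + 6"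
    proof -
      define E where "E = (\<lambda>d. g d - 2 * (real K / sqrt (real d)) - c)"
      have E: "\<bar>E d\<bar> \<le> 6 * sqrt (real d) / real K" if d: "1 \<le> d" "d \<le> K" for d
      proof -
        define M where "M = K\<^sup>2 div d"
        define x where "x = real K ^ 2 / real d"
        have "d \<le> K\<^sup>2" using d K by (auto simp: power2_eq_square intro: order.trans[OF _ le_square])
        then have M1: "M \<ge> 1" using d by (simp add: M_def Suc_le_eq div_greater_zero_iff)
        have "real (K\<^sup>2) = real d * real M + real (K\<^sup>2 mod d)"
          unfolding M_def by (simp only: of_nat_mult[symmetric] of_nat_add[symmetric]) simp
        moreover have "real (K\<^sup>2 mod d) \<le> real d" using d by (simp add: less_imp_le)
        ultimately have Mx: "real M \<le> x" "x \<le> real M + 1"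
          using d by (simp_all add: x_def field_simps)
        have sx: "sqrt x = real K / sqrt (real d)" by (simp add: x_def real_sqrt_divide)
        define s where "s = sqrt (real M)"
        have s1: "s \<ge> 1" using M1 by (simp add: s_def)
        have s_le: "s \<le> sqrt x" using Mx by (simp add: s_def)
        have x0: "0 \<le> x" by (simp add: x_def)
        have "(sqrt x - s) * s \<le> (sqrt x - s) * (sqrt x + s)" using s_le s1 x0 by (intro mult_left_mono) auto
        also have "\<dots> = x - real M" using x0 by (simp add: s_def algebra_simps)
        also have "\<dots> \<le> 1" using Mx by simp
        finally have "sqrt x - s \<le> 1 / s" using s1 by (simp add: field_simps)
        moreover have "\<bar>g d - 2 * s - c\<bar> \<le> 1 / s" using c[OF M1] by (simp add: g_def M_def s_def)
        ultimately have "\<bar>E d\<bar> \<le> 3 * (1 / s)" using s_le unfolding E_def sx[symmetric] by linarith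
        also have "1 / s \<le> 2 * sqrt (real d) / real K"
        proof -
          have "x \<le> 4 * real M" using Mx M1 by simp
          then have "sqrt x \<le> sqrt (4 * real M)" by simp
          also have "\<dots> = 2 * s" by (simp add: s_def real_sqrt_mult)
          finally have "real K \<le> 2 * s * sqrt (real d)" using d by (simp add: sx field_simps)
          then show ?thesis using s1 K by (simp add: field_simps)
        qed
        finally show ?thesis by simp
      qed
      have "(\<Sum>d=1..K. r d * (1 / sqrt (real d)) * g d)
          = (\<Sum>d=1..K. 2 * real K * (r d / real d) + c * (r d * (1 / sqrt (real d))) + r d * (1 / sqrt (real d)) * E d)"
      proof (intro sum.cong refl)
        fix d assume "d \<in> {1..K}"
        then have "1 / sqrt (real d) * (1 / sqrt (real d)) = 1 / real d" by simp
        then show "r d * (1 / sqrt (real d)) * g d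
          = 2 * real K * (r d / real d) + c * (r d * (1 / sqrt (real d))) + r d * (1 / sqrt (real d)) * E d"
          unfolding E_def by (simp add: algebra_simps)
      qed
      also have "\<dots> = 2 * real K * (\<Sum>d=1..K. r d / real d) + c * (\<Sum>d=1..K. r d * (1 / sqrt (real d)))
          + (\<Sum>d=1..K. r d * (1 / sqrt (real d)) * E d)"
        by (simp add: sum.distrib sum_distrib_left)
      also have "\<dots> \<le> 4 * real m + \<bar>c\<bar> * (2 * real m) + 6"
      proof (intro add_mono)
        have "2 * real K * (\<Sum>d=1..K. r d / real d) \<le> 2 * real K * (2 * real m / real K)"
          using inv_sum[OF K] by (intro mult_left_mono) auto
        then show "2 * real K * (\<Sum>d=1..K. r d / real d) \<le> 4 * real m" using K by simp
        have "c * (\<Sum>d=1..K. r d * (1 / sqrt (real d))) \<le> \<bar>c\<bar> * \<bar>\<Sum>d=1..K. r d * (1 / sqrt (real d))\<bar>"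
          by (metis abs_ge_self abs_mult)
        also have "\<dots> \<le> \<bar>c\<bar> * (2 * real m)"
          using sqrt_sum[of 1 "Suc K"] by (intro mult_left_mono) (auto simp: atLeastLessThanSuc_atLeastAtMost)
        finally show "c * (\<Sum>d=1..K. r d * (1 / sqrt (real d))) \<le> \<bar>c\<bar> * (2 * real m)" .
        have "(\<Sum>d=1..K. r d * (1 / sqrt (real d)) * E d) \<le> (\<Sum>d=1..K. 6 / real K)"
        proof (rule sum_mono)
          fix d assume d: "d \<in> {1..K}"
          have "r d * (1 / sqrt (real d)) * E d \<le> \<bar>r d * (1 / sqrt (real d)) * E d\<bar>" by (rule abs_ge_self)
          also have "\<dots> \<le> 1 * (1 / sqrt (real d)) * (6 * sqrt (real d) / real K)"
            unfolding abs_mult using d abs_r[of d] E[of d] by (intro mult_mono) auto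
          also have "\<dots> = 6 / real K" using d by simp
          finally show "r d * (1 / sqrt (real d)) * E d \<le> 6 / real K" .
        qed
        then show "(\<Sum>d=1..K. r d * (1 / sqrt (real d)) * E d) \<le> 6" using K by simp
      qed
      finally show ?thesis .
    qed
    \<comment> \<open>For \<open>d > K\<close> the cofactor \<open>e\<close> is at most
      \<open>K\<close>. With the order of summation exchanged, the inner sum over \<open>d\<close>
      is a tail of the series of \<open>r d / sqrt d\<close>, of size
      \<open>1 / sqrt K\<close>.\<close>
    have P2: "(\<Sum>d\<in>{K<..K\<^sup>2}. r d * (1 / sqrt (real d)) * g d) \<le> 4 * real m"
    proof -
      have "(\<Sum>d\<in>{K<..K\<^sup>2}. r d * (1 / sqrt (real d)) * g d)
          = (\<Sum>(d,e)\<in>(SIGMA d:{K<..K\<^sup>2}. {1..K\<^sup>2 div d}). r d * (1 / sqrt (real d)) * (1 / sqrt (real e)))"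
        unfolding g_def sum_distrib_left by (rule sum.Sigma) auto
      also have "\<dots> = (\<Sum>(e,d)\<in>(SIGMA e:{1..K}. {Suc K..<Suc (K\<^sup>2 div e)}). r d * (1 / sqrt (real d)) * (1 / sqrt (real e)))"
      proof (rule sum.reindex_bij_witness[of _ "\<lambda>(e,d). (d,e)" "\<lambda>(d,e). (e,d)"], goal_cases)
        case (2 z)
        then obtain d e where z: "z = (d, e)" "K < d" "d \<le> K\<^sup>2" "1 \<le> e" "e \<le> K\<^sup>2 div d" by auto
        then have "e * d \<le> K\<^sup>2" by (simp add: less_eq_div_iff_mult_less_eq)
        moreover have "e * K \<le> e * d" using z by (intro mult_le_mono2) simp
        ultimately have "e * K \<le> K * K" unfolding power2_eq_square by (rule order.trans[rotated])
        then have "e \<le> K" using K by simp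
        with z \<open>e * d \<le> K\<^sup>2\<close> show ?case by (simp add: less_Suc_eq_le less_eq_div_iff_mult_less_eq mult.commute)
      next
        case (4 z)
        then obtain d e where z: "z = (e, d)" "1 \<le> e" "e \<le> K" "Suc K \<le> d" "d < Suc (K\<^sup>2 div e)" by auto
        then have "d * e \<le> K\<^sup>2" by (simp add: less_Suc_eq_le less_eq_div_iff_mult_less_eq)
        moreover have "d \<le> d * e" using z by simp
        ultimately have "d \<le> K\<^sup>2" by linarith
        with z \<open>d * e \<le> K\<^sup>2\<close> show ?case by (simp add: less_eq_div_iff_mult_less_eq mult.commute)
      qed auto
      also have "\<dots> = (\<Sum>e=1..K. \<Sum>d\<in>{Suc K..<Suc (K\<^sup>2 div e)}. r d * (1 / sqrt (real d)) * (1 / sqrt (real e)))"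
        by (rule sum.Sigma[symmetric]) auto
      also have "\<dots> = (\<Sum>e=1..K. (1 / sqrt (real e)) * (\<Sum>d\<in>{Suc K..<Suc (K\<^sup>2 div e)}. r d * (1 / sqrt (real d))))"
        by (simp only: sum_distrib_left mult.commute)
      also have "\<dots> \<le> (\<Sum>e=1..K. (1 / sqrt (real e)) * (2 * real m / sqrt (real K)))"
      proof (intro sum_mono mult_left_mono)
        fix e
        have "\<bar>\<Sum>d\<in>{Suc K..<Suc (K\<^sup>2 div e)}. r d * (1 / sqrt (real d))\<bar> \<le> 2 * real m / sqrt (real (Suc K))"
          by (rule sqrt_sum) simp
        also have "\<dots> \<le> 2 * real m / sqrt (real K)" using K by (intro divide_left_mono) auto
        finally show "(\<Sum>d\<in>{Suc K..<Suc (K\<^sup>2 div e)}. r d * (1 / sqrt (real d))) \<le> 2 * real m / sqrt (real K)"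
          by linarith
      qed simp
      also have "\<dots> = (\<Sum>e=1..K. 1 / sqrt (real e)) * (2 * real m / sqrt (real K))"
        by (simp only: sum_distrib_right)
      also have "\<dots> \<le> 2 * sqrt (real K) * (2 * real m / sqrt (real K))"
        by (intro mult_right_mono sum_inverse_sqrt_le) simp
      also have "\<dots> = 4 * real m" using K by simp
      finally show ?thesis .
    qed
    show ?thesis unfolding split C_def using P1 P2 by (intro add_mono)
  qed
  \<comment> \<open>Keeping only the squares \<open>n = j^2\<close>, where
    \<open>F n \<ge> 1\<close>, leaves the harmonic sum, which is unbounded.\<close>
  have lower: "ln (real (Suc K)) \<le> (\<Sum>n=1..K\<^sup>2. F n / sqrt (real n))" for K
  proof -
    have "ln (real (Suc K)) \<le> (\<Sum>j=1..K. 1 / real j)" by (rule ln_le_harmonic_sum)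
    also have "\<dots> \<le> (\<Sum>j=1..K. F (j\<^sup>2) / sqrt (real (j\<^sup>2)))"
      using dss by (intro sum_mono) (auto simp: F_def divide_right_mono)
    also have "\<dots> = (\<Sum>n\<in>(\<lambda>j. j\<^sup>2) ` {1..K}. F n / sqrt (real n))"
      by (subst sum.reindex) (auto simp: inj_on_def)
    also have "\<dots> \<le> (\<Sum>n=1..K\<^sup>2. F n / sqrt (real n))"
      using dsn by (intro sum_mono2) (auto simp: F_def Suc_le_eq power_mono)
    finally show ?thesis .
  qed
  obtain K where K: "exp C < real K" using reals_Archimedean2 by blast
  then have "K \<ge> 1" using exp_gt_zero[of C] by (cases K) auto
  have "C < ln (real K)" using K by (metis exp_gt_zero exp_less_cancel_iff exp_ln less_trans)
  also have "\<dots> \<le> ln (real (Suc K))" using \<open>K \<ge> 1\<close> by simp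
  also have "\<dots> \<le> C" using lower[of K] upper[OF \<open>K \<ge> 1\<close>] by linarith
  finally show False by simp
qed

end


section \<open>Primes in arithmetic progressions\<close>

lemma sum_mangoldt_congruent:
  assumes "squarefree m" "m > 0" "coprime b m"
  shows "(\<Sum>\<chi> | dcharacter m \<chi>. cnj (\<chi> b) * dcharacter.mangoldt_sum_char \<chi> N)
           = of_real (real (card {\<chi>. dcharacter m \<chi>}) * (\<Sum>n | n \<in> {1..N} \<and> [n = b] (mod m). mangoldt n / real n))"
proof -
  define X where "X = {\<chi>. dcharacter m \<chi>}"
  have "(\<Sum>\<chi>\<in>X. cnj (\<chi> b) * dcharacter.mangoldt_sum_char \<chi> N)
      = (\<Sum>\<chi>\<in>X. \<Sum>n=1..N. \<chi> n * cnj (\<chi> b) * of_real (mangoldt n / real n))"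
  proof (intro sum.cong refl)
    fix \<chi> assume "\<chi> \<in> X"
    then interpret dcharacter m \<chi> by (simp add: X_def)
    show "cnj (\<chi> b) * mangoldt_sum_char N = (\<Sum>n=1..N. \<chi> n * cnj (\<chi> b) * of_real (mangoldt n / real n))"
      unfolding mangoldt_sum_char_def sum_distrib_left by (intro sum.cong refl) (simp only: mult_ac)
  qed
  also have "\<dots> = (\<Sum>n=1..N. (\<Sum>\<chi>\<in>X. \<chi> n * cnj (\<chi> b)) * of_real (mangoldt n / real n))"
    by (subst sum.swap) (simp only: sum_distrib_right)
  also have "\<dots> = (\<Sum>n=1..N. if [n = b] (mod m) then of_real (real (card X) * (mangoldt n / real n)) else 0)"
    unfolding X_def by (intro sum.cong refl) (simp add: sum_dcharacters[OF assms])
  also have "\<dots> = (\<Sum>n | n \<in> {1..N} \<and> [n = b] (mod m). of_real (real (card X) * (mangoldt n / real n)))"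
    by (simp only: sum.inter_filter[symmetric] finite_atLeastAtMost)
  also have "\<dots> = of_real (real (card X) * (\<Sum>n | n \<in> {1..N} \<and> [n = b] (mod m). mangoldt n / real n))"
    by (simp only: of_real_sum[symmetric] sum_distrib_left[symmetric])
  finally show ?thesis by (simp add: X_def)
qed

text \<open>Puts the three cases in one form, so that the coefficients of \<open>ln N\<close> can be
  added up over all characters.\<close>

lemma mangoldt_sum_char_asymp:
  assumes "dcharacter m \<chi>"
  shows "\<exists>C. \<forall>N\<ge>1. norm (dcharacter.mangoldt_sum_char \<chi> N - of_real ((if \<chi> = principal_dcharacter m then 1
           else if dcharacter.L1 \<chi> = 0 then -1 else 0) * ln (real N))) \<le> C"
proof -
  interpret dcharacter m \<chi> by fact
  consider "\<chi> = principal_dcharacter m" | "\<chi> \<noteq> principal_dcharacter m" "L1 = 0"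
    | "\<chi> \<noteq> principal_dcharacter m" "L1 \<noteq> 0" by blast
  then show ?thesis
  proof cases
    case 1
    then show ?thesis using mangoldt_sum_principal[OF modulus_pos] by simp
  next
    case 2
    then show ?thesis using mangoldt_sum_char_vanishing by auto
  next
    case 3
    then show ?thesis using mangoldt_sum_char_bounded by simp
  qed
qed

text \<open>Summing over all characters gives a non-negative quantity, so at most one of the \<open>L(1, \<chi>)\<close>
  can vanish; a vanishing complex character would come with its conjugate.\<close>

lemma L1_nonzero:
  assumes "squarefree m" "dcharacter m \<chi>" "\<chi> \<noteq> principal_dcharacter m"
  shows "dcharacter.L1 \<chi> \<noteq> 0"
proof
  assume L0: "dcharacter.L1 \<chi> = 0"
  interpret dcharacter m \<chi> by fact
  define X where "X = {\<chi>. dcharacter m \<chi>}"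
  define P where "P = principal_dcharacter m"
  define \<epsilon> :: "(nat \<Rightarrow> complex) \<Rightarrow> real"
    where "\<epsilon> = (\<lambda>\<chi>. if \<chi> = P then 1 else if dcharacter.L1 \<chi> = 0 then -1 else 0)"
  have finX: "finite X" unfolding X_def by (rule finite_dcharacters)
  have PX: "P \<in> X" by (simp add: X_def P_def dcharacter_principal modulus_pos)
  define \<psi> where "\<psi> = (\<lambda>a. cnj (\<chi> a))"
  have \<psi>: "dcharacter m \<psi>" unfolding \<psi>_def by (rule dcharacter_cnj) fact
  have \<psi>P: "\<psi> \<noteq> P"
  proof
    assume "\<psi> = P"
    then have "cnj (\<psi> a) = P a" for a by (simp add: P_def principal_dcharacter_def)
    then have "\<chi> = P" by (simp add: \<psi>_def fun_eq_iff)
    with assms(3) show False by (simp add: P_def)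
  qed
  have \<psi>\<chi>: "\<psi> \<noteq> \<chi>"
    using L1_nonzero_real[OF assms(3)] L0 by (auto simp: \<psi>_def fun_eq_iff)
  have L0': "dcharacter.L1 \<psi> = 0"
  proof -
    have bound: "norm (dcharacter.L1 \<psi>) \<le> 4 * real m / real (Suc N)" for N
    proof -
      define s where "s = (\<Sum>n=1..N. \<chi> n / of_nat n)"
      have "norm s \<le> 2 * real m / real (Suc N)"
        using norm_sum_minus_L1_le[OF assms(3), of N] L0 by (simp add: s_def)
      then have "norm (cnj s) \<le> 2 * real m / real (Suc N)" by (simp only: complex_mod_cnj)
      moreover have "norm (cnj s - dcharacter.L1 \<psi>) \<le> 2 * real m / real (Suc N)"
        using dcharacter.norm_sum_minus_L1_le[OF \<psi> \<psi>P[unfolded P_def], of N] by (simp add: s_def \<psi>_def)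
      moreover have "norm (dcharacter.L1 \<psi>) \<le> norm (cnj s) + norm (cnj s - dcharacter.L1 \<psi>)"
        using norm_triangle_ineq4[of "cnj s" "cnj s - dcharacter.L1 \<psi>"] by simp
      ultimately have "norm (dcharacter.L1 \<psi>) \<le> 2 * real m / real (Suc N) + 2 * real m / real (Suc N)"
        by linarith
      also have "\<dots> = 4 * real m / real (Suc N)" by (simp only: add_divide_distrib[symmetric]) simp
      finally show ?thesis .
    qed
    show ?thesis
    proof (rule ccontr)
      assume nz: "dcharacter.L1 \<psi> \<noteq> 0"
      obtain N where "4 * real m / norm (dcharacter.L1 \<psi>) < real N" using reals_Archimedean2 by blast
      then have "4 * real m < real N * norm (dcharacter.L1 \<psi>)" using nz by (simp add: field_simps)
      also have "\<dots> \<le> real (Suc N) * norm (dcharacter.L1 \<psi>)" by (intro mult_right_mono) auto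
      also have "\<dots> \<le> 4 * real m" using bound[of N] by (simp add: field_simps del: of_nat_Suc)
      finally show False by simp
    qed
  qed
  have "\<forall>\<xi>\<in>X. \<exists>C. \<forall>N\<ge>1. norm (dcharacter.mangoldt_sum_char \<xi> N - of_real (\<epsilon> \<xi> * ln (real N))) \<le> C"
    using mangoldt_sum_char_asymp unfolding X_def P_def \<epsilon>_def by blast
  then obtain C where C: "\<And>\<xi> N. \<xi> \<in> X \<Longrightarrow> N \<ge> 1 \<Longrightarrow>
      norm (dcharacter.mangoldt_sum_char \<xi> N - of_real (\<epsilon> \<xi> * ln (real N))) \<le> C \<xi>"
    using bchoice by metis
  \<comment> \<open>The principal character contributes 1, \<open>\<chi>\<close> and its conjugate
    contribute -1 each, and no other coefficient is positive.\<close>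
  have eps: "(\<Sum>\<xi>\<in>X. \<epsilon> \<xi>) \<le> -1"
  proof -
    have "(\<Sum>\<xi>\<in>X. \<epsilon> \<xi>) = (\<Sum>\<xi>\<in>{P, \<chi>, \<psi>}. \<epsilon> \<xi>) + (\<Sum>\<xi>\<in>X - {P, \<chi>, \<psi>}. \<epsilon> \<xi>)"
      using finX PX assms(2) \<psi> by (subst sum.union_disjoint[symmetric]) (auto simp: X_def intro!: sum.cong)
    also have "(\<Sum>\<xi>\<in>{P, \<chi>, \<psi>}. \<epsilon> \<xi>) = -1"
      using assms(3) \<psi>P \<psi>\<chi> L0 L0' by (auto simp: \<epsilon>_def P_def[symmetric])
    also have "(\<Sum>\<xi>\<in>X - {P, \<chi>, \<psi>}. \<epsilon> \<xi>) \<le> 0" by (intro sum_nonpos) (auto simp: \<epsilon>_def)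
    finally show ?thesis by simp
  qed
  have ln_le: "ln (real N) \<le> (\<Sum>\<xi>\<in>X. C \<xi>)" if N: "N \<ge> 1" for N
  proof -
    have "0 \<le> Re (\<Sum>\<xi>\<in>X. cnj (\<xi> 1) * dcharacter.mangoldt_sum_char \<xi> N)"
      unfolding X_def using sum_mangoldt_congruent[OF assms(1) modulus_pos, of 1 N]
      by (auto intro!: mult_nonneg_nonneg sum_nonneg simp: mangoldt_nonneg)
    also have "\<dots> = (\<Sum>\<xi>\<in>X. Re (dcharacter.mangoldt_sum_char \<xi> N))"
      unfolding Re_sum
    proof (intro sum.cong refl)
      fix \<xi> assume "\<xi> \<in> X"
      then interpret \<xi>: dcharacter m \<xi> by (simp add: X_def)
      show "Re (cnj (\<xi> 1) * \<xi>.mangoldt_sum_char N) = Re (\<xi>.mangoldt_sum_char N)"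
        using \<xi>.one by simp
    qed
    also have "\<dots> \<le> (\<Sum>\<xi>\<in>X. \<epsilon> \<xi> * ln (real N) + C \<xi>)"
    proof (rule sum_mono)
      fix \<xi> assume "\<xi> \<in> X"
      from order.trans[OF complex_Re_le_cmod C[OF this N]]
      show "Re (dcharacter.mangoldt_sum_char \<xi> N) \<le> \<epsilon> \<xi> * ln (real N) + C \<xi>" by simp
    qed
    also have "\<dots> = (\<Sum>\<xi>\<in>X. \<epsilon> \<xi>) * ln (real N) + (\<Sum>\<xi>\<in>X. C \<xi>)"
      by (simp add: sum.distrib sum_distrib_right)
    also have "(\<Sum>\<xi>\<in>X. \<epsilon> \<xi>) * ln (real N) \<le> (-1) * ln (real N)"
      using eps N by (intro mult_right_mono) auto
    finally show ?thesis by simp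
  qed
  obtain N where N: "exp (\<Sum>\<xi>\<in>X. C \<xi>) < real N" using reals_Archimedean2 by blast
  then have "N \<ge> 1" using exp_gt_zero[of "\<Sum>\<xi>\<in>X. C \<xi>"] by (cases N) auto
  moreover have "(\<Sum>\<xi>\<in>X. C \<xi>) < ln (real N)" using N by (metis exp_gt_zero exp_less_cancel_iff exp_ln less_trans)
  ultimately show False using ln_le[of N] by linarith
qed

text \<open>Orthogonality isolates the class of \<open>b\<close>. Among the character sums only the
  principal one grows, since \<open>L1\<close> is non-zero for all others; \<open>c\<close> is the
  reciprocal of the number of characters.\<close>

theorem mertens_arithmetic_progression:
  assumes "squarefree m" "m > 0" "coprime b m"
  obtains c C where "c > 0" "\<And>N. N \<ge> 1 \<Longrightarrow>
    \<bar>(\<Sum>n | n \<in> {1..N} \<and> [n = b] (mod m). mangoldt n / real n) - c * ln (real N)\<bar> \<le> C"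
proof -
  define X where "X = {\<chi>. dcharacter m \<chi>}"
  define P where "P = principal_dcharacter m"
  define e where "e = (\<lambda>\<chi>. if \<chi> = P then 1 else 0 :: real)"
  have finX: "finite X" unfolding X_def by (rule finite_dcharacters)
  have PX: "P \<in> X" by (simp add: X_def P_def dcharacter_principal assms(2))
  then have cX: "card X > 0" using finX by (auto simp: card_gt_0_iff)
  have "\<forall>\<chi>\<in>X. \<exists>C. \<forall>N\<ge>1. norm (dcharacter.mangoldt_sum_char \<chi> N - of_real (e \<chi> * ln (real N))) \<le> C"
  proof
    fix \<chi> assume "\<chi> \<in> X"
    then have \<chi>: "dcharacter m \<chi>" by (simp add: X_def)
    have "e \<chi> = (if \<chi> = principal_dcharacter m then 1 else if dcharacter.L1 \<chi> = 0 then -1 else 0)"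
      using L1_nonzero[OF assms(1) \<chi>] by (simp add: e_def P_def)
    with mangoldt_sum_char_asymp[OF \<chi>]
    show "\<exists>C. \<forall>N\<ge>1. norm (dcharacter.mangoldt_sum_char \<chi> N - of_real (e \<chi> * ln (real N))) \<le> C"
      by (simp only:)
  qed
  then obtain C where C: "\<And>\<chi> N. \<chi> \<in> X \<Longrightarrow> N \<ge> 1 \<Longrightarrow>
      norm (dcharacter.mangoldt_sum_char \<chi> N - of_real (e \<chi> * ln (real N))) \<le> C \<chi>"
    using bchoice by metis
  have "\<bar>(\<Sum>n | n \<in> {1..N} \<and> [n = b] (mod m). mangoldt n / real n) - 1 / real (card X) * ln (real N)\<bar>
      \<le> (\<Sum>\<chi>\<in>X. C \<chi>) / real (card X)" if N: "N \<ge> 1" for N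
  proof -
    define T where "T = (\<Sum>n | n \<in> {1..N} \<and> [n = b] (mod m). mangoldt n / real n)"
    have "of_real (real (card X) * T - ln (real N))
        = (\<Sum>\<chi>\<in>X. cnj (\<chi> b) * dcharacter.mangoldt_sum_char \<chi> N) - (\<Sum>\<chi>\<in>X. cnj (\<chi> b) * of_real (e \<chi> * ln (real N)))"
    proof -
      have "(\<Sum>\<chi>\<in>X. cnj (\<chi> b) * of_real (e \<chi> * ln (real N))) = (\<Sum>\<chi>\<in>{P}. cnj (\<chi> b) * of_real (e \<chi> * ln (real N)))"
        using finX PX by (intro sum.mono_neutral_right) (auto simp: e_def)
      also have "\<dots> = of_real (ln (real N))" using assms(3) by (simp add: e_def P_def principal_dcharacter_def)
      finally show ?thesis
        using sum_mangoldt_congruent[OF assms, of N] by (simp add: X_def T_def)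
    qed
    also have "\<dots> = (\<Sum>\<chi>\<in>X. cnj (\<chi> b) * (dcharacter.mangoldt_sum_char \<chi> N - of_real (e \<chi> * ln (real N))))"
      by (simp only: sum_subtractf[symmetric] right_diff_distrib)
    also have "norm \<dots> \<le> (\<Sum>\<chi>\<in>X. C \<chi>)"
    proof (intro order.trans[OF norm_sum] sum_mono)
      fix \<chi> assume \<chi>: "\<chi> \<in> X"
      have "norm (\<chi> b) \<le> 1" using \<chi> dcharacter.norm_le_1 by (auto simp: X_def)
      then have "norm (cnj (\<chi> b) * (dcharacter.mangoldt_sum_char \<chi> N - of_real (e \<chi> * ln (real N)))) \<le> 1 * C \<chi>"
        unfolding norm_mult complex_mod_cnj using C[OF \<chi> N] by (intro mult_mono) auto
      then show "norm (cnj (\<chi> b) * (dcharacter.mangoldt_sum_char \<chi> N - of_real (e \<chi> * ln (real N)))) \<le> C \<chi>" by simp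
    qed
    finally have "\<bar>real (card X) * T - ln (real N)\<bar> \<le> (\<Sum>\<chi>\<in>X. C \<chi>)" by (simp only: norm_of_real)
    moreover have "real (card X) * T - ln (real N) = real (card X) * (T - 1 / real (card X) * ln (real N))"
      using cX by (simp add: field_simps)
    ultimately have "real (card X) * \<bar>T - 1 / real (card X) * ln (real N)\<bar> \<le> (\<Sum>\<chi>\<in>X. C \<chi>)"
      by (simp add: abs_mult)
    then show ?thesis using cX by (simp add: T_def pos_le_divide_eq mult.commute)
  qed
  with cX show ?thesis by (intro that[of "1 / real (card X)" "(\<Sum>\<chi>\<in>X. C \<chi>) / real (card X)"]) auto
qed

text \<open>An exponent of at least 2 forces the prime below \<open>sqrt N\<close>, and
  \<open>2 ^ k \<le> N\<close> with \<open>ln 2 \<ge> 1/2\<close> forces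
  \<open>k \<le> 2 * ln N\<close>.\<close>

lemma card_proper_prime_powers_le:
  assumes "N \<ge> 1"
  shows "real (card {n\<in>{1..N}. primepow n \<and> \<not> prime n}) \<le> 2 * sqrt (real N) * ln (real N)"
proof -
  define s where "s = nat \<lfloor>sqrt (real N)\<rfloor>"
  define t where "t = nat \<lfloor>2 * ln (real N)\<rfloor>"
  have "{n\<in>{1..N}. primepow n \<and> \<not> prime n} \<subseteq> (\<lambda>(p,k). p ^ k) ` ({1..s} \<times> {1..t})"
  proof
    fix n assume "n \<in> {n\<in>{1..N}. primepow n \<and> \<not> prime n}"
    then obtain p k where pk: "prime p" "k > 0" "n = p ^ k" "p ^ k \<le> N" "\<not> prime n" by (auto simp: primepow_def)
    then have "k \<noteq> 1" by auto
    with pk have k2: "k \<ge> 2" by simp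
    have p2: "p \<ge> 2" using pk prime_ge_2_nat by blast
    have "p ^ 2 \<le> p ^ k" using p2 k2 by (intro power_increasing) auto
    then have "real (p ^ 2) \<le> real N" using pk by (intro of_nat_mono) simp
    then have "real p \<le> sqrt (real N)" by (intro real_le_rsqrt) simp
    then have "p \<le> s" unfolding s_def by (simp add: le_nat_floor)
    have "(2::nat) ^ k \<le> p ^ k" using p2 by (intro power_mono) auto
    then have "2 ^ k \<le> N" using pk(4) by (rule order.trans)
    then have "real (2 ^ k) \<le> real N" by (rule of_nat_mono)
    then have "ln (2 ^ k) \<le> ln (real N)" using assms by (subst ln_le_cancel_iff) auto
    then have "real k * ln 2 \<le> ln (real N)" by (simp add: ln_realpow)
    moreover have "1 / 2 \<le> ln (2::real)" using ln_le_minus_one[of "1 / 2 :: real"] by (simp add: ln_div)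
    then have "real k * (1/2) \<le> real k * ln 2" by (intro mult_left_mono) auto
    ultimately have "real k \<le> 2 * ln (real N)" by linarith
    then have "k \<le> t" unfolding t_def by (simp add: le_nat_floor)
    with \<open>p \<le> s\<close> pk p2 show "n \<in> (\<lambda>(p,k). p ^ k) ` ({1..s} \<times> {1..t})"
      by (intro image_eqI[of _ _ "(p,k)"]) auto
  qed
  then have "card {n\<in>{1..N}. primepow n \<and> \<not> prime n} \<le> card ({1..s} \<times> {1..t})"
    by (rule surj_card_le[rotated]) simp
  also have "\<dots> = s * t" by simp
  finally have "real (card {n\<in>{1..N}. primepow n \<and> \<not> prime n}) \<le> real (s * t)" by (rule of_nat_mono)
  also have "\<dots> = real s * real t" by simp
  also have "\<dots> \<le> sqrt (real N) * (2 * ln (real N))"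
    using assms by (intro mult_mono) (auto simp: s_def t_def)
  finally show ?thesis by (simp add: mult_ac)
qed

text \<open>\<open>D\<close> is chosen so that \<open>c * ln D\<close> exceeds twice the Mertens
  error by 1. The terms with \<open>N div D < n \<le> N\<close> then sum to at least 1, and each is
  at most \<open>ln N * D / N\<close>, so at least \<open>N / (D * ln N)\<close> prime powers occur.
  Half of this is conceded to the proper prime powers.\<close>

theorem primes_arithmetic_progression_lower_bound:
  assumes "squarefree m" "m > 0" "coprime b m"
  obtains c where "c > 0"
    "eventually (\<lambda>N. c * real N / ln (real N) \<le> real (card {p. p \<le> N \<and> prime p \<and> [p = b] (mod m)})) at_top"
proof -
  obtain c C where c: "c > 0" and mert: "\<And>N. N \<ge> 1 \<Longrightarrow>
    \<bar>(\<Sum>n | n \<in> {1..N} \<and> [n = b] (mod m). mangoldt n / real n) - c * ln (real N)\<bar> \<le> C"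
    using mertens_arithmetic_progression[OF assms] by blast
  obtain D where D: "exp ((2 * C + 1) / c) < real D" using reals_Archimedean2 by blast
  then have D1: "D \<ge> 1" using exp_gt_zero[of "(2 * C + 1) / c"] by (cases D) auto
  have "(2 * C + 1) / c < ln (real D)" using D by (metis exp_gt_zero exp_less_cancel_iff exp_ln less_trans)
  then have lnD: "2 * C + 1 \<le> c * ln (real D)" using c by (simp add: field_simps)
  have key: "real N / (2 * real D) / ln (real N) \<le> real (card {p. p \<le> N \<and> prime p \<and> [p = b] (mod m)})"
    if N: "N \<ge> D" "N \<ge> 3" and big: "2 * sqrt (real N) * ln (real N) \<le> real N / (2 * real D) / ln (real N)" for N
  proof -
    define M where "M = N div D"
    define A where "A = {n. n \<in> {1..N} \<and> [n = b] (mod m) \<and> n > M \<and> primepow n}"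
    have M1: "M \<ge> 1" using N D1 by (simp add: M_def Suc_le_eq div_greater_zero_iff)
    have lnN: "ln (real N) > 0" using N by simp
    have DM: "real D * real M \<le> real N"
      unfolding M_def by (simp only: of_nat_mult[symmetric] of_nat_le_iff) simp
    then have "ln (real D * real M) \<le> ln (real N)" using M1 D1 N by (subst ln_le_cancel_iff) auto
    then have "ln (real D) + ln (real M) \<le> ln (real N)" using M1 D1 by (simp add: ln_mult)
    then have "c * (ln (real D) + ln (real M)) \<le> c * ln (real N)" using c by (intro mult_left_mono) auto
    then have ln_diff: "c * ln (real D) + c * ln (real M) \<le> c * ln (real N)" by (simp add: distrib_left)
    have MN: "M \<le> N" using DM D1 unfolding M_def by simp
    have "(\<Sum>n | n \<in> {1..N} \<and> [n = b] (mod m). mangoldt n / real n :: real)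
        = (\<Sum>n | n \<in> {1..M} \<and> [n = b] (mod m). mangoldt n / real n)
          + (\<Sum>n | n \<in> {1..N} \<and> [n = b] (mod m) \<and> n > M. mangoldt n / real n)"
      using MN by (subst sum.union_disjoint[symmetric]) (auto intro!: sum.cong)
    also have "(\<Sum>n | n \<in> {1..N} \<and> [n = b] (mod m) \<and> n > M. mangoldt n / real n :: real) = (\<Sum>n\<in>A. mangoldt n / real n)"
      by (intro sum.mono_neutral_right) (auto simp: A_def mangoldt_def)
    finally have "1 \<le> (\<Sum>n\<in>A. mangoldt n / real n)"
      using mert[of N] mert[OF M1] N lnD ln_diff by linarith
    also have "\<dots> \<le> (\<Sum>n\<in>A. ln (real N) * (real D / real N))"
    proof (rule sum_mono)
      fix n assume n: "n \<in> A"
      then have n': "1 \<le> n" "n \<le> N" "M < n" by (auto simp: A_def)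
      have "N < D * Suc M" unfolding M_def using D1
        using dividend_less_times_div[of D N] by simp
      also have "\<dots> \<le> D * n" using n' by (intro mult_le_mono2) simp
      finally have "real N \<le> real D * real n" by (simp only: of_nat_mult[symmetric] of_nat_le_iff)
      then have "1 / real n \<le> real D / real N" using n' N by (simp add: field_simps)
      moreover have "mangoldt n \<le> ln (real N)"
      proof (rule order.trans)
        show "mangoldt n \<le> ln (real n)" using n' by (intro mangoldt_le) simp
        show "ln (real n) \<le> ln (real N)" using n' by simp
      qed
      ultimately have "mangoldt n * (1 / real n) \<le> ln (real N) * (real D / real N)"
        using lnN by (intro mult_mono) auto
      then show "mangoldt n / real n \<le> ln (real N) * (real D / real N)" by simp
    qed
    also have "\<dots> = real (card A) * (ln (real N) * (real D / real N))" by simp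
    finally have "real N / real D / ln (real N) \<le> real (card A)"
      using lnN N D1 by (simp add: field_simps)
    moreover have "real (card A) \<le> real (card {p. p \<le> N \<and> prime p \<and> [p = b] (mod m)})
        + real (card {n\<in>{1..N}. primepow n \<and> \<not> prime n})"
    proof -
      have "A \<subseteq> {p. p \<le> N \<and> prime p \<and> [p = b] (mod m)} \<union> {n\<in>{1..N}. primepow n \<and> \<not> prime n}"
        by (auto simp: A_def)
      then have "card A \<le> card ({p. p \<le> N \<and> prime p \<and> [p = b] (mod m)} \<union> {n\<in>{1..N}. primepow n \<and> \<not> prime n})"
        by (intro card_mono) auto
      also have "\<dots> \<le> card {p. p \<le> N \<and> prime p \<and> [p = b] (mod m)} + card {n\<in>{1..N}. primepow n \<and> \<not> prime n}"
        by (rule card_Un_le)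
      finally show ?thesis by (simp only: of_nat_add[symmetric] of_nat_le_iff)
    qed
    moreover have "real (card {n\<in>{1..N}. primepow n \<and> \<not> prime n}) \<le> 2 * sqrt (real N) * ln (real N)"
      using N by (intro card_proper_prime_powers_le) auto
    moreover have "real N / real D / ln (real N) = 2 * (real N / (2 * real D) / ln (real N))" by simp
    ultimately show ?thesis using big by linarith
  qed
  have ev: "eventually (\<lambda>N. 2 * sqrt (real N) * ln (real N) \<le> real N / (2 * real D) / ln (real N)) at_top"
    using D1 by real_asymp
  have "eventually (\<lambda>N. real N / (2 * real D) / ln (real N)
      \<le> real (card {p. p \<le> N \<and> prime p \<and> [p = b] (mod m)})) at_top"
    using ev eventually_ge_at_top[of D] eventually_ge_at_top[of 3] by eventually_elim (rule key)
  then show ?thesis using D1 by (intro that[of "1 / (2 * real D)"]) auto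
qed


section \<open>Romanov's lemma on Mersenne numbers\<close>

lemma prime_mod_6:
  assumes "prime (p::nat)" "p \<ge> 5"
  shows "p mod 6 = 1 \<or> p mod 6 = 5"
proof -
  have "\<not> 2 dvd p" "\<not> 3 dvd p"
    using assms primes_dvd_imp_eq[of 2 p] primes_dvd_imp_eq[of 3 p] by auto
  then show ?thesis by presburger
qed

definition primes_from_5 :: "nat \<Rightarrow> nat set" where
  "primes_from_5 n = {p. prime p \<and> 5 \<le> p \<and> p \<le> n}"

lemma finite_primes_from_5: "finite (primes_from_5 n)"
  by (rule finite_subset[of _ "{..n}"]) (auto simp: primes_from_5_def)

lemma prime_quotient_ge_1: "p \<ge> 2 \<Longrightarrow> 1 \<le> real p / (real p - 1)"
  by simp

text \<open>Primes above 3 are congruent to 1 or 5 modulo 6, so the product over them grows at most like a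
  cube root.\<close>

lemma prod_primes_from_5_le:
  assumes "i \<ge> 1"
  shows "(\<Prod>p\<in>primes_from_5 (6 * i + 4). real p / (real p - 1)) ^ 3 \<le> 8 * real i"
  using assms
proof (induction i rule: dec_induct)
  case base
  have "primes_from_5 10 \<subseteq> {5, 7}"
  proof
    fix p assume "p \<in> primes_from_5 10"
    then have p: "prime p" "5 \<le> p" "p \<le> 10" by (auto simp: primes_from_5_def)
    have "p = 5 \<or> p = 7" using prime_mod_6[OF p(1,2)] p(2,3) by presburger
    then show "p \<in> {5, 7}" by simp
  qed
  then have "(\<Prod>p\<in>primes_from_5 10. real p / (real p - 1)) \<le> (\<Prod>p\<in>{5::nat, 7}. real p / (real p - 1))"
    by (intro prod_mono2) (auto simp: primes_from_5_def intro!: prime_quotient_ge_1)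
  also have "\<dots> = 35 / 24" by simp
  finally have "(\<Prod>p\<in>primes_from_5 10. real p / (real p - 1)) ^ 3 \<le> (35 / 24) ^ 3"
    by (intro power_mono prod_nonneg) (auto simp: primes_from_5_def)
  also have "\<dots> \<le> 8" by (simp add: power3_eq_cube)
  finally show ?case by simp
next
  case (step i)
  define q where "q = (\<lambda>p. real p / (real p - 1))"
  define A where "A = primes_from_5 (6 * i + 4)"
  have sub: "primes_from_5 (6 * Suc i + 4) \<subseteq> A \<union> {6 * i + 5, 6 * i + 7}"
  proof
    fix p assume "p \<in> primes_from_5 (6 * Suc i + 4)"
    then have p: "prime p" "5 \<le> p" "p \<le> 6 * i + 10" by (auto simp: primes_from_5_def)
    have "p \<le> 6 * i + 4 \<or> p = 6 * i + 5 \<or> p = 6 * i + 7"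
      using prime_mod_6[OF p(1,2)] p(3) by presburger
    then show "p \<in> A \<union> {6 * i + 5, 6 * i + 7}" using p by (auto simp: A_def primes_from_5_def)
  qed
  have "(\<Prod>p\<in>primes_from_5 (6 * Suc i + 4). q p) \<le> (\<Prod>p\<in>A \<union> {6 * i + 5, 6 * i + 7}. q p)"
    using sub unfolding q_def
    by (intro prod_mono2) (auto simp: A_def finite_primes_from_5 primes_from_5_def intro!: prime_quotient_ge_1)
  also have "\<dots> = (\<Prod>p\<in>A. q p) * (q (6 * i + 5) * q (6 * i + 7))"
    by (subst prod.union_disjoint) (auto simp: A_def finite_primes_from_5 primes_from_5_def)
  finally have "(\<Prod>p\<in>primes_from_5 (6 * Suc i + 4). q p) ^ 3 \<le> ((\<Prod>p\<in>A. q p) * (q (6 * i + 5) * q (6 * i + 7))) ^ 3"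
    by (intro power_mono prod_nonneg) (auto simp: primes_from_5_def q_def)
  also have "\<dots> = (\<Prod>p\<in>A. q p) ^ 3 * (q (6 * i + 5) * q (6 * i + 7)) ^ 3" by (rule power_mult_distrib)
  also have "\<dots> \<le> (8 * real i) * ((real i + 1) / real i)"
  proof (rule mult_mono)
    show "(\<Prod>p\<in>A. q p) ^ 3 \<le> 8 * real i" using step.IH by (simp add: A_def q_def)
    define x where "x = real i"
    have x: "x \<ge> 1" using step by (simp add: x_def)
    \<comment> \<open>Since \<open>(6 * x + 5) * (6 * x + 7) = a + b\<close>, the two new factors
      multiply to \<open>1 + b / a\<close>, where \<open>b / a\<close> is close to
      \<open>1 / (3 * x)\<close>. The bounds \<open>b1\<close> to \<open>b3\<close> show that the
      cube is at most \<open>1 + 1 / x\<close>.\<close>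
    define a where "a = (6 * x + 4) * (6 * x + 6)"
    define b where "b = 12 * x + 11"
    have ab: "0 < a" "0 \<le> b" using x by (auto simp: a_def b_def)
    have qq: "q (6 * i + 5) * q (6 * i + 7) = (a + b) / a"
      by (simp add: q_def x_def[symmetric] a_def b_def algebra_simps)
    have xx: "x * x \<ge> x" using x by (simp add: mult_le_cancel_left1)
    have a: "a = 36 * (x * x) + 60 * x + 24" by (simp add: a_def algebra_simps)
    have b1: "b \<le> a" using x xx unfolding a b_def by linarith
    have "b * b = 144 * (x * x) + 264 * x + 121" by (simp add: b_def algebra_simps)
    moreover have "5 * a = 180 * (x * x) + 300 * x + 120" by (simp add: a algebra_simps)
    ultimately have b2: "b * b \<le> 5 * a" using x xx by linarith
    have "3 * x * b + 20 * x = 36 * (x * x) + 53 * x" by (simp add: b_def algebra_simps)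
    then have b3: "3 * x * b + 20 * x \<le> a" using x unfolding a by linarith
    have "x * (a + b) ^ 3 = x * a ^ 3 + 3 * x * b * (a * a) + 3 * x * a * (b * b) + x * b * (b * b)"
      by (simp add: power3_eq_cube algebra_simps)
    also have "\<dots> \<le> x * a ^ 3 + 3 * x * b * (a * a) + 3 * x * a * (5 * a) + x * a * (5 * a)"
    proof -
      have "3 * x * a * (b * b) \<le> 3 * x * a * (5 * a)" using x ab b2 by (intro mult_left_mono) auto
      moreover have "x * b * (b * b) \<le> x * a * (5 * a)"
        using x ab by (intro mult_mono[OF mult_left_mono[OF b1] b2]) auto
      ultimately show ?thesis by linarith
    qed
    also have "\<dots> = x * a ^ 3 + (a * a) * (3 * x * b + 20 * x)" by (simp add: algebra_simps)
    also have "\<dots> \<le> x * a ^ 3 + (a * a) * a"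
      using b3 ab by (intro add_left_mono mult_left_mono) auto
    also have "\<dots> = (x + 1) * a ^ 3" by (simp add: power3_eq_cube algebra_simps)
    finally have "x * (a + b) ^ 3 \<le> (x + 1) * a ^ 3" .
    then show "(q (6 * i + 5) * q (6 * i + 7)) ^ 3 \<le> (real i + 1) / real i"
      unfolding qq x_def[symmetric] using x ab by (simp add: power_divide field_simps)
  qed (use step in \<open>auto simp: q_def\<close>)
  also have "\<dots> = 8 * real (Suc i)" using step by simp
  finally show ?case by (simp add: q_def)
qed

text \<open>The prime 3 contributes \<open>3 / 2\<close>. Since \<open>k \<le> 6 * i + 4\<close>,
  primes beyond that bound contribute at most \<open>1 + 1 / k\<close> each; there are at most
  \<open>k\<close> of them, so together at most \<open>exp 1 \<le> 3\<close>. The rest is the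
  preceding lemma, and \<open>729 = (3 / 2 * 3)^3 * 8\<close>. The cube-root growth matters: with
  \<open>k = x^2\<close> it leaves a power of \<open>x\<close> below the first.\<close>

lemma prod_odd_primes_le:
  assumes S: "finite S" "\<And>p. p \<in> S \<Longrightarrow> prime p" "2 \<notin> S" and k: "card S \<le> k" "k \<ge> 1"
  shows "(\<Prod>p\<in>S. real p / (real p - 1)) ^ 3 \<le> 729 * real k"
proof -
  define q where "q = (\<lambda>p. real p / (real p - 1))"
  define i where "i = k div 6 + 1"
  define A where "A = primes_from_5 (6 * i + 4)"
  define B where "B = {p \<in> S. p > 6 * i + 4}"
  have i: "k \<le> 6 * i + 4" "i \<ge> 1" "i \<le> k" using k(2) unfolding i_def by presburger+
  have p2: "p \<ge> 2" if "p \<in> S" for p using S(2)[OF that] prime_ge_2_nat by blast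
  have sub: "S \<subseteq> insert 3 (A \<union> B)"
  proof
    fix p assume p: "p \<in> S"
    have "p \<noteq> 2" "p \<noteq> 4" using p S(3) S(2)[OF p] primes_dvd_imp_eq[of 2 4] by auto
    with p p2[OF p] S(2)[OF p] show "p \<in> insert 3 (A \<union> B)" by (auto simp: A_def B_def primes_from_5_def)
  qed
  have "(\<Prod>p\<in>S. q p) \<le> (\<Prod>p\<in>insert 3 (A \<union> B). q p)"
    using sub S(1) p2 unfolding q_def
    by (intro prod_mono2) (auto simp: A_def B_def finite_primes_from_5 primes_from_5_def dest: p2 intro!: prime_quotient_ge_1)
  also have "\<dots> = q 3 * ((\<Prod>p\<in>A. q p) * (\<Prod>p\<in>B. q p))"
    using S(1) by (subst prod.insert) (auto simp: A_def B_def finite_primes_from_5 primes_from_5_def intro!: prod.union_disjoint)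
  finally have *: "(\<Prod>p\<in>S. q p) \<le> q 3 * ((\<Prod>p\<in>A. q p) * (\<Prod>p\<in>B. q p))" .
  have A0: "0 \<le> (\<Prod>p\<in>A. q p)"
    by (intro prod_nonneg) (auto simp: A_def primes_from_5_def q_def)
  have B0: "0 \<le> (\<Prod>p\<in>B. q p)" by (intro prod_nonneg) (auto simp: B_def q_def dest!: p2)
  have "q 3 * ((\<Prod>p\<in>A. q p) * (\<Prod>p\<in>B. q p)) \<le> (3 / 2) * ((\<Prod>p\<in>A. q p) * 3)"
  proof (intro mult_mono mult_left_mono)
    have "(\<Prod>p\<in>B. q p) \<le> (\<Prod>p\<in>B. 1 + 1 / real k)"
    proof (intro prod_mono conjI)
      fix p assume p: "p \<in> B"
      then have "k < p" using i by (auto simp: B_def)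
      then have "1 / (real p - 1) \<le> 1 / real k" using k(2) by (intro divide_left_mono) auto
      moreover have "q p = 1 + 1 / (real p - 1)" using \<open>k < p\<close> k(2) by (simp add: q_def field_simps)
      ultimately show "q p \<le> 1 + 1 / real k" by simp
      show "0 \<le> q p" using \<open>k < p\<close> k(2) by (simp add: q_def)
    qed
    also have "\<dots> = (1 + 1 / real k) ^ card B" by simp
    also have "\<dots> \<le> (1 + 1 / real k) ^ k"
    proof (rule power_increasing)
      have "card B \<le> card S" using S(1) by (intro card_mono) (auto simp: B_def)
      then show "card B \<le> k" using k(1) by simp
    qed simp
    also have "\<dots> \<le> exp (1 / real k) ^ k" by (intro power_mono exp_ge_add_one_self) auto
    also have "\<dots> = exp 1" using k(2) by (simp add: exp_of_nat_mult[symmetric])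
    also have "\<dots> \<le> 3" by (rule exp_le)
    finally show "(\<Prod>p\<in>B. q p) \<le> 3" .
  qed (use A0 B0 in \<open>auto simp: q_def\<close>)
  with * have "(\<Prod>p\<in>S. q p) \<le> (3 / 2) * ((\<Prod>p\<in>A. q p) * 3)" by (rule order.trans)
  then have "(\<Prod>p\<in>S. q p) ^ 3 \<le> ((3 / 2) * ((\<Prod>p\<in>A. q p) * 3)) ^ 3"
    using p2 by (intro power_mono prod_nonneg) (auto simp: q_def dest: p2)
  also have "\<dots> = (729 / 8) * (\<Prod>p\<in>A. q p) ^ 3" by (simp add: power_mult_distrib power3_eq_cube)
  also have "\<dots> \<le> (729 / 8) * (8 * real i)"
    using prod_primes_from_5_le[OF i(2)] by (intro mult_left_mono) (auto simp: A_def q_def)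
  also have "\<dots> \<le> 729 * real k" using i by simp
  finally show ?thesis by (simp add: q_def)
qed

section \<open>Reciprocal sums over divisors\<close>

lemma sum_inverse_divisors_prime_power:
  assumes "prime p"
  shows "(\<Sum>d | d dvd p ^ k. 1 / real d) = (\<Sum>i\<le>k. (1 / real p) ^ i)"
proof -
  have "{d. d dvd p ^ k} = (\<lambda>i. p ^ i) ` {..k}"
    using assms by (auto simp: divides_primepow_nat le_imp_power_dvd)
  moreover have "inj_on (\<lambda>i. p ^ i) {..k}"
    using assms prime_gt_1_nat by (auto simp: inj_on_def)
  ultimately show ?thesis by (simp add: sum.reindex power_divide)
qed

text \<open>All three expressions are multiplicative, and at a prime power the geometric sum lies
  between \<open>1 + 1 / p\<close> and \<open>p / (p - 1)\<close>.\<close>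

lemma sum_inverse_divisors_bounds:
  assumes "n > 0"
  shows "(\<Prod>p\<in>prime_factors n. 1 + 1 / real p) \<le> (\<Sum>d | d dvd n. 1 / real d)"
    and "(\<Sum>d | d dvd n. 1 / real d) \<le> prime_ratio n"
proof -
  have "(\<Prod>p\<in>prime_factors n. 1 + 1 / real p) \<le> (\<Sum>d | d dvd n. 1 / real d) \<and>
    (\<Sum>d | d dvd n. 1 / real d) \<le> prime_ratio n"
    using assms
  proof (induction n rule: less_induct)
    case (less n)
    show ?case
    proof (cases "n = 1")
      case False
      then have "n > 1" using less by simp
      then obtain p k n' where n: "prime p" "n = p ^ k * n'" "\<not> p dvd n'" "n' > 0" "n' < n"
        by (rule obtain_prime_power)
      have p2: "p \<ge> 2" using n prime_ge_2_nat by blast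
      have k: "k > 0" using n by (cases k) auto
      have cop: "coprime (p ^ k) n'" using n by (simp add: prime_imp_coprime)
      have pf: "prime_factors n = insert p (prime_factors n')"
        using n k p2 by (simp add: prime_factors_product prime_factors_power prime_prime_factors)
      have pn: "p \<notin> prime_factors n'" using n by auto
      have split: "(\<Sum>d | d dvd n. 1 / real d) = (\<Sum>i\<le>k. (1 / real p) ^ i) * (\<Sum>d | d dvd n'. 1 / real d)"
      proof -
        have "(\<Sum>d | d dvd n. 1 / real d) = (\<Sum>x | x dvd p ^ k. \<Sum>y | y dvd n'. 1 / real x * (1 / real y))"
          unfolding n(2) using cop n p2 by (subst sum_divisors_coprime_mult) auto
        also have "\<dots> = (\<Sum>x | x dvd p ^ k. 1 / real x) * (\<Sum>y | y dvd n'. 1 / real y)"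
          by (simp only: sum_product)
        finally show ?thesis by (simp only: sum_inverse_divisors_prime_power[OF n(1)])
      qed
      note IH = less.IH[OF n(5,4)]
      have g1: "1 + 1 / real p \<le> (\<Sum>i\<le>k. (1 / real p) ^ i)"
      proof -
        have "(\<Sum>i\<in>{0,1}. (1 / real p) ^ i) \<le> (\<Sum>i\<le>k. (1 / real p) ^ i)"
          using k by (intro sum_mono2) auto
        then show ?thesis by simp
      qed
      have g2: "(\<Sum>i\<le>k. (1 / real p) ^ i) \<le> real p / (real p - 1)"
      proof -
        have "(\<Sum>i\<le>k. (1 / real p) ^ i) \<le> 1 / (1 - 1 / real p)"
          using sum_power_le_geometric[of "1 / real p" k] p2 by (simp add: atLeast0AtMost)
        also have "\<dots> = real p / (real p - 1)" using p2 by (simp add: field_simps)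
        finally show ?thesis .
      qed
      have "(1 + 1 / real p) * (\<Prod>p\<in>prime_factors n'. 1 + 1 / real p)
          \<le> (\<Sum>i\<le>k. (1 / real p) ^ i) * (\<Sum>d | d dvd n'. 1 / real d)"
        using g1 IH by (intro mult_mono) (auto intro!: prod_nonneg sum_nonneg)
      moreover have "(\<Sum>i\<le>k. (1 / real p) ^ i) * (\<Sum>d | d dvd n'. 1 / real d) \<le> real p / (real p - 1) * prime_ratio n'"
        using g2 IH p2 by (intro mult_mono) (auto intro!: sum_nonneg)
      ultimately show ?thesis using pn unfolding split by (simp add: pf prime_ratio_def)
    qed (simp add: prime_ratio_def)
  qed
  then show "(\<Prod>p\<in>prime_factors n. 1 + 1 / real p) \<le> (\<Sum>d | d dvd n. 1 / real d)"
    and "(\<Sum>d | d dvd n. 1 / real d) \<le> prime_ratio n" by blast+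
qed

text \<open>\<open>p / (p - 1)\<close> is \<open>1 + 1 / p\<close> times
  \<open>p^2 / (p^2 - 1)\<close>, and the product of the latter factors over all integers from 2 on
  telescopes to at most 2. This replaces a product over primes by a divisor sum, which can be
  regrouped by the order of 2.\<close>

lemma prime_ratio_le_sum_inverse_divisors:
  assumes "n > 0"
  shows "prime_ratio n \<le> 2 * (\<Sum>d | d dvd n. 1 / real d)"
proof -
  define f where "f = (\<lambda>p. (real p)\<^sup>2 / ((real p)\<^sup>2 - 1))"
  have tele: "(\<Prod>j=2..J. f j) \<le> 2 * real J / (real J + 1)" if "J \<ge> 1" for J
    using that
  proof (induction J rule: dec_induct)
    case (step J)
    have "(\<Prod>j=2..Suc J. f j) = (\<Prod>j=2..J. f j) * f (Suc J)"
      using step by (simp add: prod.cl_ivl_Suc)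
    also have "\<dots> \<le> (2 * real J / (real J + 1)) * f (Suc J)"
      using step by (intro mult_right_mono) (auto simp: f_def)
    also have "f (Suc J) = (real J + 1)\<^sup>2 / (real J * (real J + 2))"
      by (simp add: f_def power2_eq_square algebra_simps)
    also have "(2 * real J / (real J + 1)) * ((real J + 1)\<^sup>2 / (real J * (real J + 2))) = 2 * real (Suc J) / (real (Suc J) + 1)"
      using step by (simp add: power2_eq_square divide_simps) (simp add: algebra_simps)
    finally show ?case .
  qed simp
  have f1: "f j \<ge> 1" if "j \<ge> 2" for j
  proof -
    have "2\<^sup>2 \<le> (real j)\<^sup>2" using that by (intro power_mono) auto
    then show ?thesis by (simp add: f_def)
  qed
  have pf: "p \<ge> 2 \<and> p \<le> n" if "p \<in> prime_factors n" for p
    using that assms prime_ge_2_nat by (auto intro: dvd_imp_le)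
  have "(\<Prod>p\<in>prime_factors n. f p) \<le> (\<Prod>p=2..n. f p)"
    using pf f1 by (intro prod_mono2) (auto intro: order.trans[OF zero_le_one])
  also have "\<dots> \<le> 2 * real n / (real n + 1)" using assms by (intro tele) simp
  also have "\<dots> \<le> 2" by (simp add: field_simps)
  finally have f2: "(\<Prod>p\<in>prime_factors n. f p) \<le> 2" .
  have "prime_ratio n = (\<Prod>p\<in>prime_factors n. (1 + 1 / real p) * f p)"
    unfolding prime_ratio_def
  proof (rule prod.cong)
    fix p assume "p \<in> prime_factors n"
    then have p: "real p \<ge> 2" using pf[of p] by simp
    have "(real p)\<^sup>2 - 1 = (real p - 1) * (real p + 1)" by (simp add: power2_eq_square algebra_simps)
    then show "real p / (real p - 1) = (1 + 1 / real p) * f p"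
      using p unfolding f_def by (simp add: divide_simps power2_eq_square)
  qed simp
  also have "\<dots> = (\<Prod>p\<in>prime_factors n. 1 + 1 / real p) * (\<Prod>p\<in>prime_factors n. f p)"
    by (rule prod.distrib)
  also have "\<dots> \<le> (\<Sum>d | d dvd n. 1 / real d) * 2"
    using sum_inverse_divisors_bounds(1)[OF assms] f2 f1 pf
    by (intro mult_mono prod_nonneg sum_nonneg) (auto intro: order.trans[OF zero_le_one])
  finally show ?thesis by simp
qed

text \<open>Used for \<open>t \<ge> 1\<close>: for \<open>t = 0\<close> this is the infinite set of
  even numbers, since \<open>ord\<close> is 0 for moduli not coprime to 2.\<close>

definition divisors_with_order :: "nat \<Rightarrow> nat set" where
  "divisors_with_order t = {d. d dvd 2 ^ t - 1 \<and> ord d 2 = t}"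

definition order_weight :: "nat \<Rightarrow> real" where
  "order_weight t = (\<Sum>d\<in>divisors_with_order t. 1 / real d)"

lemma Mersenne_pos: "t \<ge> 1 \<Longrightarrow> (2::nat) ^ t - 1 > 0"
  using one_less_power[of "2::nat" t] by simp

lemma finite_divisors_with_order: "t \<ge> 1 \<Longrightarrow> finite (divisors_with_order t)"
proof -
  assume "t \<ge> 1"
  then have "(2::nat) ^ t - 1 > 0" by (rule Mersenne_pos)
  then have "finite {d. d dvd (2::nat) ^ t - 1}" by (rule finite_divisors_nat)
  then show ?thesis by (rule finite_subset[rotated]) (auto simp: divisors_with_order_def)
qed

lemma order_weight_nonneg: "order_weight t \<ge> 0"
  by (simp add: order_weight_def sum_nonneg)

text \<open>All divisors involved are distinct divisors of the odd number \<open>W\<close>. As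
  \<open>2 ^ card (prime_factors W) \<le> W \<le> 2 ^ x^2\<close>, it has at most \<open>x^2\<close>
  prime factors, so the product bound over odd primes applies.\<close>

lemma sum_order_weight_cubed_le:
  assumes "x \<ge> 1"
  shows "(\<Sum>t=1..x. order_weight t) ^ 3 \<le> 729 * (real x)\<^sup>2"
proof -
  define W where "W = (\<Prod>t=1..x. 2 ^ t - 1 :: nat)"
  have Wpos: "W > 0" unfolding W_def by (intro prod_pos Mersenne_pos) simp
  have Wodd: "odd W" unfolding W_def by (subst even_prod_iff) auto
  have "(\<Sum>t=1..x. order_weight t) = (\<Sum>d\<in>(\<Union>t\<in>{1..x}. divisors_with_order t). 1 / real d)"
    unfolding order_weight_def
  proof (rule sum.UNION_disjoint[symmetric])
    show "\<forall>t\<in>{1..x}. finite (divisors_with_order t)" by (simp add: finite_divisors_with_order)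
  qed (auto simp: divisors_with_order_def)
  also have "\<dots> \<le> (\<Sum>d | d dvd W. 1 / real d)"
  proof (rule sum_mono2)
    show "(\<Union>t\<in>{1..x}. divisors_with_order t) \<subseteq> {d. d dvd W}"
      using dvd_prodI[of "{1..x}" _ "\<lambda>t. 2 ^ t - 1 :: nat"]
      by (auto simp: divisors_with_order_def W_def intro: dvd_trans)
  qed (use Wpos in auto)
  also have "\<dots> \<le> prime_ratio W" by (rule sum_inverse_divisors_bounds(2)[OF Wpos])
  finally have le: "(\<Sum>t=1..x. order_weight t) \<le> prime_ratio W" .
  have card: "card (prime_factors W) \<le> x\<^sup>2"
  proof -
    have "2 ^ card (prime_factors W) = (\<Prod>p\<in>prime_factors W. 2::nat)" by simp
    also have "\<dots> \<le> \<Prod>(prime_factors W)" using prime_ge_2_nat by (intro prod_mono) auto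
    also have "\<dots> \<le> W" using Wpos by (intro dvd_imp_le prod_primes_dvd) auto
    also have "\<dots> \<le> (\<Prod>t=1..x. 2 ^ x)" unfolding W_def
      by (intro prod_mono) (auto intro!: order.trans[OF diff_le_self] power_increasing)
    also have "\<dots> = 2 ^ x\<^sup>2" by (simp add: power_mult[symmetric] power2_eq_square)
    finally show ?thesis by simp
  qed
  have "(\<Sum>t=1..x. order_weight t) ^ 3 \<le> prime_ratio W ^ 3"
    using le by (intro power_mono) (auto intro: sum_nonneg order_weight_nonneg)
  also have "\<dots> \<le> 729 * real (x\<^sup>2)"
    unfolding prime_ratio_def using card assms Wodd
    by (intro prod_odd_primes_le) (auto simp: power2_eq_square)
  finally show ?thesis by simp
qed

text \<open>Telescopes against \<open>3 * L powr (-1/3)\<close>; with \<open>x\<close>,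
  \<open>y\<close> the cube roots of \<open>L\<close> and \<open>L + 1\<close>, the step rests on
  \<open>y^3 - x^3 = 1\<close>.\<close>

lemma sum_powr_four_thirds_le: "(\<Sum>t=1..L. real t powr (-4/3)) \<le> 4"
proof -
  have "(\<Sum>t=1..L. real t powr (-4/3)) \<le> 4 - 3 * real L powr (-1/3)" if "L \<ge> 1"
    using that
  proof (induction L rule: dec_induct)
    case (step L)
    define x where "x = real L powr (1/3)"
    define y where "y = real (Suc L) powr (1/3)"
    have pos: "0 < x" "0 < y" using step by (simp_all add: x_def y_def)
    have xy: "x \<le> y" unfolding x_def y_def by (intro powr_mono2) auto
    have cube: "(z powr (1/3)) ^ 3 = z" if "z > 0" for z :: real
    proof -
      have "(z powr (1/3)) ^ 3 = (z powr (1/3)) powr 3" by (simp add: powr_numeral)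
      also have "\<dots> = z" using that by (subst powr_powr) simp
      finally show ?thesis .
    qed
    have "y ^ 3 - x ^ 3 = 1" using step cube[of "real L"] cube[of "real (Suc L)"] by (simp add: x_def y_def)
    then have "(y - x) * (x * x + x * y + y * y) = 1" by (simp add: power3_eq_cube algebra_simps)
    moreover have "(y - x) * (x * x + x * y + y * y) \<le> (y - x) * (3 * (y * y))"
    proof (rule mult_left_mono)
      have "x * x \<le> y * y" "x * y \<le> y * y" using pos xy by (auto intro: mult_mono)
      then show "x * x + x * y + y * y \<le> 3 * (y * y)" by linarith
    qed (use xy in simp)
    ultimately have "1 / (y * y) \<le> 3 * (y - x)" using pos by (simp add: field_simps)
    then have "1 / (y * y) / (y * y) \<le> 3 * (y - x) / (x * y)"
      using pos xy by (intro frac_le mult_mono) auto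
    then have "1 / y ^ 4 \<le> 3 * (1 / x - 1 / y)" using pos by (simp add: power4_eq_xxxx field_simps)
    moreover have "real (Suc L) powr (-4/3) = 1 / y ^ 4"
    proof -
      have "y ^ 4 = y powr 4" using pos(2) by simp
      also have "\<dots> = real (Suc L) powr (4/3)" unfolding y_def by (subst powr_powr) simp
      finally show ?thesis by (simp add: powr_minus_divide)
    qed
    moreover have "real L powr (-1/3) = 1 / x" "real (Suc L) powr (-1/3) = 1 / y"
      by (simp_all add: x_def y_def powr_minus_divide)
    ultimately show ?case using step.IH by simp
  qed simp
  moreover have "0 \<le> real L powr (-1/3)" by simp
  ultimately show ?thesis by (cases "L \<ge> 1") (linarith, simp)
qed

text \<open>Romanov's convergence statement, by partial summation: the partial sums
  \<open>A t\<close> are at most \<open>9 * t powr (2/3)\<close>, so \<open>A t / t^2\<close> is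
  dominated by the convergent series of \<open>t powr (-4/3)\<close>.\<close>

lemma sum_order_weight_over_order_bounded:
  obtains C where "\<And>L. (\<Sum>t=1..L. order_weight t / real t) \<le> C"
proof -
  define A where "A = (\<lambda>x. \<Sum>t=1..x. order_weight t)"
  have A0: "A t \<ge> 0" for t by (auto simp: A_def intro: sum_nonneg order_weight_nonneg)
  have A: "A t \<le> 9 * real t powr (2/3)" if "t \<ge> 1" for t
  proof (rule power_le_imp_le_base)
    have "A t ^ 3 \<le> 729 * (real t)\<^sup>2" unfolding A_def using that by (rule sum_order_weight_cubed_le)
    also have "\<dots> = (9 * real t powr (2/3)) ^ 3"
    proof -
      have "(real t powr (2/3)) ^ 3 = (real t powr (2/3)) powr 3" by (simp add: powr_numeral)
      also have "\<dots> = real t powr (2/3 * 3)" by (rule powr_powr)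
      also have "\<dots> = (real t)\<^sup>2" by (simp add: powr_numeral)
      finally show ?thesis by (simp add: power_mult_distrib)
    qed
    finally show "A t ^ Suc 2 \<le> (9 * real t powr (2/3)) ^ Suc 2" by (simp only: numeral_3_eq_3 numeral_2_eq_2)
  qed simp
  have abel: "(\<Sum>t=1..L. order_weight t / real t) = A L / real (Suc L) + (\<Sum>t=1..L. A t / (real t * real (Suc t)))" for L
  proof (induction L)
    case (Suc L)
    have "A (Suc L) = A L + order_weight (Suc L)" by (simp add: A_def)
    then have "A L / real (Suc L) + order_weight (Suc L) / real (Suc L) = A (Suc L) / real (Suc L)"
      by (metis add_divide_distrib)
    also have "\<dots> = A (Suc L) / real (Suc (Suc L)) + A (Suc L) / (real (Suc L) * real (Suc (Suc L)))"
    proof -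
      have "y / u = y / (u + 1) + y / (u * (u + 1))" if "u > 0" for y u :: real
      proof -
        have "y / (u + 1) = y * u / (u * (u + 1))" using that by simp
        then have "y / (u + 1) + y / (u * (u + 1)) = y * (u + 1) / (u * (u + 1))"
          by (simp only: add_divide_distrib distrib_left mult_1_right)
        then show ?thesis using that by simp
      qed
      from this[of "real (Suc L)" "A (Suc L)"] show ?thesis by (simp add: add.commute)
    qed
    finally show ?case using Suc by simp
  qed (simp add: A_def)
  have "(\<Sum>t=1..L. order_weight t / real t) \<le> 9 + 9 * 4" for L
  proof (cases "L \<ge> 1")
    case True
    have "A L \<le> 9 * real L powr (2/3)" using True by (rule A)
    also have "\<dots> \<le> 9 * real L powr 1" using True by (intro mult_left_mono powr_mono) auto
    also have "\<dots> \<le> 9 * real (Suc L)" by simp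
    finally have 1: "A L / real (Suc L) \<le> 9" by (simp add: divide_simps)
    have "(\<Sum>t=1..L. A t / (real t * real (Suc t))) \<le> (\<Sum>t=1..L. 9 * real t powr (-4/3))"
    proof (rule sum_mono)
      fix t assume t: "t \<in> {1..L}"
      have "A t / (real t * real (Suc t)) \<le> 9 * real t powr (2/3) / (real t * real t)"
        using t A[of t] A0[of t] by (intro frac_le) auto
      also have "\<dots> = 9 * (real t powr (2/3) / real t powr 2)"
        using t by (simp add: power2_eq_square)
      also have "\<dots> = 9 * real t powr (-4/3)" by (simp only: powr_diff[symmetric]) simp
      finally show "A t / (real t * real (Suc t)) \<le> 9 * real t powr (-4/3)" .
    qed
    also have "\<dots> = 9 * (\<Sum>t=1..L. real t powr (-4/3))" by (simp only: sum_distrib_left)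
    also have "\<dots> \<le> 9 * 4" by (intro mult_left_mono sum_powr_four_thirds_le) simp
    finally show ?thesis unfolding abel using 1 by (intro add_mono)
  next
    case False
    then show ?thesis by simp
  qed
  then show ?thesis by (rule that)
qed

text \<open>The divisors of \<open>2 ^ j - 1\<close> are the \<open>d\<close> for which the order of
  2 divides \<open>j\<close>. After exchanging summations an order \<open>t\<close> is counted
  \<open>L div t\<close> times, which leaves \<open>L\<close> times the bounded sum of
  \<open>order_weight t / t\<close>.\<close>

theorem sum_prime_ratio_Mersenne_le:
  obtains C where "\<And>L. (\<Sum>j=1..L. prime_ratio (2 ^ j - 1)) \<le> C * real L"
proof -
  obtain C where C: "\<And>L. (\<Sum>t=1..L. order_weight t / real t) \<le> C"
    using sum_order_weight_over_order_bounded by blast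
  have "(\<Sum>j=1..L. prime_ratio (2 ^ j - 1)) \<le> 2 * C * real L" for L
  proof -
    have "(\<Sum>j=1..L. prime_ratio (2 ^ j - 1)) \<le> (\<Sum>j=1..L. \<Sum>t | t dvd j. 2 * order_weight t)"
    proof (rule sum_mono)
      fix j assume j: "j \<in> {1..L}"
      have pos: "(2::nat) ^ j - 1 > 0" using j by (intro Mersenne_pos) simp
      have cong: "[2 ^ t = 1] (mod d) \<longleftrightarrow> d dvd 2 ^ t - 1" for d t :: nat
        by (rule cong_altdef_nat) simp
      have eq: "{d. d dvd 2 ^ j - 1} = (\<Union>t\<in>{t. t dvd j}. divisors_with_order t)"
      proof (intro equalityI subsetI)
        fix d :: nat assume "d \<in> {d. d dvd 2 ^ j - 1}"
        then have "ord d 2 dvd j" using cong[of j d] ord_divides[of 2 j d] by auto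
        moreover have "d dvd 2 ^ ord d 2 - 1" using cong[of "ord d 2" d] ord[of 2 d] by simp
        ultimately show "d \<in> (\<Union>t\<in>{t. t dvd j}. divisors_with_order t)" by (auto simp: divisors_with_order_def)
      next
        fix d assume "d \<in> (\<Union>t\<in>{t. t dvd j}. divisors_with_order t)"
        then have "ord d 2 dvd j" by (auto simp: divisors_with_order_def)
        then show "d \<in> {d. d dvd 2 ^ j - 1}" using cong[of j d] ord_divides[of 2 j d] by auto
      qed
      have "prime_ratio (2 ^ j - 1) \<le> 2 * (\<Sum>d | d dvd 2 ^ j - 1. 1 / real d)"
        by (rule prime_ratio_le_sum_inverse_divisors[OF pos])
      also have "(\<Sum>d | d dvd 2 ^ j - 1. 1 / real d) = (\<Sum>t | t dvd j. order_weight t)"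
        unfolding eq order_weight_def
      proof (intro sum.UNION_disjoint ballI impI)
        show "finite {t. t dvd j}" using j by (intro finite_divisors_nat) simp
        fix t assume "t \<in> {t. t dvd j}"
        then have "t \<ge> 1" using j dvd_pos_nat[of j t] by simp
        then show "finite (divisors_with_order t)" by (rule finite_divisors_with_order)
      qed (auto simp: divisors_with_order_def)
      finally show "prime_ratio (2 ^ j - 1) \<le> (\<Sum>t | t dvd j. 2 * order_weight t)"
        by (simp add: sum_distrib_left)
    qed
    also have "\<dots> = (\<Sum>t=1..L. \<Sum>e=1..L div t. 2 * order_weight t)" by (rule sum_divisors_swap)
    also have "\<dots> \<le> (\<Sum>t=1..L. 2 * real L * (order_weight t / real t))"
    proof (rule sum_mono)
      fix t assume t: "t \<in> {1..L}"
      have "real t * real (L div t) \<le> real L" by (simp only: of_nat_mult[symmetric] of_nat_le_iff) simp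
      then have "real (L div t) \<le> real L / real t" using t by (simp add: field_simps)
      then have "real (L div t) * (2 * order_weight t) \<le> real L / real t * (2 * order_weight t)"
        using order_weight_nonneg[of t] by (intro mult_right_mono) auto
      then show "(\<Sum>e=1..L div t. 2 * order_weight t) \<le> 2 * real L * (order_weight t / real t)" by (simp add: mult_ac)
    qed
    also have "\<dots> = 2 * real L * (\<Sum>t=1..L. order_weight t / real t)" by (simp only: sum_distrib_left)
    also have "\<dots> \<le> 2 * real L * C" by (intro mult_left_mono C) simp
    finally show ?thesis by (simp add: mult_ac)
  qed
  then show ?thesis by (rule that)
qed


section \<open>Romanov's theorem in arithmetic progressions\<close>

lemma sum_squared_le_card_mult:
  fixes f :: "'a \<Rightarrow> real"
  shows "(\<Sum>i\<in>I. f i)\<^sup>2 \<le> real (card I) * (\<Sum>i\<in>I. (f i)\<^sup>2)"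
proof -
  have "0 \<le> (\<Sum>i\<in>I. \<Sum>j\<in>I. (f i - f j)\<^sup>2)" by (intro sum_nonneg) simp
  also have "\<dots> = (\<Sum>i\<in>I. \<Sum>j\<in>I. (f i)\<^sup>2 + (f j)\<^sup>2 - 2 * (f i * f j))"
    by (simp only: power2_diff mult.assoc)
  also have "\<dots> = 2 * (real (card I) * (\<Sum>i\<in>I. (f i)\<^sup>2)) - 2 * (\<Sum>i\<in>I. f i)\<^sup>2"
    by (simp add: sum.distrib sum_subtractf sum_distrib_left[symmetric] sum_distrib_right[symmetric]
        power2_eq_square)
  finally show ?thesis by simp
qed

text \<open>Cauchy--Schwarz over the fibres of \<open>f\<close>: the sum of their squared sizes
  counts the ordered coincidences, diagonal included.\<close>

lemma card_squared_le_coincidences: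
  assumes "finite A"
  shows "real (card A) ^ 2 \<le> real (card (f ` A)) * real (card {(x,y). x \<in> A \<and> y \<in> A \<and> f x = f y})"
proof -
  define c where "c = (\<lambda>s. real (card {x \<in> A. f x = s}))"
  have 1: "real (card A) = (\<Sum>s\<in>f ` A. c s)"
    using sum.image_gen[OF assms, of "\<lambda>_. 1::real" f] by (simp add: c_def)
  have "{(x,y). x \<in> A \<and> y \<in> A \<and> f x = f y} = (SIGMA x:A. {y \<in> A. f y = f x})" by auto
  then have "real (card {(x,y). x \<in> A \<and> y \<in> A \<and> f x = f y}) = (\<Sum>x\<in>A. c (f x))"
    using assms by (simp add: c_def card_SigmaI)
  also have "\<dots> = (\<Sum>s\<in>f ` A. \<Sum>x\<in>{x \<in> A. f x = s}. c (f x))" by (rule sum.image_gen[OF assms])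
  also have "\<dots> = (\<Sum>s\<in>f ` A. c s ^ 2)"
    by (intro sum.cong refl) (simp add: c_def power2_eq_square)
  finally have 2: "real (card {(x,y). x \<in> A \<and> y \<in> A \<and> f x = f y}) = (\<Sum>s\<in>f ` A. c s ^ 2)" .
  show ?thesis unfolding 1 2
    by (rule sum_squared_le_card_mult)
qed

text \<open>A coincidence \<open>p + 2 ^ k = q + 2 ^ l\<close> with \<open>k < l\<close> makes
  \<open>q\<close> and \<open>q + 2 ^ k * (2 ^ (l - k) - 1)\<close> a pair of primes and is
  determined by \<open>(k, l - k, q)\<close>. The two orders of \<open>k\<close> and
  \<open>l\<close> give the factor 2; equal exponents force equal primes, which is the
  diagonal.\<close>

lemma card_prime_power_coincidences:
  fixes P K :: "nat set"
  assumes P: "P \<subseteq> {p. p \<le> N \<and> prime p}" and K: "K \<subseteq> {1..L}"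
  shows "card {(x,y). x \<in> P \<times> K \<and> y \<in> P \<times> K \<and> fst x + 2 ^ snd x = fst y + 2 ^ snd y}
    \<le> card P * card K + 2 * (\<Sum>k=1..L. \<Sum>j=1..L. card {n. n < Suc N \<and> prime n \<and> prime (n + 2 ^ k * (2 ^ j - 1))})"
proof -
  define T where "T = (\<lambda>k j. {n. n < Suc N \<and> prime n \<and> prime (n + 2 ^ k * (2 ^ j - 1 :: nat))})"
  define W where "W = (SIGMA k:{1..L}. SIGMA j:{1..L}. T k j)"
  define D where "D = (\<lambda>x. (x, x :: nat \<times> nat)) ` (P \<times> K)"
  define U where "U = {(x,y). x \<in> P \<times> K \<and> y \<in> P \<times> K \<and> fst x + 2 ^ snd x = fst y + 2 ^ snd y \<and> snd x < snd y}"
  have finP: "finite P" using P by (rule finite_subset) (rule finite_subset[of _ "{..N}"], auto)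
  have finK: "finite K" using K finite_subset by blast
  have finT: "finite (T k j)" for k j unfolding T_def by (rule finite_subset[of _ "{..N}"]) auto
  have finW: "finite W" unfolding W_def using finT by (intro finite_SigmaI) auto
  have cW: "card W = (\<Sum>k=1..L. \<Sum>j=1..L. card (T k j))"
    unfolding W_def using finT by (subst card_SigmaI) (auto simp: card_SigmaI)
  have finU: "finite U"
    by (rule finite_subset[of _ "(P \<times> K) \<times> (P \<times> K)"]) (use finP finK in \<open>auto simp: U_def\<close>)
  define \<phi> :: "(nat \<times> nat) \<times> nat \<times> nat \<Rightarrow> nat \<times> nat \<times> nat"
    where "\<phi> = (\<lambda>(x,y). (snd x, snd y - snd x, fst y))"
  have U: "fst x = fst y + 2 ^ snd x * (2 ^ (snd y - snd x) - 1)" if "(x, y) \<in> U" for x y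
  proof -
    have "snd y = snd x + (snd y - snd x)" using that by (simp add: U_def)
    then have "(2::nat) ^ snd y = 2 ^ snd x * 2 ^ (snd y - snd x)" by (metis power_add)
    moreover have "fst x + 2 ^ snd x = fst y + 2 ^ snd y" using that by (simp add: U_def)
    ultimately show ?thesis by (simp add: diff_mult_distrib2)
  qed
  have "inj_on \<phi> U"
  proof (rule inj_onI)
    fix z z' assume z: "z \<in> U" "z' \<in> U" "\<phi> z = \<phi> z'"
    obtain x y x' y' where xy: "z = (x, y)" "z' = (x', y')" by (cases z, cases z') auto
    have s: "snd x = snd x'" "snd y - snd x = snd y' - snd x'" "fst y = fst y'"
      using z by (auto simp: \<phi>_def xy)
    have "snd x < snd y" "snd x' < snd y'" using z by (auto simp: U_def xy)
    with s have "snd y = snd y'" by linarith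
    moreover have "fst x = fst x'" using U[of x y] U[of x' y'] z s by (simp add: xy)
    ultimately show "z = z'" using s by (simp add: xy prod_eq_iff)
  qed
  moreover have "\<phi> ` U \<subseteq> W"
  proof
    fix w assume "w \<in> \<phi> ` U"
    then obtain p k q l where w: "w = \<phi> ((p,k),(q,l))" "((p,k),(q,l)) \<in> U" by auto
    from U[OF w(2)] have "p = q + 2 ^ k * (2 ^ (l - k) - 1)" by simp
    moreover have "prime p" "prime q" "q \<le> N" "1 \<le> k" "k \<le> L" "l \<le> L" "k < l"
      using w(2) P K by (auto simp: U_def)
    moreover from this have "1 \<le> l - k" "l - k \<le> L" by simp_all
    ultimately show "w \<in> W" unfolding w(1) by (simp add: \<phi>_def W_def T_def)
  qed
  ultimately have cU: "card U \<le> card W" using finW by (rule card_inj_on_le)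
  have "{(x,y). x \<in> P \<times> K \<and> y \<in> P \<times> K \<and> fst x + 2 ^ snd x = fst y + 2 ^ snd y} \<subseteq> D \<union> (U \<union> prod.swap ` U)"
  proof (rule subsetI)
    fix z assume z: "z \<in> {(x,y). x \<in> P \<times> K \<and> y \<in> P \<times> K \<and> fst x + 2 ^ snd x = fst y + 2 ^ snd y}"
    obtain x y where xy: "z = (x, y)" by (cases z) auto
    consider "snd x < snd y" | "snd y < snd x" | "snd x = snd y" by linarith
    then show "z \<in> D \<union> (U \<union> prod.swap ` U)"
    proof cases
      case 1
      then show ?thesis using z by (simp add: U_def xy)
    next
      case 2
      then have "(y, x) \<in> U" using z by (simp add: U_def xy)
      then show ?thesis unfolding xy by (metis UnI2 image_eqI swap_simp)
    next
      case 3
      then have "x = y" using z by (simp add: xy prod_eq_iff)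
      then show ?thesis using z by (simp add: D_def xy)
    qed
  qed
  then have "card {(x,y). x \<in> P \<times> K \<and> y \<in> P \<times> K \<and> fst x + 2 ^ snd x = fst y + 2 ^ snd y}
      \<le> card (D \<union> (U \<union> prod.swap ` U))"
    using finP finK finU by (intro card_mono) (auto simp: D_def)
  also have "\<dots> \<le> card D + (card U + card (prod.swap ` U))"
    by (intro order.trans[OF card_Un_le] add_left_mono card_Un_le)
  also have "\<dots> \<le> card P * card K + (card W + card W)"
  proof (intro add_mono)
    show "card D \<le> card P * card K"
      unfolding D_def card_cartesian_product[symmetric] using finP finK by (intro card_image_le) simp
    show "card (prod.swap ` U) \<le> card W" using card_image_le[OF finU] cU by (rule order.trans)
  qed (rule cU)
  finally show ?thesis unfolding cW T_def by simp
qed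

lemma prime_ratio_shifted_Mersenne:
  assumes "k \<ge> 1" "j \<ge> 1"
  shows "prime_ratio (2 ^ k * (2 ^ j - 1)) = 2 * prime_ratio (2 ^ j - 1)"
proof -
  have pos: "(2::nat) ^ j - 1 > 0" using assms(2) by (rule Mersenne_pos)
  have odd: "odd ((2::nat) ^ j - 1)" using assms(2) by simp
  have "prime_factors (2 ^ k * (2 ^ j - 1 :: nat)) = insert 2 (prime_factors (2 ^ j - 1))"
    using assms pos by (subst prime_factors_product) (auto simp: prime_factors_power prime_prime_factors)
  moreover have "2 \<notin> prime_factors ((2::nat) ^ j - 1)" using odd by auto
  ultimately show ?thesis by (simp add: prime_ratio_def)
qed

text \<open>A squarefree modulus has at most one factor 2, which \<open>2 ^ k\<close> absorbs as
  soon as \<open>k \<ge> 1\<close>; Euler's theorem handles the odd part.\<close>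

lemma squarefree_power_of_2_periodic:
  fixes M :: nat
  assumes "squarefree M" "M > 0"
  obtains u where "u > 0" "\<And>k i. k \<ge> 1 \<Longrightarrow> [2 ^ (k + u * i) = 2 ^ k] (mod M)"
proof -
  define M' where "M' = (if even M then M div 2 else M)"
  have M': "M' > 0" "M dvd 2 * M'" "odd M'"
  proof -
    show "M' > 0" using assms(2) by (auto simp: M'_def intro!: Nat.gr0I)
    show "M dvd 2 * M'" by (auto simp: M'_def)
    show "odd M'"
    proof
      assume "even M'"
      then have "even M" by (auto simp: M'_def split: if_splits)
      then have "2\<^sup>2 dvd M" using \<open>even M'\<close> by (auto simp: M'_def power2_eq_square elim!: dvdE)
      then have "2 dvd (1::nat)" using squarefreeD[OF assms(1)] by blast
      then show False by simp
    qed
  qed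
  define u where "u = totient M'"
  have "[2 ^ (k + u * i) = 2 ^ k] (mod M)" if "k \<ge> 1" for k i
  proof -
    have "[2 ^ u = 1] (mod M')" unfolding u_def using M'(3) by (intro euler_theorem) simp
    then have "[(2 ^ u) ^ i = 1 ^ i] (mod M')" by (rule cong_pow)
    then have "[2 ^ (u * i) = 1] (mod M')" by (simp add: power_mult)
    then have "M' dvd 2 ^ (u * i) - 1" by (subst (asm) cong_altdef_nat) auto
    then have "2 * M' dvd 2 ^ k * (2 ^ (u * i) - 1)"
      using that by (intro mult_dvd_mono) auto
    then have "M dvd 2 ^ k * (2 ^ (u * i) - 1)" using M'(2) dvd_trans by blast
    then have "M dvd 2 ^ (k + u * i) - 2 ^ k" by (simp add: power_add diff_mult_distrib2)
    then show ?thesis by (subst cong_altdef_nat) (auto intro: power_increasing)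
  qed
  moreover have "u > 0" using M'(1) by (simp add: u_def)
  ultimately show ?thesis using that by blast
qed

text \<open>The Romanov argument: by Cauchy--Schwarz, the number of distinct \<open>p + 2 ^ k\<close> is at least the
  square of the number of pairs divided by the number of coincidences.\<close>

theorem romanov_arithmetic_progression:
  fixes M b k0 :: nat
  assumes M: "squarefree M" "M > 0" and b: "coprime b M" and k0: "k0 \<ge> 1"
  obtains c where "c > 0" "eventually (\<lambda>N. c * real N \<le>
    real (card {n. n \<le> 2 * N \<and> (\<exists>p k. prime p \<and> 0 < k \<and> n = p + 2 ^ k \<and> [n = b + 2 ^ k0] (mod M))})) at_top"
proof -
  obtain u where u: "u > 0" and per: "\<And>k i. k \<ge> 1 \<Longrightarrow> [2 ^ (k + u * i) = 2 ^ k] (mod M)"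
    using squarefree_power_of_2_periodic[OF M] by blast
  obtain c where c: "c > 0" and primes: "eventually (\<lambda>N. c * real N / ln (real N)
      \<le> real (card {p. p \<le> N \<and> prime p \<and> [p = b] (mod M)})) at_top"
    using primes_arithmetic_progression_lower_bound[OF M b] by blast
  obtain R where R: "\<And>L. (\<Sum>j=1..L. prime_ratio (2 ^ j - 1)) \<le> R * real L"
    using sum_prime_ratio_Mersenne_le by blast
  have R0: "R \<ge> 0" using R[of 1] by (simp add: prime_ratio_def)
  define c2 where "c2 = c / (2 * real u)"
  have c2: "c2 > 0" using c u by (simp add: c2_def)
  \<comment> \<open>From \<open>2 * (2 * l) * (6976 * N / l^2) * (R * (2 * l))\<close>, where the
    two sums over \<open>k\<close> and \<open>j\<close> have length at most \<open>2 * l\<close>.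
    Here \<open>6976 = 1744 * 2 * 2\<close> combines the sieve constant,
    \<open>Suc N \<le> 2 * N\<close> and the prime 2 in the difference.\<close>
  define C where "C = 55808 * R"
  have C0: "C \<ge> 0" using R0 by (simp add: C_def)
  have key: "c2 / (1 + C / c2) * real N \<le>
    real (card {n. n \<le> 2 * N \<and> (\<exists>p k. prime p \<and> 0 < k \<and> n = p + 2 ^ k \<and> [n = b + 2 ^ k0] (mod M))})"
    if N: "N \<ge> 3" and pr: "c * real N / ln (real N) \<le> real (card {p. p \<le> N \<and> prime p \<and> [p = b] (mod M)})"
      and big: "(ln (real N) - 1 - real k0) / real u - 1 \<ge> ln (real N) / (2 * real u)" for N
  proof -
    define l where "l = ln (real N)"
    have l: "l > 0" using N by (simp add: l_def)
    define L where "L = nat \<lfloor>log 2 (real N)\<rfloor>"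
    have logN: "log 2 (real N) \<ge> 0" using N by simp
    have ln2: "1 / 2 \<le> ln (2::real)" using ln_le_minus_one[of "1 / 2 :: real"] by (simp add: ln_div)
    have L_le: "real L \<le> log 2 (real N)" using logN by (simp add: L_def)
    have log_le: "log 2 (real N) \<le> 2 * l"
    proof -
      have "log 2 (real N) = l / ln 2" by (simp add: log_def l_def)
      also have "\<dots> \<le> l / (1 / 2)" using ln2 l by (intro divide_left_mono) auto
      finally show ?thesis by simp
    qed
    have l_le: "l \<le> log 2 (real N)"
    proof -
      have "l / 1 \<le> l / ln 2" using ln_2_less_1 l by (intro divide_left_mono) auto
      then show ?thesis by (simp add: log_def l_def)
    qed
    have L_ge: "real L \<ge> l - 1" using l_le logN unfolding L_def by linarith
    have L2: "real L \<le> 2 * l" using L_le log_le by linarith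
    have pow: "2 ^ k \<le> N" if "k \<le> L" for k
    proof -
      have "real (2 ^ k) = 2 powr real k" by (simp add: powr_realpow)
      also have "\<dots> \<le> 2 powr log 2 (real N)" using that L_le by (intro powr_mono) auto
      also have "\<dots> = real N" using N by simp
      finally show ?thesis by (simp only: of_nat_le_iff)
    qed
    define I where "I = (L - k0) div u"
    \<comment> \<open>Exponents congruent to \<open>k0\<close> modulo the period keep
      \<open>2 ^ k\<close> in its residue class, so all sums \<open>p + 2 ^ k\<close> stay in the
      class of \<open>b + 2 ^ k0\<close>; exponents up to \<open>L\<close> keep
      \<open>2 ^ k \<le> N\<close>.\<close>
    define K where "K = (\<lambda>i. k0 + u * i) ` {..<I}"
    define P where "P = {p. p \<le> N \<and> prime p \<and> [p = b] (mod M)}"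
    have cK: "card K = I" unfolding K_def using u by (subst card_image) (auto simp: inj_on_def)
    have K: "K \<subseteq> {1..L}"
    proof
      fix k assume "k \<in> K"
      then obtain i where i: "k = k0 + u * i" "i < I" by (auto simp: K_def)
      then have "u * i < u * I" using u by simp
      also have "\<dots> \<le> L - k0" unfolding I_def by simp
      finally show "k \<in> {1..L}" using i k0 by simp
    qed
    have I_ge: "real I \<ge> l / (2 * real u)"
    proof -
      have "L - k0 < u * Suc I" unfolding I_def using dividend_less_times_div[OF u, of "L - k0"] by simp
      then have "L \<le> k0 + u * Suc I" by simp
      then have "real L \<le> real (k0 + u * Suc I)" by (rule of_nat_mono)
      then have "real L \<le> real k0 + real u * (real I + 1)" by (simp add: algebra_simps)
      then have "l - 1 - real k0 \<le> real u * (real I + 1)" using L_ge by linarith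
      then have "(l - 1 - real k0) / real u - 1 \<le> real I" using u by (simp add: field_simps)
      with big show ?thesis by (simp add: l_def)
    qed
    define Q where "Q = real (card P) * real (card K)"
    have Q: "Q \<ge> c2 * real N"
    proof -
      have "c * real N / l * (l / (2 * real u)) \<le> Q"
        unfolding Q_def cK using pr I_ge c l by (intro mult_mono) (auto simp: P_def l_def)
      then show ?thesis using l u by (simp add: c2_def)
    qed
    define S where "S = (\<lambda>x. fst x + 2 ^ snd x) ` (P \<times> K)"
    define coin where "coin = {(x,y). x \<in> P \<times> K \<and> y \<in> P \<times> K \<and> fst x + 2 ^ snd x = fst y + 2 ^ snd y}"
    have finP: "finite P" unfolding P_def by (rule finite_subset[of _ "{..N}"]) auto
    have finK: "finite K" by (simp add: K_def)
    have coin: "real (card coin) \<le> Q + C * real N"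
    proof -
      define t where "t = (\<lambda>k j. card {n. n < Suc N \<and> prime n \<and> prime (n + 2 ^ k * (2 ^ j - 1))})"
      have t: "real (t k j) \<le> 6976 * real N / l\<^sup>2 * prime_ratio (2 ^ j - 1)" if "k \<in> {1..L}" "j \<in> {1..L}" for k j
      proof -
        have "real (t k j) \<le> 1744 * real (Suc N) / (ln (real (Suc N)))\<^sup>2 * prime_ratio (2 ^ k * (2 ^ j - 1))"
          unfolding t_def using that N Mersenne_pos[of j] by (intro prime_pairs_upper_bound) auto
        also have "\<dots> = 1744 * real (Suc N) / (ln (real (Suc N)))\<^sup>2 * (2 * prime_ratio (2 ^ j - 1))"
          using that by (subst prime_ratio_shifted_Mersenne) auto
        also have "\<dots> \<le> 1744 * (2 * real N) / l\<^sup>2 * (2 * prime_ratio (2 ^ j - 1))"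
        proof (rule mult_right_mono)
          have "l\<^sup>2 \<le> (ln (real (Suc N)))\<^sup>2" using l N by (intro power_mono) (auto simp: l_def)
          then show "1744 * real (Suc N) / (ln (real (Suc N)))\<^sup>2 \<le> 1744 * (2 * real N) / l\<^sup>2"
            using l N by (intro frac_le) auto
          show "0 \<le> 2 * prime_ratio (2 ^ j - 1)" using prime_ratio_ge_1[of "2 ^ j - 1"] by simp
        qed
        also have "\<dots> = 6976 * real N / l\<^sup>2 * prime_ratio (2 ^ j - 1)" by simp
        finally show ?thesis .
      qed
      have "card coin \<le> card P * card K + 2 * (\<Sum>k=1..L. \<Sum>j=1..L. t k j)"
        unfolding coin_def t_def using K by (intro card_prime_power_coincidences) (auto simp: P_def)
      then have "real (card coin) \<le> real (card P * card K + 2 * (\<Sum>k=1..L. \<Sum>j=1..L. t k j))"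
        by (simp only: of_nat_le_iff)
      also have "\<dots> = Q + 2 * (\<Sum>k=1..L. \<Sum>j=1..L. real (t k j))" by (simp add: Q_def)
      also have "\<dots> \<le> Q + 2 * (\<Sum>k=1..L. \<Sum>j=1..L. 6976 * real N / l\<^sup>2 * prime_ratio (2 ^ j - 1))"
        using t by (intro add_left_mono mult_left_mono sum_mono) auto
      also have "\<dots> = Q + 2 * (real L * (6976 * real N / l\<^sup>2 * (\<Sum>j=1..L. prime_ratio (2 ^ j - 1))))"
        by (simp only: sum_distrib_left[symmetric] sum_constant card_atLeastAtMost) simp
      also have "\<dots> \<le> Q + 2 * (2 * l * (6976 * real N / l\<^sup>2 * (R * (2 * l))))"
      proof (intro add_left_mono mult_left_mono mult_mono L2)
        show "(\<Sum>j=1..L. prime_ratio (2 ^ j - 1)) \<le> R * (2 * l)"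
          using R[of L] mult_left_mono[OF L2 R0] by linarith
        show "0 \<le> 6976 * real N / l\<^sup>2 * (\<Sum>j=1..L. prime_ratio (2 ^ j - 1))"
          using prime_ratio_ge_1 by (intro mult_nonneg_nonneg sum_nonneg) (auto intro: order.trans[OF zero_le_one])
      qed (use l in auto)
      also have "\<dots> = Q + C * real N" using l by (simp add: C_def power2_eq_square)
      finally show ?thesis .
    qed
    have "Q\<^sup>2 \<le> real (card S) * real (card coin)"
      using card_squared_le_coincidences[of "P \<times> K" "\<lambda>x. fst x + 2 ^ snd x"] finP finK
      by (simp add: S_def coin_def Q_def)
    also have "\<dots> \<le> real (card S) * (Q * (1 + C / c2))"
    proof (rule mult_left_mono)
      \<comment> \<open>As \<open>Q\<close> itself is at least \<open>c2 * N\<close>, the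
        off-diagonal coincidences are absorbed into a multiple of \<open>Q\<close>, and one factor
        \<open>Q\<close> cancels in the Cauchy--Schwarz inequality.\<close>
      have "C * real N = (C / c2) * (c2 * real N)" using c2 by simp
      also have "\<dots> \<le> (C / c2) * Q" using Q C0 c2 by (intro mult_left_mono) auto
      finally show "real (card coin) \<le> Q * (1 + C / c2)" using coin by (simp add: algebra_simps)
    qed simp
    finally have "Q * Q \<le> Q * (real (card S) * (1 + C / c2))" by (simp add: power2_eq_square mult_ac)
    moreover have "Q > 0" using Q c2 N by (smt (verit) mult_pos_pos of_nat_0_less_iff less_le_trans zero_less_numeral)
    ultimately have "Q \<le> real (card S) * (1 + C / c2)" by simp
    then have "c2 * real N \<le> real (card S) * (1 + C / c2)" using Q by linarith
    moreover have "1 + C / c2 > 0" using C0 c2 by (simp add: add_pos_nonneg)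
    ultimately have "c2 / (1 + C / c2) * real N \<le> real (card S)" by (simp add: field_simps)
    also have "S \<subseteq> {n. n \<le> 2 * N \<and> (\<exists>p k. prime p \<and> 0 < k \<and> n = p + 2 ^ k \<and> [n = b + 2 ^ k0] (mod M))}"
    proof
      fix n assume "n \<in> S"
      then obtain p i where p: "p \<in> P" "i < I" "n = p + 2 ^ (k0 + u * i)" by (auto simp: S_def K_def)
      have "k0 + u * i \<in> {1..L}" using p K by (auto simp: K_def)
      then have "2 ^ (k0 + u * i) \<le> N" using pow by simp
      moreover have "[p + 2 ^ (k0 + u * i) = b + 2 ^ k0] (mod M)"
        using p per[OF k0] by (intro cong_add) (auto simp: P_def)
      moreover have "p \<le> N" "prime p" "0 < k0 + u * i" using p k0 by (simp_all add: P_def)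
      ultimately show "n \<in> {n. n \<le> 2 * N \<and> (\<exists>p k. prime p \<and> 0 < k \<and> n = p + 2 ^ k \<and> [n = b + 2 ^ k0] (mod M))}"
        using p(3) by (intro CollectI conjI exI[of _ p] exI[of _ "k0 + u * i"]) simp_all
    qed
    then have "card S \<le> card {n. n \<le> 2 * N \<and> (\<exists>p k. prime p \<and> 0 < k \<and> n = p + 2 ^ k \<and> [n = b + 2 ^ k0] (mod M))}"
      by (intro card_mono) auto
    finally show ?thesis by simp
  qed
  have big: "eventually (\<lambda>N. (ln (real N) - 1 - real k0) / real u - 1 \<ge> ln (real N) / (2 * real u)) at_top"
    using u by real_asymp
  have "eventually (\<lambda>N. c2 / (1 + C / c2) * real N \<le>
    real (card {n. n \<le> 2 * N \<and> (\<exists>p k. prime p \<and> 0 < k \<and> n = p + 2 ^ k \<and> [n = b + 2 ^ k0] (mod M))})) at_top"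
    using primes big eventually_ge_at_top[of 3] by eventually_elim (rule key)
  moreover have "c2 / (1 + C / c2) > 0" using C0 c2 by (simp add: add_pos_nonneg)
  ultimately show ?thesis using that by blast
qed


section \<open>Covering systems from the primes 3, 5, 7, 13, 17, 241\<close>

definition cover_primes :: "int list" where
  "cover_primes = [3, 5, 7, 13, 17, 241]"

definition power_rows :: "int list list" where
  "power_rows = [
     [1, 1, 1, 1, 1, 1], [2, 2, 2, 2, 2, 2], [1, 4, 4, 4, 4, 4], [2, 3, 1, 8, 8, 8],
     [1, 1, 2, 3, 16, 16], [2, 2, 4, 6, 15, 32], [1, 4, 1, 12, 13, 64], [2, 3, 2, 11, 9, 128],
     [1, 1, 4, 9, 1, 15], [2, 2, 1, 5, 2, 30], [1, 4, 2, 10, 4, 60], [2, 3, 4, 7, 8, 120],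
     [1, 1, 1, 1, 16, 240], [2, 2, 2, 2, 15, 239], [1, 4, 4, 4, 13, 237], [2, 3, 1, 8, 9, 233],
     [1, 1, 2, 3, 1, 225], [2, 2, 4, 6, 2, 209], [1, 4, 1, 12, 4, 177], [2, 3, 2, 11, 8, 113],
     [1, 1, 4, 9, 16, 226], [2, 2, 1, 5, 15, 211], [1, 4, 2, 10, 13, 181], [2, 3, 4, 7, 9, 121]]"

definition covering_residues :: "int list" where
  "covering_residues = [
     509203, 762701, 992077, 1247173, 1254341, 1330207, 1330319, 1730653, 1730681, 1976473,
     2313487, 2344211, 2554843, 3177553, 3292241, 3419789, 3423373, 3661529, 3661543, 3784439,
     4384979, 4442323, 4506097, 4507889, 4626967, 5049251, 5050147, 6610811, 7117807, 7576559,
     7629217, 8086751, 8101087, 8252819, 8253043, 8643209, 9053711, 9053767, 9545351, 9560713,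
     9666029, 10219379, 10280827, 10581097, 10609769, 10702091, 10913233, 10913681]"

text \<open>Chinese remaindering of the residue 1 modulo 2 with given residues modulo the cover primes; the
  coefficients are the idempotents modulo 11184810.\<close>

fun crt_residue :: "int list \<Rightarrow> int" where
  "crt_residue [r3, r5, r7, r13, r17, r241] =
     (5592405 + 7456540 * r3 + 6710886 * r5 + 7989150 * r7 + 8603700 * r13 + 2631720 * r17
        + 5754840 * r241) mod 11184810"
| "crt_residue _ = 0"

text \<open>For the row of \<open>2 ^ k\<close> and the residues of \<open>a\<close>, agreement in
  an entry means that the corresponding prime divides \<open>a - 2 ^ k\<close>. An entry
  \<open>-1\<close> agrees with no table entry, so it switches its prime off.\<close>

definition covered :: "int list \<Rightarrow> int list \<Rightarrow> bool" where
  "covered us rs = list_ex (\<lambda>(u, r). u = r) (zip us rs)"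

text \<open>Residue vectors are partial, with \<open>-1\<close> for an entry that is not yet chosen. Some entry has to be
  chosen so as to cover the first uncovered row.\<close>

fun choices :: "int list \<Rightarrow> int list \<Rightarrow> int list list" where
  "choices (r # rs) (t # ts) = (if r = -1 then [t # rs] else []) @ map ((#) r) (choices rs ts)"
| "choices _ _ = []"

primrec search :: "nat \<Rightarrow> int list \<Rightarrow> int list list \<Rightarrow> bool" where
  "search 0 rs rows = False"
| "search (Suc n) rs rows = (case filter (\<lambda>us. \<not> covered us rs) rows of
     [] \<Rightarrow> \<not> list_ex (\<lambda>r. r = -1) rs \<and> list_ex (\<lambda>x. x = crt_residue rs) covering_residues
   | ts # tss \<Rightarrow> list_all (\<lambda>rs'. search n rs' (ts # tss)) (choices rs ts))"

text \<open>Six choices fill the vector and the seventh level checks the leaf; level 0 counts as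
  failure, so success certifies that the depth suffices. A leaf covering all rows with an entry
  still open would also count as failure, because its completions are not determined.\<close>

lemma search_succeeds: "search 7 [-1, -1, -1, -1, -1, -1] power_rows"
  by code_simp

lemma power_rows_eq: "power_rows = map (\<lambda>k. map (\<lambda>q. 2 ^ k mod q) cover_primes) [0..<24]"
  by (simp add: power_rows_def cover_primes_def upt_rec)

lemma covering_residues_cover:
  "list_all (\<lambda>a. odd a \<and> 0 < a \<and> a < 11184810 \<and>
     list_all (\<lambda>us. covered us (map (\<lambda>q. a mod q) cover_primes)) power_rows) covering_residues"
  by code_simp

lemma covering_residues_minimal:
  "list_all (\<lambda>a. list_all (\<lambda>q.
     \<not> list_all (\<lambda>us. covered us (map (\<lambda>p. if p = q then -1 else a mod p) cover_primes)) power_rows)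
     cover_primes) covering_residues"
  by code_simp

text \<open>\<open>Rs\<close> agrees with \<open>ts\<close> in some entry. There \<open>rs\<close>
  must still be open, because a chosen entry equals that of \<open>Rs\<close> and would already
  cover \<open>ts\<close>; filling it is one of the choices.\<close>

lemma choices_complete:
  assumes "list_all2 (\<lambda>r R. r = -1 \<or> r = R) rs Rs" "covered ts Rs" "\<not> covered ts rs"
  shows "\<exists>rs'\<in>set (choices rs ts). list_all2 (\<lambda>r R. r = -1 \<or> r = R) rs' Rs"
  using assms
proof (induction rs Rs arbitrary: ts rule: list_all2_induct)
  case Nil
  then show ?case by (simp add: covered_def)
next
  case (Cons r rs R Rs)
  show ?case
  proof (cases ts)
    case Nil
    with Cons show ?thesis by (simp add: covered_def)
  next
    case ts: (Cons t ts')
    show ?thesis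
    proof (cases "t = R")
      case True
      then have "r = -1" using Cons ts by (auto simp: covered_def)
      then show ?thesis using Cons True by (auto simp: ts)
    next
      case False
      then have "\<exists>rs'\<in>set (choices rs ts'). list_all2 (\<lambda>r R. r = -1 \<or> r = R) rs' Rs"
        using Cons.prems by (intro Cons.IH) (auto simp: covered_def ts)
      then show ?thesis using Cons.hyps by (auto simp: ts)
    qed
  qed
qed

lemma search_sound:
  assumes "search n rs rows" "list_all2 (\<lambda>r R. r = -1 \<or> r = R) rs Rs" "\<forall>us\<in>set rows. covered us Rs"
  shows "crt_residue Rs \<in> set covering_residues"
  using assms
proof (induction n arbitrary: rs rows)
  case (Suc n)
  show ?case
  proof (cases "filter (\<lambda>us. \<not> covered us rs) rows")
    case Nil
    then have "-1 \<notin> set rs" "crt_residue rs \<in> set covering_residues"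
      using Suc.prems(1) by (auto simp: list_ex_iff)
    moreover have "rs = Rs"
      using Suc.prems(2) \<open>-1 \<notin> set rs\<close> by (induction rule: list_all2_induct) auto
    ultimately show ?thesis by simp
  next
    case (Cons ts tss)
    then have mem: "set (ts # tss) \<subseteq> set rows" "\<not> covered ts rs"
      by (metis filter_is_subset, metis (no_types, lifting) Cons_eq_filterD)
    then have "covered ts Rs" using Suc.prems(3) by auto
    then obtain rs' where rs': "rs' \<in> set (choices rs ts)" "list_all2 (\<lambda>r R. r = -1 \<or> r = R) rs' Rs"
      using choices_complete[OF Suc.prems(2) _ mem(2)] by blast
    have "search n rs' (ts # tss)"
      using Suc.prems(1) rs'(1) Cons by (simp add: list_all_iff)
    then show ?thesis by (rule Suc.IH) (use rs'(2) mem(1) Suc.prems(3) in auto)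
  qed
qed simp

text \<open>It suffices that \<open>S - a\<close> is divisible by 2 and by every cover prime. Modulo
  its own prime a residue has coefficient 1 in \<open>S\<close>, modulo the others 0. The explicit
  cofactors below are the coefficients divided by the prime in question, its own coefficient being
  first diminished by 1.\<close>

lemma crt_residue_eq:
  assumes "odd a"
  shows "crt_residue (map (\<lambda>q. a mod q) cover_primes) = a mod 11184810"
proof -
  define r3 d3 where "r3 = a mod 3" and "d3 = a div 3"
  have q3: "a = 3 * d3 + r3" by (simp add: r3_def d3_def)
  define r5 d5 where "r5 = a mod 5" and "d5 = a div 5"
  have q5: "a = 5 * d5 + r5" by (simp add: r5_def d5_def)
  define r7 d7 where "r7 = a mod 7" and "d7 = a div 7"
  have q7: "a = 7 * d7 + r7" by (simp add: r7_def d7_def)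
  define r13 d13 where "r13 = a mod 13" and "d13 = a div 13"
  have q13: "a = 13 * d13 + r13" by (simp add: r13_def d13_def)
  define r17 d17 where "r17 = a mod 17" and "d17 = a div 17"
  have q17: "a = 17 * d17 + r17" by (simp add: r17_def d17_def)
  define r241 d241 where "r241 = a mod 241" and "d241 = a div 241"
  have q241: "a = 241 * d241 + r241" by (simp add: r241_def d241_def)
  define S where "S = 5592405 + 7456540 * r3 + 6710886 * r5 + 7989150 * r7
    + 8603700 * r13 + 2631720 * r17 + 5754840 * r241"
  obtain b where b: "a = 2 * b + 1" using assms by (rule oddE)
  have "S - a = 2 * (2796202 + 3728270 * r3 + 3355443 * r5 + 3994575 * r7
      + 4301850 * r13 + 1315860 * r17 + 2877420 * r241 - b)"
    unfolding S_def using b by (simp add: algebra_simps)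
  then have dvd2: "2 dvd S - a" by (rule dvdI)
  have "S - a = 3 * (1864135 + 2485513 * r3 + 2236962 * r5 + 2663050 * r7
      + 2867900 * r13 + 877240 * r17 + 1918280 * r241 - d3)"
    unfolding S_def using q3 by (simp add: algebra_simps)
  then have dvd3: "3 dvd S - a" by (rule dvdI)
  have "S - a = 5 * (1118481 + 1491308 * r3 + 1342177 * r5 + 1597830 * r7
      + 1720740 * r13 + 526344 * r17 + 1150968 * r241 - d5)"
    unfolding S_def using q5 by (simp add: algebra_simps)
  then have dvd5: "5 dvd S - a" by (rule dvdI)
  have "S - a = 7 * (798915 + 1065220 * r3 + 958698 * r5 + 1141307 * r7
      + 1229100 * r13 + 375960 * r17 + 822120 * r241 - d7)"
    unfolding S_def using q7 by (simp add: algebra_simps)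
  then have dvd7: "7 dvd S - a" by (rule dvdI)
  have "S - a = 13 * (430185 + 573580 * r3 + 516222 * r5 + 614550 * r7
      + 661823 * r13 + 202440 * r17 + 442680 * r241 - d13)"
    unfolding S_def using q13 by (simp add: algebra_simps)
  then have dvd13: "13 dvd S - a" by (rule dvdI)
  have "S - a = 17 * (328965 + 438620 * r3 + 394758 * r5 + 469950 * r7
      + 506100 * r13 + 154807 * r17 + 338520 * r241 - d17)"
    unfolding S_def using q17 by (simp add: algebra_simps)
  then have dvd17: "17 dvd S - a" by (rule dvdI)
  have "S - a = 241 * (23205 + 30940 * r3 + 27846 * r5 + 33150 * r7
      + 35700 * r13 + 10920 * r17 + 23879 * r241 - d241)"
    unfolding S_def using q241 by (simp add: algebra_simps)
  then have dvd241: "241 dvd S - a" by (rule dvdI)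
  have "coprime (3::int) 2" "coprime (5::int) 6" "coprime (7::int) 30" "coprime (13::int) 210"
    "coprime (17::int) 2730" "coprime (241::int) 46410"
    by (simp_all add: prime_imp_coprime)
  with dvd2 dvd3 dvd5 dvd7 dvd13 dvd17 dvd241
  have "241 * (17 * (13 * (7 * (5 * (3 * 2))))) dvd S - a"
    by (intro divides_mult) simp_all
  then have "S mod 11184810 = a mod 11184810" by (simp add: mod_eq_dvd_iff)
  moreover have "crt_residue (map (\<lambda>q. a mod q) cover_primes) = S mod 11184810"
    by (simp only: cover_primes_def list.map crt_residue.simps S_def r3_def r5_def r7_def r13_def
        r17_def r241_def)
  ultimately show ?thesis by (simp only:)
qed


section \<open>Quasi-non-representable progressions\<close>

lemma finite_counting_set: "finite {n \<in> A. 1 \<le> n \<and> real_of_int n \<le> x}"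
  by (rule finite_subset[of _ "{1..\<lfloor>x\<rfloor>}"]) (auto simp: le_floor_iff)

lemma density_zero_mono:
  assumes "A \<subseteq> B" "has_asymptotic_density B 0"
  shows "has_asymptotic_density A 0"
  unfolding has_asymptotic_density_def
proof (rule tendsto_sandwich[of "\<lambda>_. 0"])
  show "((\<lambda>x::real. real (card {n \<in> B. 1 \<le> n \<and> real_of_int n \<le> x}) / x) \<longlongrightarrow> 0) at_top"
    using assms(2) by (simp add: has_asymptotic_density_def)
  show "\<forall>\<^sub>F x::real in at_top. real (card {n \<in> A. 1 \<le> n \<and> real_of_int n \<le> x}) / x
      \<le> real (card {n \<in> B. 1 \<le> n \<and> real_of_int n \<le> x}) / x"
    using eventually_gt_at_top[of 0]
    by eventually_elim
      (use assms(1) finite_counting_set in \<open>auto intro!: divide_right_mono card_mono\<close>)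
  show "\<forall>\<^sub>F x::real in at_top. 0 \<le> real (card {n \<in> A. 1 \<le> n \<and> real_of_int n \<le> x}) / x"
    using eventually_gt_at_top[of 0] by eventually_elim simp
qed simp

lemma density_zero_Un:
  assumes "has_asymptotic_density A 0" "has_asymptotic_density B 0"
  shows "has_asymptotic_density (A \<union> B) 0"
  unfolding has_asymptotic_density_def
proof (rule tendsto_sandwich[of "\<lambda>_. 0"])
  show "((\<lambda>x::real. real (card {n \<in> A. 1 \<le> n \<and> real_of_int n \<le> x}) / x
      + real (card {n \<in> B. 1 \<le> n \<and> real_of_int n \<le> x}) / x) \<longlongrightarrow> 0) at_top"
    using tendsto_add[of _ 0 at_top _ 0] assms by (simp add: has_asymptotic_density_def)
  show "\<forall>\<^sub>F x::real in at_top. real (card {n \<in> A \<union> B. 1 \<le> n \<and> real_of_int n \<le> x}) / x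
      \<le> real (card {n \<in> A. 1 \<le> n \<and> real_of_int n \<le> x}) / x
        + real (card {n \<in> B. 1 \<le> n \<and> real_of_int n \<le> x}) / x"
    using eventually_gt_at_top[of 0]
  proof eventually_elim
    case (elim x)
    have "{n \<in> A \<union> B. 1 \<le> n \<and> real_of_int n \<le> x}
        = {n \<in> A. 1 \<le> n \<and> real_of_int n \<le> x} \<union> {n \<in> B. 1 \<le> n \<and> real_of_int n \<le> x}" by auto
    then have "card {n \<in> A \<union> B. 1 \<le> n \<and> real_of_int n \<le> x}
        \<le> card {n \<in> A. 1 \<le> n \<and> real_of_int n \<le> x} + card {n \<in> B. 1 \<le> n \<and> real_of_int n \<le> x}"
      by (simp add: card_Un_le)
    then have "real (card {n \<in> A \<union> B. 1 \<le> n \<and> real_of_int n \<le> x})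
        \<le> real (card {n \<in> A. 1 \<le> n \<and> real_of_int n \<le> x}) + real (card {n \<in> B. 1 \<le> n \<and> real_of_int n \<le> x})"
      by (simp only: of_nat_add[symmetric] of_nat_le_iff)
    then show ?case using elim by (simp only: add_divide_distrib[symmetric] divide_right_mono less_imp_le)
  qed
  show "\<forall>\<^sub>F x::real in at_top. 0 \<le> real (card {n \<in> A \<union> B. 1 \<le> n \<and> real_of_int n \<le> x}) / x"
    using eventually_gt_at_top[of 0] by eventually_elim simp
qed simp

lemma density_zero_empty: "has_asymptotic_density {} 0"
  by (simp add: has_asymptotic_density_def)

lemma density_zero_UN:
  assumes "finite I" "\<And>i. i \<in> I \<Longrightarrow> has_asymptotic_density (A i) 0"
  shows "has_asymptotic_density (\<Union>i\<in>I. A i) 0"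
  using assms by (induction I rule: finite_induct) (auto intro: density_zero_Un density_zero_empty)

lemma density_zero_shifted_powers:
  assumes "c \<ge> 0"
  shows "has_asymptotic_density (range (\<lambda>k::nat. c + 2 ^ k)) 0"
  unfolding has_asymptotic_density_def
proof (rule tendsto_sandwich[of "\<lambda>_. 0"])
  show "((\<lambda>x::real. (log 2 x + 1) / x) \<longlongrightarrow> 0) at_top" by real_asymp
  show "\<forall>\<^sub>F x::real in at_top. real (card {n \<in> range (\<lambda>k::nat. c + 2 ^ k). 1 \<le> n \<and> real_of_int n \<le> x}) / x
      \<le> (log 2 x + 1) / x"
    using eventually_ge_at_top[of 1]
  proof eventually_elim
    case (elim x)
    define l where "l = nat \<lfloor>log 2 x\<rfloor>"
    have "{n \<in> range (\<lambda>k::nat. c + 2 ^ k). 1 \<le> n \<and> real_of_int n \<le> x} \<subseteq> (\<lambda>k. c + 2 ^ k) ` {..l}"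
    proof
      fix n assume "n \<in> {n \<in> range (\<lambda>k::nat. c + 2 ^ k). 1 \<le> n \<and> real_of_int n \<le> x}"
      then obtain k where k: "n = c + 2 ^ k" "real_of_int n \<le> x" by auto
      then have "2 ^ k \<le> x" using assms by simp
      then have "log 2 (2 ^ k) \<le> log 2 x" using elim by (subst log_le_cancel_iff) auto
      then have "real k \<le> log 2 x" by (simp add: log_nat_power)
      then have "k \<le> l" unfolding l_def by (simp add: le_nat_floor)
      with k show "n \<in> (\<lambda>k. c + 2 ^ k) ` {..l}" by auto
    qed
    then have "card {n \<in> range (\<lambda>k::nat. c + 2 ^ k). 1 \<le> n \<and> real_of_int n \<le> x} \<le> card {..l}"
      by (rule surj_card_le[rotated]) simp
    then have "real (card {n \<in> range (\<lambda>k::nat. c + 2 ^ k). 1 \<le> n \<and> real_of_int n \<le> x}) \<le> real (Suc l)"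
      by (simp only: of_nat_le_iff card_atMost)
    also have "\<dots> \<le> log 2 x + 1" using elim by (simp add: l_def)
    finally show ?case using elim by (intro divide_right_mono) auto
  qed
  show "\<forall>\<^sub>F x::real in at_top. 0 \<le> real (card {n \<in> range (\<lambda>k::nat. c + 2 ^ k). 1 \<le> n \<and> real_of_int n \<le> x}) / x"
    using eventually_gt_at_top[of 0] by eventually_elim simp
qed simp

text \<open>The counting bound is \<open>2 * N\<close> because sums of a prime and a power of 2,
  both up to \<open>N\<close>, lie below it. Along \<open>x = 2 * N\<close> the quotient stays at
  least \<open>c / 2\<close>.\<close>

lemma not_density_zero_linear:
  assumes "c > 0" "eventually (\<lambda>N. c * real N \<le> real (card {n \<in> A. 1 \<le> n \<and> n \<le> int (2 * N)})) at_top"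
  shows "\<not> has_asymptotic_density A 0"
proof
  assume "has_asymptotic_density A 0"
  then have lim: "((\<lambda>x::real. real (card {n \<in> A. 1 \<le> n \<and> real_of_int n \<le> x}) / x) \<longlongrightarrow> 0) at_top"
    by (simp add: has_asymptotic_density_def)
  have "filterlim (\<lambda>N::nat. 2 * real N) at_top at_top" by real_asymp
  from filterlim_compose[OF lim this]
  have "(\<lambda>N. real (card {n \<in> A. 1 \<le> n \<and> real_of_int n \<le> 2 * real N}) / (2 * real N)) \<longlonglongrightarrow> 0" .
  from order_tendstoD(2)[OF this, of "c / 2"] assms(1)
  have "eventually (\<lambda>N. real (card {n \<in> A. 1 \<le> n \<and> real_of_int n \<le> 2 * real N}) / (2 * real N) < c / 2) at_top"
    by simp
  with assms(2) eventually_ge_at_top[of 1]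
  have "eventually (\<lambda>N::nat. False) at_top"
  proof eventually_elim
    case (elim N)
    have "{n \<in> A. 1 \<le> n \<and> real_of_int n \<le> 2 * real N} = {n \<in> A. 1 \<le> n \<and> n \<le> int (2 * N)}" by auto
    then show ?case using elim by (simp add: field_simps)
  qed
  then show False by simp
qed

lemma progression_not_density_zero:
  assumes "m > 0"
  shows "\<not> has_asymptotic_density (progression m a) 0"
proof (rule not_density_zero_linear[of "1 / (2 * real_of_int m)"])
  have key: "1 / (2 * real_of_int m) * real N \<le> real (card {n \<in> progression m a. 1 \<le> n \<and> n \<le> int (2 * N)})"
    if N: "int N \<ge> \<bar>a\<bar> * (1 + m)" "int N \<ge> 2 * m" for N
  proof -
    define K where "K = nat (int N div m)"
    \<comment> \<open>Starting at index \<open>\<bar>a\<bar>\<close> makes all members positive,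
      whatever the sign of \<open>a\<close>.\<close>
    define \<phi> where "\<phi> = (\<lambda>i. a + m * (\<bar>a\<bar> + int i))"
    have inj: "inj_on \<phi> {1..K}" using assms by (auto simp: inj_on_def \<phi>_def)
    have "\<phi> ` {1..K} \<subseteq> {n \<in> progression m a. 1 \<le> n \<and> n \<le> int (2 * N)}"
    proof
      fix n assume "n \<in> \<phi> ` {1..K}"
      then obtain i where i: "1 \<le> i" "i \<le> K" "n = a + m * (\<bar>a\<bar> + int i)" by (auto simp: \<phi>_def)
      have "1 * (\<bar>a\<bar> + int i) \<le> m * (\<bar>a\<bar> + int i)" using assms by (intro mult_right_mono) auto
      moreover have "- a \<le> \<bar>a\<bar>" by simp
      ultimately have "1 \<le> n" using i(1) unfolding i(3) mult_1 by linarith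
      have "int i \<le> int N div m" using i(2) assms by (simp add: K_def nat_le_iff le_nat_iff pos_imp_zdiv_nonneg_iff)
      then have "m * int i \<le> m * (int N div m)" using assms by (intro mult_left_mono) auto
      also have "\<dots> \<le> int N" using assms by (metis add_le_cancel_left mult_div_mod_eq le_add_same_cancel1 pos_mod_sign)
      finally have "n \<le> int N + int N" using i(3) N(1) by (simp add: algebra_simps)
      moreover have "n \<in> progression m a"
        unfolding progression_def i(3) by (intro CollectI exI[of _ "nat \<bar>a\<bar> + i"]) simp
      ultimately show "n \<in> {n \<in> progression m a. 1 \<le> n \<and> n \<le> int (2 * N)}" using \<open>1 \<le> n\<close> by simp
    qed
    moreover have "finite {n \<in> progression m a. 1 \<le> n \<and> n \<le> int (2 * N)}"
      by (rule finite_subset[of _ "{1..int (2 * N)}"]) auto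
    ultimately have "card {1..K} \<le> card {n \<in> progression m a. 1 \<le> n \<and> n \<le> int (2 * N)}"
      using inj by (intro card_inj_on_le[of \<phi>]) auto
    then have K: "real K \<le> real (card {n \<in> progression m a. 1 \<le> n \<and> n \<le> int (2 * N)})" by simp
    define r where "r = int N mod m"
    have "int K = int N div m" using assms by (simp add: K_def pos_imp_zdiv_nonneg_iff)
    then have "int N = m * int K + r" by (simp add: r_def)
    moreover have "r < m" using assms by (simp add: r_def)
    ultimately have "int N \<le> m * int K + m" by linarith
    with N(2) have "int N \<le> 2 * (m * int K)" by linarith
    then have "real_of_int (int N) \<le> real_of_int (2 * (m * int K))" by (simp only: of_int_le_iff)
    then have "real N \<le> real K * (2 * real_of_int m)" by (simp add: mult_ac)
    then have "1 / (2 * real_of_int m) * real N \<le> real K" using assms by (simp add: field_simps)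
    with K show ?thesis by linarith
  qed
  show "eventually (\<lambda>N. 1 / (2 * real_of_int m) * real N \<le> real (card {n \<in> progression m a. 1 \<le> n \<and> n \<le> int (2 * N)})) at_top"
  proof (rule eventually_sequentiallyI)
    fix N assume "nat (\<bar>a\<bar> * (1 + m) + 2 * m) \<le> N"
    then have "\<bar>a\<bar> * (1 + m) + 2 * m \<le> int N" by (simp add: nat_le_iff)
    moreover have "0 \<le> \<bar>a\<bar> * (1 + m)" using assms by simp
    ultimately show "1 / (2 * real_of_int m) * real N \<le> real (card {n \<in> progression m a. 1 \<le> n \<and> n \<le> int (2 * N)})"
      using assms by (intro key) linarith+
  qed
qed (use assms in simp)

text \<open>For \<open>b\<close> congruent to the unit \<open>a - 2 ^ k\<close>, Romanov's theorem
  in the class of \<open>b + 2 ^ k\<close>, which is that of \<open>a\<close>, yields a positive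
  proportion of representable numbers.\<close>

lemma squarefree_coprime_not_quasi_nonrepresentable:
  assumes sq: "squarefree (nat m)" and k: "k \<ge> 1" and cop: "coprime (a - 2 ^ k) m"
  shows "\<not> quasi_nonrepresentable m a"
proof
  assume "quasi_nonrepresentable m a"
  then have m: "m > 0" and dens: "has_asymptotic_density (progression m a - nonrepresentable) 0"
    by (auto simp: quasi_nonrepresentable_def)
  define M where "M = nat m"
  define b where "b = nat ((a - 2 ^ k) mod m)"
  have mM: "m = int M" using m by (simp add: M_def)
  have b: "int b = (a - 2 ^ k) mod m" using m by (simp add: b_def)
  have "coprime (int b) (int M)" unfolding b mM[symmetric] using cop m by (simp add: coprime_mod_left_iff)
  then have cb: "coprime b M" by simp
  obtain c where c: "c > 0" and ev: "eventually (\<lambda>N. c * real N \<le>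
    real (card {n. n \<le> 2 * N \<and> (\<exists>p k'. prime p \<and> 0 < k' \<and> n = p + 2 ^ k' \<and> [n = b + 2 ^ k] (mod M))})) at_top"
    using romanov_arithmetic_progression[of M b k] sq m cb k by (auto simp: M_def)
  define A where "A = progression m a - nonrepresentable"
  have "eventually (\<lambda>N. c / 2 * real N \<le> real (card {n \<in> A. 1 \<le> n \<and> n \<le> int (2 * N)})) at_top"
  proof -
    \<comment> \<open>The progression begins at \<open>a\<close>, so sums below
      \<open>\<bar>a\<bar>\<close> in the residue class are discarded; this constant loss costs at
      most half of the linear bound.\<close>
    have large: "eventually (\<lambda>N. c / 2 * real N \<ge> real (nat \<bar>a\<bar>)) at_top" using c by real_asymp
    show ?thesis using ev large
    proof eventually_elim
      case (elim N)
      define S where "S = {n. n \<le> 2 * N \<and> (\<exists>p k'. prime p \<and> 0 < k' \<and> n = p + 2 ^ k' \<and> [n = b + 2 ^ k] (mod M))}"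
      have finS: "finite S" by (rule finite_subset[of _ "{..2 * N}"]) (auto simp: S_def)
      have "int ` (S - {..<nat \<bar>a\<bar>}) \<subseteq> {n \<in> A. 1 \<le> n \<and> n \<le> int (2 * N)}"
      proof
        fix z assume "z \<in> int ` (S - {..<nat \<bar>a\<bar>})"
        then obtain n where "z = int n" "\<not> n < nat \<bar>a\<bar>" "n \<in> S" by auto
        then obtain p k' where n: "z = int n" "\<not> n < nat \<bar>a\<bar>" "n \<le> 2 * N" "prime p" "0 < k'" "n = p + 2 ^ k'"
          "[n = b + 2 ^ k] (mod M)" unfolding S_def by blast
        have "[int n = int b + 2 ^ k] (mod m)" unfolding mM using n(7) by (simp add: cong_int_iff[symmetric])
        also have "[int b + 2 ^ k = (a - 2 ^ k) + 2 ^ k] (mod m)" unfolding b by (intro cong_add) auto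
        finally have "[int n = a] (mod m)" by simp
        then have "m dvd int n - a" by (simp add: cong_iff_dvd_diff)
        then obtain t where t: "int n - a = m * t" by blast
        have "0 \<le> m * t" using n(2) t by linarith
        then have "0 \<le> t" using m by (simp add: zero_le_mult_iff)
        then have "z \<in> progression m a"
          unfolding progression_def using t n(1) by (intro CollectI exI[of _ "nat t"]) simp
        moreover have "z \<notin> nonrepresentable"
          using n by (auto simp: nonrepresentable_def)
        moreover have "1 \<le> n" using n(6) prime_ge_1_nat[OF n(4)] by simp
        then have "1 \<le> z" unfolding n(1) by simp
        ultimately show "z \<in> {n \<in> A. 1 \<le> n \<and> n \<le> int (2 * N)}" using n(1,3) by (simp add: A_def)
      qed
      moreover have "finite {n \<in> A. 1 \<le> n \<and> n \<le> int (2 * N)}"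
        by (rule finite_subset[of _ "{1..int (2 * N)}"]) auto
      ultimately have "card (S - {..<nat \<bar>a\<bar>}) \<le> card {n \<in> A. 1 \<le> n \<and> n \<le> int (2 * N)}"
        by (intro card_inj_on_le[of int]) auto
      moreover have "card S \<le> card (S - {..<nat \<bar>a\<bar>}) + nat \<bar>a\<bar>"
        using diff_card_le_card_Diff[of "{..<nat \<bar>a\<bar>}" S] by simp
      ultimately have "real (card S) \<le> real (card {n \<in> A. 1 \<le> n \<and> n \<le> int (2 * N)}) + real (nat \<bar>a\<bar>)"
        by (simp only: of_nat_add[symmetric] of_nat_le_iff)
      then show ?case using elim unfolding S_def[symmetric] by linarith
    qed
  qed
  then have "\<not> has_asymptotic_density A 0" using c by (intro not_density_zero_linear[of "c / 2"]) auto
  with dens show False by (simp add: A_def)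
qed

text \<open>Even numbers are never in \<open>nonrepresentable\<close>, so no infinite subprogression
  of even numbers is possible. An odd modulus would give one of modulus \<open>2 * m\<close>,
  starting at \<open>a\<close> or at \<open>a + m\<close>.\<close>

lemma quasi_nonrepresentable_parity:
  assumes "quasi_nonrepresentable m a"
  shows "even m" "odd a"
proof -
  from assms have m: "m > 0" and dens: "has_asymptotic_density (progression m a - nonrepresentable) 0"
    by (auto simp: quasi_nonrepresentable_def)
  have no_even: False if "progression m' a' \<subseteq> progression m a" "even m'" "even a'" "m' > 0" for m' a'
  proof -
    have "progression m' a' \<subseteq> progression m a - nonrepresentable"
      using that by (auto simp: progression_def nonrepresentable_def)
    from density_zero_mono[OF this dens] progression_not_density_zero[OF that(4)] show False by simp
  qed
  show "even m"
  proof (rule ccontr)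
    assume odd: "odd m"
    define e :: int where "e = (if even a then 0 else 1)"
    have "progression (2 * m) (a + m * e) \<subseteq> progression m a"
    proof
      fix n assume "n \<in> progression (2 * m) (a + m * e)"
      then obtain h where "n = 2 * m * int h + (a + m * e)" by (auto simp: progression_def)
      then show "n \<in> progression m a"
        unfolding progression_def
        by (intro CollectI exI[of _ "2 * h + nat e"]) (simp add: e_def algebra_simps)
    qed
    moreover have "even (a + m * e)" using odd by (cases "even a") (simp_all add: e_def)
    ultimately show False using no_even[of "2 * m" "a + m * e"] m by simp
  qed
  then show "odd a" using no_even[of m a] m by blast
qed


lemma quasi_nonrepresentable_iff:
  assumes sq: "squarefree (nat m)" and m: "m > 0" "even m"
  shows "quasi_nonrepresentable m a \<longleftrightarrow> 0 < a \<and> odd a \<and> (\<forall>k\<ge>1. \<not> coprime (a - 2 ^ k) m)"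
proof
  assume qn: "quasi_nonrepresentable m a"
  then show "0 < a \<and> odd a \<and> (\<forall>k\<ge>1. \<not> coprime (a - 2 ^ k) m)"
    using quasi_nonrepresentable_parity(2)[OF qn] squarefree_coprime_not_quasi_nonrepresentable[OF sq]
    by (auto simp: quasi_nonrepresentable_def)
next
  assume a: "0 < a \<and> odd a \<and> (\<forall>k\<ge>1. \<not> coprime (a - 2 ^ k) m)"
  have "progression m a - nonrepresentable \<subseteq> (\<Union>p\<in>prime_factors (nat m). range (\<lambda>k::nat. int p + 2 ^ k))"
  proof
    fix n assume n: "n \<in> progression m a - nonrepresentable"
    then obtain h where h: "n = m * int h + a" by (auto simp: progression_def)
    then have "0 < n" "odd n" using a m by (auto intro: add_nonneg_pos)
    then obtain p k where pk: "prime p" "0 < k" "n = int p + 2 ^ k"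
      using n by (auto simp: nonrepresentable_def)
    then have "\<not> coprime (a - 2 ^ k) m" using a by (simp add: Suc_le_eq)
    then obtain d where d: "d dvd a - 2 ^ k" "d dvd m" "\<not> is_unit d" by (auto simp: coprime_def)
    then have "d dvd int p"
    proof -
      have "int p = m * int h + (a - 2 ^ k)" using h pk(3) by simp
      then show ?thesis using d by simp
    qed
    moreover have "prime (int p)" using pk(1) by simp
    \<comment> \<open>A non-unit divisor of the prime \<open>p\<close> is associated to
      \<open>p\<close>; this puts \<open>p\<close> among the finitely many primes dividing
      \<open>m\<close>.\<close>
    ultimately have "int p dvd d" using d(3) prime_elem_iff_prime_abs
      by (metis prime_imp_prime_elem prime_elem_dvd_cases not_is_unit_0 irreducible_altdef prime_elem_imp_irreducible)
    then have "int p dvd m" using d(2) dvd_trans by blast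
    then have "p dvd nat m" using m by (metis int_dvd_int_iff int_nat_eq less_imp_le)
    then have "p \<in> prime_factors (nat m)" using pk(1) m by (simp add: prime_factors_dvd)
    then show "n \<in> (\<Union>p\<in>prime_factors (nat m). range (\<lambda>k::nat. int p + 2 ^ k))" using pk(3) by blast
  qed
  moreover have "has_asymptotic_density (\<Union>p\<in>prime_factors (nat m). range (\<lambda>k::nat. int p + 2 ^ k)) 0"
    by (intro density_zero_UN density_zero_shifted_powers) auto
  ultimately have "has_asymptotic_density (progression m a - nonrepresentable) 0"
    by (rule density_zero_mono)
  then show "quasi_nonrepresentable m a" using a m by (simp add: quasi_nonrepresentable_def)
qed

section \<open>Transfer between the modulus 11184810 and the covering table\<close>

lemma prime_cover_primes: "q \<in> set cover_primes \<Longrightarrow> prime q"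
  by (auto simp: cover_primes_def)

lemma squarefree_modulus: "squarefree (11184810::nat)"
proof -
  have "squarefree (2 * (3 * (5 * (7 * (13 * (17 * 241))))) :: nat)"
    by (intro squarefree_mult_coprime prime_imp_coprime squarefree_prime) simp_all
  then show ?thesis by simp
qed

lemma prime_dvd_prod_list_primes:
  fixes q :: int
  assumes "prime q" "q dvd prod_list ps" "\<And>p. p \<in> set ps \<Longrightarrow> prime p"
  shows "q \<in> set ps"
  using assms(2,3)
proof (induction ps)
  case Nil
  then show ?case using assms(1) by auto
next
  case (Cons p ps)
  then show ?case using assms(1) primes_dvd_imp_eq[of q p] by (auto simp: prime_dvd_mult_iff)
qed

lemma coprime_prod_list:
  fixes x :: int
  assumes "\<And>p. p \<in> set ps \<Longrightarrow> coprime x p"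
  shows "coprime x (prod_list ps)"
  using assms by (induction ps) auto

lemma coprime_cover_prime:
  assumes "p \<in> set cover_primes" "\<not> p dvd x"
  shows "coprime x p"
  using prime_imp_coprime[OF prime_cover_primes[OF assms(1)] assms(2)] by (simp add: coprime_commute)

lemma coprime_modulus_iff:
  "coprime x 11184810 \<longleftrightarrow> odd x \<and> (\<forall>q\<in>set cover_primes. \<not> q dvd x)" for x :: int
proof
  assume cop: "coprime x 11184810"
  have "q dvd 11184810" "\<not> is_unit q" if "q \<in> set (2 # cover_primes)" for q
    using that by (auto simp: cover_primes_def)
  then have "\<not> q dvd x" if "q \<in> set (2 # cover_primes)" for q
    using that cop by (meson coprime_common_divisor)
  then show "odd x \<and> (\<forall>q\<in>set cover_primes. \<not> q dvd x)" by simp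
next
  assume x: "odd x \<and> (\<forall>q\<in>set cover_primes. \<not> q dvd x)"
  then have "coprime x p" if "p \<in> set (2 # cover_primes)" for p
    using that coprime_cover_prime[of p x] by (auto simp: coprime_right_2_iff_odd)
  then have "coprime x (prod_list (2 # cover_primes))" by (rule coprime_prod_list)
  then show "coprime x 11184810" by (simp add: cover_primes_def)
qed

lemma coprime_cofactor:
  assumes "odd x" "q \<in> set cover_primes" "\<And>p. p \<in> set cover_primes \<Longrightarrow> p \<noteq> q \<Longrightarrow> \<not> p dvd x"
  shows "coprime x (11184810 div q)"
proof -
  have "coprime x p" if "p \<in> set (2 # removeAll q cover_primes)" for p
    using that assms coprime_cover_prime[of p x] by (auto simp: coprime_right_2_iff_odd)
  then have "coprime x (prod_list (2 # removeAll q cover_primes))" by (rule coprime_prod_list)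
  moreover have "prod_list (2 # removeAll q cover_primes) = 11184810 div q"
    using assms(2) by (auto simp: cover_primes_def)
  ultimately show ?thesis by (simp only:)
qed

lemma power_of_2_mod_period:
  assumes "q \<in> set cover_primes"
  shows "(2::int) ^ (k + 24) mod q = 2 ^ k mod q"
proof -
  have "(2::int) ^ 24 mod q = 1 mod q" using assms by (auto simp: cover_primes_def)
  then have "(2::int) ^ k * 2 ^ 24 mod q = 2 ^ k * 1 mod q" by (metis mod_mult_right_eq)
  then show ?thesis by (simp only: power_add mult_1_right)
qed

lemma power_of_2_mod_24:
  assumes "q \<in> set cover_primes"
  shows "(2::int) ^ k mod q = 2 ^ (k mod 24) mod q"
  using periodic_mod[of "\<lambda>k. (2::int) ^ k mod q" 24 k] power_of_2_mod_period[OF assms] by simp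

lemma covered_power_row_iff:
  assumes "k < 24"
  shows "covered (power_rows ! k) (map f cover_primes) \<longleftrightarrow> (\<exists>q\<in>set cover_primes. 2 ^ k mod q = f q)"
  using assms by (simp add: power_rows_eq covered_def zip_map_map list_ex_iff zip_same_conv_map)

lemma dvd_diff_power_iff:
  assumes "q \<in> set cover_primes"
  shows "q dvd a - 2 ^ k \<longleftrightarrow> 2 ^ (k mod 24) mod q = a mod q"
  unfolding power_of_2_mod_24[OF assms, of k, symmetric] mod_eq_dvd_iff[of "2 ^ k" q a]
  by (rule dvd_diff_commute)

lemma length_power_rows: "length power_rows = 24"
  by (simp add: power_rows_eq)

lemma covering_imp_residue:
  assumes "odd a" "\<forall>k\<ge>1. \<not> coprime (a - 2 ^ k) 11184810"
  shows "a mod 11184810 \<in> set covering_residues"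
proof -
  define R where "R = map (\<lambda>q. a mod q) cover_primes"
  have "covered us R" if us: "us \<in> set power_rows" for us
  proof -
    obtain k where k: "k < 24" "us = power_rows ! k"
      using us length_power_rows by (metis in_set_conv_nth)
    \<comment> \<open>Rows are numbered from 0 while exponents start at 1, so row \<open>k\<close>
      is represented by the exponent \<open>k + 24\<close>.\<close>
    have "\<not> coprime (a - 2 ^ (k + 24)) 11184810" using assms(2) by simp
    then obtain q where q: "q \<in> set cover_primes" "q dvd a - 2 ^ (k + 24)"
      using assms(1) by (auto simp: coprime_modulus_iff)
    then have "2 ^ k mod q = a mod q" using k(1) by (simp add: dvd_diff_power_iff)
    then show ?thesis unfolding k(2) R_def using q(1) covered_power_row_iff[OF k(1)] by blast
  qed
  moreover have "list_all2 (\<lambda>r R. r = -1 \<or> r = R) [-1, -1, -1, -1, -1, -1] R"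
    by (simp add: R_def cover_primes_def)
  ultimately have "crt_residue R \<in> set covering_residues"
    using search_sound[OF search_succeeds] by blast
  then show ?thesis unfolding R_def crt_residue_eq[OF assms(1)] .
qed

lemma covering_residuesD:
  assumes "a \<in> set covering_residues"
  shows "odd a" "0 < a" "a < 11184810" "k \<ge> 1 \<Longrightarrow> \<not> coprime (a - 2 ^ k) 11184810"
proof -
  have all: "odd a \<and> 0 < a \<and> a < 11184810 \<and>
      list_all (\<lambda>us. covered us (map (\<lambda>q. a mod q) cover_primes)) power_rows"
    using covering_residues_cover assms by (simp add: list_all_iff)
  then show "odd a" "0 < a" "a < 11184810" by blast+
  have "k mod 24 < 24" by simp
  then have "covered (power_rows ! (k mod 24)) (map (\<lambda>q. a mod q) cover_primes)"
    using all length_power_rows by (simp add: list_all_length)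
  then obtain q where "q \<in> set cover_primes" "2 ^ (k mod 24) mod q = a mod q"
    using covered_power_row_iff[OF \<open>k mod 24 < 24\<close>] by blast
  then show "\<not> coprime (a - 2 ^ k) 11184810"
    using dvd_diff_power_iff coprime_modulus_iff by blast
qed

text \<open>At an exponent whose row only \<open>q\<close> covers, \<open>a - 2 ^ k\<close> shares
  no factor with the modulus deprived of \<open>q\<close>. This rules out every larger progression
  whose modulus lacks \<open>q\<close>.\<close>

lemma covering_residues_cofactor:
  assumes "a \<in> set covering_residues" "q \<in> set cover_primes"
  shows "\<exists>k\<ge>1. coprime (a - 2 ^ k) (11184810 div q)"
proof -
  have "\<not> list_all (\<lambda>us. covered us (map (\<lambda>p. if p = q then -1 else a mod p) cover_primes)) power_rows"
    using covering_residues_minimal assms by (simp add: list_all_iff)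
  then obtain k where k: "k < 24" "\<not> covered (power_rows ! k) (map (\<lambda>p. if p = q then -1 else a mod p) cover_primes)"
    using length_power_rows by (auto simp: list_all_length)
  have "coprime (a - 2 ^ (k + 24)) (11184810 div q)"
  proof (rule coprime_cofactor[OF _ assms(2)])
    show "odd (a - 2 ^ (k + 24))" using covering_residuesD(1)[OF assms(1)] by simp
    fix p assume p: "p \<in> set cover_primes" "p \<noteq> q"
    then show "\<not> p dvd a - 2 ^ (k + 24)"
      using k(2) unfolding covered_power_row_iff[OF k(1)] using k(1) by (auto simp: dvd_diff_power_iff)
  qed
  then show ?thesis by (intro exI[of _ "k + 24"]) simp
qed

lemma progression_subset_iff:
  assumes "m > 0" "m' > 0"
  shows "progression m a \<subseteq> progression m' a' \<longleftrightarrow> m' dvd m \<and> m' dvd a - a' \<and> a' \<le> a"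
proof
  assume sub: "progression m a \<subseteq> progression m' a'"
  have "a \<in> progression m a" by (auto simp: progression_def intro: exI[of _ 0])
  moreover have "m + a \<in> progression m a" by (auto simp: progression_def intro: exI[of _ 1])
  ultimately have "a \<in> progression m' a'" "m + a \<in> progression m' a'" using sub by blast+
  then obtain h0 h1 where h: "a = m' * int h0 + a'" "m + a = m' * int h1 + a'"
    unfolding progression_def by blast
  then have "m = m' * (int h1 - int h0)" by (simp add: algebra_simps)
  then have "m' dvd m" by (rule dvdI)
  then show "m' dvd m \<and> m' dvd a - a' \<and> a' \<le> a" using h(1) assms by simp
next
  assume *: "m' dvd m \<and> m' dvd a - a' \<and> a' \<le> a"
  then obtain s t where st: "m = m' * s" "a - a' = m' * t" by (auto elim!: dvdE)
  have "0 \<le> m' * t" using * st(2) by linarith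
  then have "0 \<le> t" "0 \<le> s" using assms st(1) by (simp_all add: zero_le_mult_iff zero_less_mult_iff)
  show "progression m a \<subseteq> progression m' a'"
  proof
    fix n assume "n \<in> progression m a"
    then obtain h where h: "n = m * int h + a" by (auto simp: progression_def)
    have "n = m' * (s * int h + t) + a'" unfolding h st(1) using st(2) by (simp add: algebra_simps)
    then show "n \<in> progression m' a'"
      unfolding progression_def using \<open>0 \<le> t\<close> \<open>0 \<le> s\<close>
      by (intro CollectI exI[of _ "nat (s * int h + t)"]) simp
  qed
qed

theorem theorem3:
  fixes a :: int
  shows "longest_quasi_nonrepresentable 11184810 a \<longleftrightarrow>
    a \<in> {509203, 762701, 992077, 1247173, 1254341, 1330207, 1330319, 1730653, 1730681,
      1976473, 2313487, 2344211, 2554843, 3177553, 3292241, 3419789, 3423373, 3661529,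
      3661543, 3784439, 4384979, 4442323, 4506097, 4507889, 4626967, 5049251, 5050147,
      6610811, 7117807, 7576559, 7629217, 8086751, 8101087, 8252819, 8253043, 8643209,
      9053711, 9053767, 9545351, 9560713, 9666029, 10219379, 10280827, 10581097,
      10609769, 10702091, 10913233, 10913681}"
proof -
  define M :: int where "M = 11184810"
  have M: "M > 0" "even M" "squarefree (nat M)" using squarefree_modulus by (simp_all add: M_def)
  have qn_iff: "quasi_nonrepresentable M a \<longleftrightarrow> 0 < a \<and> odd a \<and> (\<forall>k\<ge>1. \<not> coprime (a - 2 ^ k) M)" for a
    by (rule quasi_nonrepresentable_iff[OF M(3,1,2)])
  have "longest_quasi_nonrepresentable M a \<longleftrightarrow> a \<in> set covering_residues"
  proof
    assume long: "longest_quasi_nonrepresentable M a"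
    then have a: "0 < a" "odd a" "\<forall>k\<ge>1. \<not> coprime (a - 2 ^ k) M"
      using qn_iff by (auto simp: longest_quasi_nonrepresentable_def)
    \<comment> \<open>Otherwise \<open>a - M\<close> would be a smaller positive first term
      satisfying the same conditions, and its progression would be strictly longer;
      \<open>a = M\<close> is excluded by parity.\<close>
    have "a < M"
    proof (rule ccontr)
      assume "\<not> a < M"
      then have "a > M" using a(2) M(2) by (cases "a = M") auto
      have "\<not> coprime (a - M - 2 ^ k) M" if "k \<ge> 1" for k
      proof -
        have "gcd (a - M - 2 ^ k) M = gcd (a - 2 ^ k) M"
          using gcd_add_mult[of M "-1" "a - 2 ^ k"] by (simp add: gcd.commute algebra_simps)
        then show ?thesis using a(3) that by (simp only: coprime_iff_gcd_eq_1) simp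
      qed
      then have "quasi_nonrepresentable M (a - M)"
        unfolding qn_iff using \<open>a > M\<close> a(2) M(2) by auto
      moreover have "progression M a \<subset> progression M (a - M)"
        using progression_subset_iff[OF M(1) M(1), of a "a - M"]
          progression_subset_iff[OF M(1) M(1), of "a - M" a] M(1) by auto
      ultimately show False using long by (auto simp: longest_quasi_nonrepresentable_def)
    qed
    then show "a \<in> set covering_residues"
      using covering_imp_residue[OF a(2)] a(1,3) by (simp add: M_def)
  next
    assume a: "a \<in> set covering_residues"
    note aD = covering_residuesD[OF a]
    have "quasi_nonrepresentable M a" unfolding qn_iff using aD by (simp add: M_def)
    moreover have False if qn': "quasi_nonrepresentable m' a'" and sub: "progression M a \<subset> progression m' a'" for m' a'
    proof -
      have m': "m' > 0" "0 < a'" using qn' by (auto simp: quasi_nonrepresentable_def)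
      have dvd: "m' dvd M" "m' dvd a - a'" "a' \<le> a"
        using sub progression_subset_iff[OF M(1) m'(1)] by auto
      obtain t where t: "M = m' * t" using dvd(1) by blast
      have tpos: "t > 0" using t M(1) m'(1) by (simp add: zero_less_mult_iff)
      show False
      proof (cases "t = 1")
        case True
        \<comment> \<open>For equal moduli both first terms lie strictly between 0 and
          \<open>M\<close>, so congruence makes them equal and the inclusion is not proper.\<close>
        have "\<bar>a - a'\<bar> < M" using dvd(3) m'(2) aD(3) by (simp add: M_def)
        then have "a = a'" using dvd(2) t True zdvd_not_zless[of "a - a'" M] dvd(3) by force
        then show False using sub t True by simp
      next
        case False
        then have "\<not> is_unit t" using tpos by simp
        then obtain q where q: "prime q" "q dvd t"
          using tpos prime_divisor_exists[of t] by auto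
        have "q dvd M" using q(2) t by simp
        have "q dvd prod_list (2 # cover_primes)" using \<open>q dvd M\<close> by (simp add: M_def cover_primes_def)
        then have "q \<in> set (2 # cover_primes)"
          using prime_cover_primes by (intro prime_dvd_prod_list_primes[OF q(1)]) auto
        \<comment> \<open>By parity \<open>m'\<close> keeps the factor 2, so a factor 2 in the
          cofactor \<open>t\<close> would make 4 divide \<open>M\<close>.\<close>
        moreover have "q \<noteq> 2"
        proof
          assume "q = 2"
          moreover have "even m'" using quasi_nonrepresentable_parity(1)[OF qn'] .
          ultimately have "2 * 2 dvd M" unfolding t using q(2) by (intro mult_dvd_mono) auto
          then show False by (simp add: M_def)
        qed
        ultimately have qc: "q \<in> set cover_primes" by simp
        obtain k where k: "k \<ge> 1" "coprime (a - 2 ^ k) (M div q)"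
          using covering_residues_cofactor[OF a qc] by (auto simp: M_def)
        \<comment> \<open>Thus the exponent \<open>k\<close> that is coprime for
          \<open>M div q\<close> is coprime for \<open>m'\<close> as well, and it stays so after
          replacing \<open>a\<close> by the congruent \<open>a'\<close>; the Romanov half then
          contradicts \<open>qn'\<close>.\<close>
        have "m' dvd M div q" using q t by (auto elim!: dvdE)
        then have "coprime (a - 2 ^ k) m'" using k(2) coprime_divisors[OF dvd_refl] by blast
        moreover have "[a - 2 ^ k = a' - 2 ^ k] (mod m')" using dvd(2) by (simp add: cong_iff_dvd_diff)
        ultimately have "coprime (a' - 2 ^ k) m'" by (rule cong_imp_coprime[rotated])
        moreover have "squarefree (nat m')"
          using M(3) dvd(1) m'(1) M(1) by (intro squarefree_mono[of "nat m'" "nat M"]) (simp_all add: nat_dvd_iff)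
        ultimately show False
          using squarefree_coprime_not_quasi_nonrepresentable[OF _ k(1)] qn' by blast
      qed
    qed
    ultimately show "longest_quasi_nonrepresentable M a"
      unfolding longest_quasi_nonrepresentable_def by blast
  qed
  then show ?thesis by (simp add: M_def covering_residues_def)
qed

end
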